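(* Let $\mathbf{Mlc}$ be the category of set-sized bounded modular lattices and modular connections, with its upper-interval-quotient--lower-interval-embedding factorization system. Let $\mathcal C$ have a specified proper factorization system $(\mathcal E,\mathcal M)$, pullbacks of two $\mathcal M$-arrows with common codomain, and pushouts of two $\mathcal E$-arrows with common domain. Then $\mathcal C$ has a noetherian form inducing $(\mathcal E,\mathcal M)$ if and only if there is a transfer functor $\mathcal C\to\mathbf{Mlc}$ for these systems. Thus $\mathbf{Mlc}$ is a universal target. Moreover, with $\mathbf{Set}$ and $\mathbf{Ab}$ equipped with their surjection--injection systems, the composite $$\mathbf{Set}\xrightarrow{\ \mathbb Z^{(-)}\ }\mathbf{Ab}\xrightarrow{\ S\ }\mathbf{Mlc},\qquad X\longmapsto\operatorname{Sub}\bigl(\mathbb Z^{(X)}\bigr),$$ is a transfer functor, where $\mathbb Z^{(-)}$ is the free abelian group functor and $S$ sends an abelian group $A$ to its subgroup lattice $\operatorname{Sub}(A)$ and a homomorphism $h$ to the pair (subgroup direct image along $h$, subgroup inverse image along $h$).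
   Context: The category $\mathbf{Mlc}$: an arrow $f:L\to M$ between bounded modular lattices is a modular connection, i.e. an adjunction of monotone maps $f_!:L\rightleftarrows M:f^*$ ($f_!x\le y\iff x\le f^*y$) with $f^*f_!(x)=x\vee f^*(0_M)$ and $f_!f^*(y)=y\wedge f_!(1_L)$ for all $x\in L,\ y\in M$. Composition uses composition of left adjoints and reverse composition of right adjoints. Its specified proper factorization system has as left class, up to isomorphism, the upper-interval quotients $q_a:L\to[a,1_L]$ with $(q_a)_!(x)=x\vee a$, $q_a^*(z)=z$, and as right class, up to isomorphism, the lower-interval embeddings $j_a:[0_L,a]\to L$ with $(j_a)_!(z)=z$, $j_a^*(x)=x\wedge a$ ($a\in L$). "Universal target": a category $\mathcal D$ with a specified proper factorization system, pullbacks of two right-class morphisms and pushouts of two left-class morphisms, such that for every $\mathcal C$ with a specified system as in the claim, $\mathcal C$ has a noetherian form inducing its system iff there is a transfer functor $\mathcal C\to\mathcal D$. Conventions: categories are locally small; "set" is relative to a fixed universe. A conservative functor is one that reflects isomorphisms. A proper factorization system $(\mathcal E,\mathcal M)$ is an orthogonal factorization system with every morphism in $\mathcal E$ an epimorphism and every morphism in $\mathcal M$ a monomorphism. Transfer functors. Let $\mathcal C,\mathcal D$ have specified proper factorization systems $(\mathcal E_{\mathcal C},\mathcal M_{\mathcal C})$, $(\mathcal E_{\mathcal D},\mathcal M_{\mathcal D})$, and suppose both have pullbacks of two right-class morphisms with common codomain and pushouts of two left-class morphisms with common domain. A transfer functor $T:\mathcal C\to\mathcal D$ is a conservative functor with $T(\mathcal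 E_{\mathcal C})\subseteq\mathcal E_{\mathcal D}$, $T(\mathcal M_{\mathcal C})\subseteq\mathcal M_{\mathcal D}$, preserving pullbacks of two $\mathcal M_{\mathcal C}$-morphisms and pushouts of two $\mathcal E_{\mathcal C}$-morphisms. Forms. An (orean) form $\mathsf F$ on a category $\mathcal C$ assigns to each object $X$ a set-sized bounded lattice $\mathsf F(X)$ (the fibre over $X$; its elements are called clusters) and to each morphism $f:X\to Y$ monotone maps $f_!:\mathsf F(X)\to\mathsf F(Y)$ and $f^*:\mathsf F(Y)\to\mathsf F(X)$ with $f_!S\le T\iff S\le f^*T$, such that $(gf)_!=g_!f_!$, $(gf)^*=f^*g^*$, and identities act as identities. Put $\operatorname{Im}f=f_!\top_X$ and $\operatorname{Ker}f=f^*\bot_Y$. A cluster in $\mathsf F(X)$ is conormal if it is the image of some morphism of $\mathcal C$ with codomain $X$, and normal if it is the kernel of some morphism of $\mathcal C$ with domain $X$. An embedding of a conormal $S\in\mathsf F(X)$ is a morphism $\iota$ into $X$ with $\operatorname{Im}\iota=S$ such that every morphism $f$ into $X$ with $\operatorname{Im}f\le S$ factors as $f=\iota h$ for a unique $h$. A quotient of a normal $K\in\mathsf F(X)$ is a morphism $\pi$ out of $X$ with $\operatorname{Ker}\pi=K$ such that every morphism $g$ out of $X$ with $K\le\operatorname{Ker}g$ factors as $g=h\pi$ for a unique $h$. The form is noetherian if: (N1) $f^*f_!S=S\vee\operatorname{Ker}f$ and $f_!f^*T=T\wedge\operatorname{Im}f$ for all $f,S,T$; (N2) every morphism $f$ factors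 as $f=me$ with $e$ a quotient of $\operatorname{Ker}f$ and $m$ an embedding of $\operatorname{Im}f$; (N3) the join of two normal clusters (in the same fibre) is normal, and the meet of two conormal clusters is conormal. For a noetherian form, the class $\mathcal E$ of all quotients (of normal clusters) and the class $\mathcal M$ of all embeddings (of conormal clusters) form a proper factorization system, the one induced by the form. *)

theory Defs
  imports
    "HOL-Algebra.Free_Abelian_Groups"
    "HOL-Algebra.Galois_Connection"
begin

unbundle cardinal_syntax

section \<open>The universe\<close>

text \<open>
  The fixed universe is represented by a type \<open>'u\<close> whose cardinal is uncountable and strongly
  inaccessible.  A set over any type is small (``set-sized'') if it has fewer elements than \<open>'u\<close>.
  Every small set is then equipotent to a small subset of \<open>'u\<close>, and likewise to a small subset of
  any type at least as large as \<open>'u\<close>.  Hence small structures with carriers in such a type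
  represent all small structures up to isomorphism.
\<close>

definition small :: "'u itself \<Rightarrow> 'x set \<Rightarrow> bool" where
  "small (U :: 'u itself) A \<longleftrightarrow> |A| <o |UNIV :: 'u set|"

definition inaccessible_universe :: "'u itself \<Rightarrow> bool" where
  "inaccessible_universe (U :: 'u itself) \<longleftrightarrow>
     natLeq <o |UNIV :: 'u set| \<and>
     regularCard |UNIV :: 'u set| \<and>
     (\<forall>A :: 'u set. small U A \<longrightarrow> small U (Pow A))"


section \<open>Categories with a specified proper factorization system\<close>

text \<open>\<open>Comp C g f\<close> is the composite \<open>g \<circ> f\<close>; it is meaningful only if \<open>Cod C f = Dom C g\<close>.\<close>

record ('o, 'a) category =
  Obj  :: "'o set"
  Arr  :: "'a set"
  Dom  :: "'a \<Rightarrow> 'o"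
  Cod  :: "'a \<Rightarrow> 'o"
  Id   :: "'o \<Rightarrow> 'a"
  Comp :: "'a \<Rightarrow> 'a \<Rightarrow> 'a"

record ('o, 'a) system_category = "('o, 'a) category" +
  Left  :: "'a set"
  Right :: "'a set"

definition Hom :: "('o, 'a, 'm) category_scheme \<Rightarrow> 'o \<Rightarrow> 'o \<Rightarrow> 'a set" where
  "Hom C X Y = {f \<in> Arr C. Dom C f = X \<and> Cod C f = Y}"

locale locally_small_category =
  fixes U :: "'u itself" and C :: "('o, 'a, 'm) category_scheme"
  assumes dom_obj: "f \<in> Arr C \<Longrightarrow> Dom C f \<in> Obj C"
    and cod_obj: "f \<in> Arr C \<Longrightarrow> Cod C f \<in> Obj C"
    and id_hom: "X \<in> Obj C \<Longrightarrow> Id C X \<in> Hom C X X"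
    and comp_hom: "\<lbrakk>f \<in> Hom C X Y; g \<in> Hom C Y Z\<rbrakk> \<Longrightarrow> Comp C g f \<in> Hom C X Z"
    and comp_id: "f \<in> Hom C X Y \<Longrightarrow> Comp C f (Id C X) = f"
    and id_comp: "f \<in> Hom C X Y \<Longrightarrow> Comp C (Id C Y) f = f"
    and comp_assoc: "\<lbrakk>f \<in> Hom C X Y; g \<in> Hom C Y Z; h \<in> Hom C Z W\<rbrakk> \<Longrightarrow>
           Comp C h (Comp C g f) = Comp C (Comp C h g) f"
    and small_hom: "\<lbrakk>X \<in> Obj C; Y \<in> Obj C\<rbrakk> \<Longrightarrow> small U (Hom C X Y)"

definition iso_arrow :: "('o, 'a, 'm) category_scheme \<Rightarrow> 'a \<Rightarrow> bool" where
  "iso_arrow C f \<longleftrightarrow> f \<in> Arr C \<and>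
     (\<exists>g \<in> Hom C (Cod C f) (Dom C f).
        Comp C g f = Id C (Dom C f) \<and> Comp C f g = Id C (Cod C f))"

definition epi_arrow :: "('o, 'a, 'm) category_scheme \<Rightarrow> 'a \<Rightarrow> bool" where
  "epi_arrow C f \<longleftrightarrow> f \<in> Arr C \<and>
     (\<forall>Z. \<forall>g \<in> Hom C (Cod C f) Z. \<forall>h \<in> Hom C (Cod C f) Z. Comp C g f = Comp C h f \<longrightarrow> g = h)"

definition mono_arrow :: "('o, 'a, 'm) category_scheme \<Rightarrow> 'a \<Rightarrow> bool" where
  "mono_arrow C f \<longleftrightarrow> f \<in> Arr C \<and>
     (\<forall>Z. \<forall>g \<in> Hom C Z (Dom C f). \<forall>h \<in> Hom C Z (Dom C f). Comp C f g = Comp C f h \<longrightarrow> g = h)"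

definition isomorphic_arrows :: "('o, 'a, 'm) category_scheme \<Rightarrow> 'a \<Rightarrow> 'a \<Rightarrow> bool" where
  "isomorphic_arrows C f g \<longleftrightarrow> f \<in> Arr C \<and> g \<in> Arr C \<and>
     (\<exists>i \<in> Hom C (Dom C f) (Dom C g). \<exists>j \<in> Hom C (Cod C f) (Cod C g).
        iso_arrow C i \<and> iso_arrow C j \<and> Comp C j f = Comp C g i)"

definition orthogonal_arrows :: "('o, 'a, 'm) category_scheme \<Rightarrow> 'a \<Rightarrow> 'a \<Rightarrow> bool" where
  "orthogonal_arrows C e m \<longleftrightarrow>
     (\<forall>u \<in> Hom C (Dom C e) (Dom C m). \<forall>v \<in> Hom C (Cod C e) (Cod C m).
        Comp C m u = Comp C v e \<longrightarrow>
        (\<exists>!d. d \<in> Hom C (Cod C e) (Dom C m) \<and> Comp C d e = u \<and> Comp C m d = v))"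

text \<open>\<open>p\<close>, \<open>q\<close> form a pullback of \<open>f\<close>, \<open>g\<close>, with \<open>f \<circ> p = g \<circ> q\<close>.\<close>

definition is_pullback :: "('o, 'a, 'm) category_scheme \<Rightarrow> 'a \<Rightarrow> 'a \<Rightarrow> 'a \<Rightarrow> 'a \<Rightarrow> bool" where
  "is_pullback C f g p q \<longleftrightarrow>
     f \<in> Arr C \<and> g \<in> Arr C \<and> Cod C f = Cod C g \<and>
     p \<in> Hom C (Dom C p) (Dom C f) \<and> q \<in> Hom C (Dom C p) (Dom C g) \<and>
     Comp C f p = Comp C g q \<and>
     (\<forall>Z. \<forall>h \<in> Hom C Z (Dom C f). \<forall>k \<in> Hom C Z (Dom C g). Comp C f h = Comp C g k \<longrightarrow>
        (\<exists>!u. u \<in> Hom C Z (Dom C p) \<and> Comp C p u = h \<and> Comp C q u = k))"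

text \<open>\<open>p\<close>, \<open>q\<close> form a pushout of \<open>f\<close>, \<open>g\<close>, with \<open>p \<circ> f = q \<circ> g\<close>.\<close>

definition is_pushout :: "('o, 'a, 'm) category_scheme \<Rightarrow> 'a \<Rightarrow> 'a \<Rightarrow> 'a \<Rightarrow> 'a \<Rightarrow> bool" where
  "is_pushout C f g p q \<longleftrightarrow>
     f \<in> Arr C \<and> g \<in> Arr C \<and> Dom C f = Dom C g \<and>
     p \<in> Hom C (Cod C f) (Cod C p) \<and> q \<in> Hom C (Cod C g) (Cod C p) \<and>
     Comp C p f = Comp C q g \<and>
     (\<forall>Z. \<forall>h \<in> Hom C (Cod C f) Z. \<forall>k \<in> Hom C (Cod C g) Z. Comp C h f = Comp C k g \<longrightarrow>
        (\<exists>!u. u \<in> Hom C (Cod C p) Z \<and> Comp C u p = h \<and> Comp C u q = k))"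

locale proper_factorization_system =
  locally_small_category U C
  for U :: "'u itself" and C :: "('o, 'a, 'm) system_category_scheme" +
  assumes left_arr: "Left C \<subseteq> Arr C"
    and right_arr: "Right C \<subseteq> Arr C"
    and iso_left: "iso_arrow C f \<Longrightarrow> f \<in> Left C"
    and iso_right: "iso_arrow C f \<Longrightarrow> f \<in> Right C"
    and comp_left: "\<lbrakk>f \<in> Left C; g \<in> Left C; Cod C f = Dom C g\<rbrakk> \<Longrightarrow> Comp C g f \<in> Left C"
    and comp_right: "\<lbrakk>f \<in> Right C; g \<in> Right C; Cod C f = Dom C g\<rbrakk> \<Longrightarrow> Comp C g f \<in> Right C"
    and factorization: "f \<in> Arr C \<Longrightarrow>
           \<exists>e \<in> Left C. \<exists>m \<in> Right C. Cod C e = Dom C m \<and> f = Comp C m e"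
    and orthogonality: "\<lbrakk>e \<in> Left C; m \<in> Right C\<rbrakk> \<Longrightarrow> orthogonal_arrows C e m"
    and left_epi: "e \<in> Left C \<Longrightarrow> epi_arrow C e"
    and right_mono: "m \<in> Right C \<Longrightarrow> mono_arrow C m"

locale transfer_category =
  proper_factorization_system U C
  for U :: "'u itself" and C :: "('o, 'a, 'm) system_category_scheme" +
  assumes right_pullbacks: "\<lbrakk>f \<in> Right C; g \<in> Right C; Cod C f = Cod C g\<rbrakk> \<Longrightarrow>
           \<exists>p q. is_pullback C f g p q"
    and left_pushouts: "\<lbrakk>f \<in> Left C; g \<in> Left C; Dom C f = Dom C g\<rbrakk> \<Longrightarrow>
           \<exists>p q. is_pushout C f g p q"


section \<open>Transfer functors\<close>

record ('o, 'a, 'p, 'b) functor_data =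
  on_obj :: "'o \<Rightarrow> 'p"
  on_arr :: "'a \<Rightarrow> 'b"

definition comp_functor ::
  "('p, 'b, 'q, 'c) functor_data \<Rightarrow> ('o, 'a, 'p, 'b) functor_data \<Rightarrow> ('o, 'a, 'q, 'c) functor_data"
  where "comp_functor S T = \<lparr>on_obj = on_obj S \<circ> on_obj T, on_arr = on_arr S \<circ> on_arr T\<rparr>"

definition is_functor ::
  "('o, 'a, 'm) category_scheme \<Rightarrow> ('p, 'b, 'n) category_scheme \<Rightarrow>
   ('o, 'a, 'p, 'b) functor_data \<Rightarrow> bool" where
  "is_functor C D T \<longleftrightarrow>
     (\<forall>X \<in> Obj C. on_obj T X \<in> Obj D) \<and>
     (\<forall>f \<in> Arr C. on_arr T f \<in> Hom D (on_obj T (Dom C f)) (on_obj T (Cod C f))) \<and>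
     (\<forall>X \<in> Obj C. on_arr T (Id C X) = Id D (on_obj T X)) \<and>
     (\<forall>f \<in> Arr C. \<forall>g \<in> Arr C. Cod C f = Dom C g \<longrightarrow>
        on_arr T (Comp C g f) = Comp D (on_arr T g) (on_arr T f))"

definition conservative ::
  "('o, 'a, 'm) category_scheme \<Rightarrow> ('p, 'b, 'n) category_scheme \<Rightarrow>
   ('o, 'a, 'p, 'b) functor_data \<Rightarrow> bool" where
  "conservative C D T \<longleftrightarrow> (\<forall>f \<in> Arr C. iso_arrow D (on_arr T f) \<longrightarrow> iso_arrow C f)"

definition transfer_functor ::
  "'u itself \<Rightarrow> ('o, 'a, 'm) system_category_scheme \<Rightarrow> ('p, 'b, 'n) system_category_scheme \<Rightarrow>
   ('o, 'a, 'p, 'b) functor_data \<Rightarrow> bool" where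
  "transfer_functor U C D T \<longleftrightarrow>
     transfer_category U C \<and> transfer_category U D \<and>
     is_functor C D T \<and> conservative C D T \<and>
     on_arr T ` Left C \<subseteq> Left D \<and>
     on_arr T ` Right C \<subseteq> Right D \<and>
     (\<forall>f \<in> Right C. \<forall>g \<in> Right C. \<forall>p q. is_pullback C f g p q \<longrightarrow>
        is_pullback D (on_arr T f) (on_arr T g) (on_arr T p) (on_arr T q)) \<and>
     (\<forall>f \<in> Left C. \<forall>g \<in> Left C. \<forall>p q. is_pushout C f g p q \<longrightarrow>
        is_pushout D (on_arr T f) (on_arr T g) (on_arr T p) (on_arr T q))"


section \<open>Noetherian forms\<close>

text \<open>\<open>direct F f\<close> and \<open>inverse_im F f\<close> are \<open>f\<^sub>!\<close> and \<open>f\<^sup>*\<close>.\<close>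

record ('o, 'a, 'u) form =
  fibre      :: "'o \<Rightarrow> 'u gorder"
  direct     :: "'a \<Rightarrow> 'u \<Rightarrow> 'u"
  inverse_im :: "'a \<Rightarrow> 'u \<Rightarrow> 'u"

text \<open>Monotonicity of both maps is part of the library's \<^const>\<open>galois_connection\<close>
  (there a consequence of the adjunction).\<close>

locale orean_form =
  fixes U :: "'u itself" and C :: "('o, 'a, 'm) category_scheme" and F :: "('o, 'a, 'u) form"
  assumes bounded_fibre: "X \<in> Obj C \<Longrightarrow> bounded_lattice (fibre F X)"
    and small_fibre: "X \<in> Obj C \<Longrightarrow> small U (carrier (fibre F X))"
    and adjunction: "f \<in> Hom C X Y \<Longrightarrow>
           galois_connection \<lparr>orderA = fibre F X, orderB = fibre F Y,
                              lower = direct F f, upper = inverse_im F f\<rparr>"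
    and direct_comp: "\<lbrakk>f \<in> Hom C X Y; g \<in> Hom C Y Z; S \<in> carrier (fibre F X)\<rbrakk> \<Longrightarrow>
           direct F (Comp C g f) S = direct F g (direct F f S)"
    and inverse_comp: "\<lbrakk>f \<in> Hom C X Y; g \<in> Hom C Y Z; T \<in> carrier (fibre F Z)\<rbrakk> \<Longrightarrow>
           inverse_im F (Comp C g f) T = inverse_im F f (inverse_im F g T)"
    and direct_id: "\<lbrakk>X \<in> Obj C; S \<in> carrier (fibre F X)\<rbrakk> \<Longrightarrow> direct F (Id C X) S = S"
    and inverse_id: "\<lbrakk>X \<in> Obj C; S \<in> carrier (fibre F X)\<rbrakk> \<Longrightarrow> inverse_im F (Id C X) S = S"

definition im_cluster :: "('o, 'a, 'm) category_scheme \<Rightarrow> ('o, 'a, 'u) form \<Rightarrow> 'a \<Rightarrow> 'u" where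
  "im_cluster C F f = direct F f \<top>\<^bsub>fibre F (Dom C f)\<^esub>"

definition ker_cluster :: "('o, 'a, 'm) category_scheme \<Rightarrow> ('o, 'a, 'u) form \<Rightarrow> 'a \<Rightarrow> 'u" where
  "ker_cluster C F f = inverse_im F f \<bottom>\<^bsub>fibre F (Cod C f)\<^esub>"

definition conormal_cluster ::
  "('o, 'a, 'm) category_scheme \<Rightarrow> ('o, 'a, 'u) form \<Rightarrow> 'o \<Rightarrow> 'u \<Rightarrow> bool" where
  "conormal_cluster C F X S \<longleftrightarrow> (\<exists>f \<in> Arr C. Cod C f = X \<and> im_cluster C F f = S)"

definition normal_cluster ::
  "('o, 'a, 'm) category_scheme \<Rightarrow> ('o, 'a, 'u) form \<Rightarrow> 'o \<Rightarrow> 'u \<Rightarrow> bool" where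
  "normal_cluster C F X K \<longleftrightarrow> (\<exists>f \<in> Arr C. Dom C f = X \<and> ker_cluster C F f = K)"

definition embedding_of ::
  "('o, 'a, 'm) category_scheme \<Rightarrow> ('o, 'a, 'u) form \<Rightarrow> 'o \<Rightarrow> 'u \<Rightarrow> 'a \<Rightarrow> bool" where
  "embedding_of C F X S i \<longleftrightarrow>
     conormal_cluster C F X S \<and> i \<in> Arr C \<and> Cod C i = X \<and> im_cluster C F i = S \<and>
     (\<forall>f \<in> Arr C. Cod C f = X \<and> im_cluster C F f \<sqsubseteq>\<^bsub>fibre F X\<^esub> S \<longrightarrow>
        (\<exists>!h. h \<in> Hom C (Dom C f) (Dom C i) \<and> f = Comp C i h))"

definition quotient_of ::
  "('o, 'a, 'm) category_scheme \<Rightarrow> ('o, 'a, 'u) form \<Rightarrow> 'o \<Rightarrow> 'u \<Rightarrow> 'a \<Rightarrow> bool" where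
  "quotient_of C F X K p \<longleftrightarrow>
     normal_cluster C F X K \<and> p \<in> Arr C \<and> Dom C p = X \<and> ker_cluster C F p = K \<and>
     (\<forall>g \<in> Arr C. Dom C g = X \<and> K \<sqsubseteq>\<^bsub>fibre F X\<^esub> ker_cluster C F g \<longrightarrow>
        (\<exists>!h. h \<in> Hom C (Cod C p) (Cod C g) \<and> g = Comp C h p))"

locale noetherian_form =
  orean_form U C F
  for U :: "'u itself" and C :: "('o, 'a, 'm) category_scheme" and F :: "('o, 'a, 'u) form" +
  assumes N1_inverse: "\<lbrakk>f \<in> Hom C X Y; S \<in> carrier (fibre F X)\<rbrakk> \<Longrightarrow>
           inverse_im F f (direct F f S) = S \<squnion>\<^bsub>fibre F X\<^esub> ker_cluster C F f"
    and N1_direct: "\<lbrakk>f \<in> Hom C X Y; T \<in> carrier (fibre F Y)\<rbrakk> \<Longrightarrow>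
           direct F f (inverse_im F f T) = T \<sqinter>\<^bsub>fibre F Y\<^esub> im_cluster C F f"
    and N2: "f \<in> Hom C X Y \<Longrightarrow>
           \<exists>e m. quotient_of C F X (ker_cluster C F f) e \<and> embedding_of C F Y (im_cluster C F f) m \<and>
                 Cod C e = Dom C m \<and> f = Comp C m e"
    and N3_normal: "\<lbrakk>X \<in> Obj C; normal_cluster C F X S; normal_cluster C F X T\<rbrakk> \<Longrightarrow>
           normal_cluster C F X (S \<squnion>\<^bsub>fibre F X\<^esub> T)"
    and N3_conormal: "\<lbrakk>X \<in> Obj C; conormal_cluster C F X S; conormal_cluster C F X T\<rbrakk> \<Longrightarrow>
           conormal_cluster C F X (S \<sqinter>\<^bsub>fibre F X\<^esub> T)"

definition induces_system ::
  "('o, 'a, 'u) form \<Rightarrow> ('o, 'a, 'm) system_category_scheme \<Rightarrow> bool" where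
  "induces_system F C \<longleftrightarrow>
     Left C = {e. \<exists>X \<in> Obj C. \<exists>K. quotient_of C F X K e} \<and>
     Right C = {m. \<exists>X \<in> Obj C. \<exists>S. embedding_of C F X S m}"

definition has_inducing_form ::
  "'u itself \<Rightarrow> ('o, 'a, 'm) system_category_scheme \<Rightarrow> bool" where
  "has_inducing_form (U :: 'u itself) C \<longleftrightarrow>
     (\<exists>F :: ('o, 'a, 'u) form. noetherian_form U C F \<and> induces_system F C)"

text \<open>The types \<open>'o\<close>, \<open>'a\<close> of objects and arrows of the tested categories are parameters,
  since HOL cannot quantify over them inside a formula.\<close>

definition universal_target ::
  "'u itself \<Rightarrow> 'o itself \<Rightarrow> 'a itself \<Rightarrow> ('p, 'b, 'n) system_category_scheme \<Rightarrow> bool" where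
  "universal_target U (_ :: 'o itself) (_ :: 'a itself) D \<longleftrightarrow>
     transfer_category U D \<and>
     (\<forall>C :: ('o, 'a) system_category. transfer_category U C \<longrightarrow>
        (has_inducing_form U C \<longleftrightarrow> (\<exists>T. transfer_functor U C D T)))"


section \<open>Bounded modular lattices and modular connections\<close>

text \<open>The element type \<open>'l\<close> is a parameter: once it is at least as large as \<open>'u\<close>, every small bounded
  modular lattice has an isomorphic copy over \<open>'l\<close>, so that all these choices give equivalent
  versions of the category.\<close>

definition modular_lattice :: "('l, 'm) gorder_scheme \<Rightarrow> bool" where
  "modular_lattice L \<longleftrightarrow>
     (\<forall>x \<in> carrier L. \<forall>y \<in> carrier L. \<forall>z \<in> carrier L. x \<sqsubseteq>\<^bsub>L\<^esub> z \<longrightarrow>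
        x \<squnion>\<^bsub>L\<^esub> (y \<sqinter>\<^bsub>L\<^esub> z) = (x \<squnion>\<^bsub>L\<^esub> y) \<sqinter>\<^bsub>L\<^esub> z)"

text \<open>Here and in the concrete categories below, maps are \<^const>\<open>extensional\<close> so that equality of
  arrows means agreement on the carriers.\<close>

definition modular_connection :: "('l, 'l) galois \<Rightarrow> bool" where
  "modular_connection f \<longleftrightarrow>
     galois_connection f \<and>
     lower f \<in> extensional (carrier (orderA f)) \<and>
     upper f \<in> extensional (carrier (orderB f)) \<and>
     (\<forall>x \<in> carrier (orderA f).
        upper f (lower f x) = x \<squnion>\<^bsub>orderA f\<^esub> upper f \<bottom>\<^bsub>orderB f\<^esub>) \<and>
     (\<forall>y \<in> carrier (orderB f).
        lower f (upper f y) = y \<sqinter>\<^bsub>orderB f\<^esub> lower f \<top>\<^bsub>orderA f\<^esub>)"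

definition Mlc_obj :: "'u itself \<Rightarrow> 'l gorder set" where
  "Mlc_obj U = {L. bounded_lattice L \<and> modular_lattice L \<and> small U (carrier L)}"

definition Mlc_category :: "'u itself \<Rightarrow> ('l gorder, ('l, 'l) galois) category" where
  "Mlc_category U =
     \<lparr>Obj = Mlc_obj U,
      Arr = {f. orderA f \<in> Mlc_obj U \<and> orderB f \<in> Mlc_obj U \<and> modular_connection f},
      Dom = orderA,
      Cod = orderB,
      Id = (\<lambda>L. \<lparr>orderA = L, orderB = L,
                 lower = (\<lambda>x \<in> carrier L. x), upper = (\<lambda>x \<in> carrier L. x)\<rparr>),
      Comp = (\<lambda>g f. \<lparr>orderA = orderA f, orderB = orderB g,
                     lower = compose (carrier (orderA f)) (lower g) (lower f),
                     upper = compose (carrier (orderB g)) (upper f) (upper g)\<rparr>)\<rparr>"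

definition upper_interval :: "'l gorder \<Rightarrow> 'l \<Rightarrow> 'l gorder" where
  "upper_interval L a = L\<lparr>carrier := \<lbrace>a..\<top>\<^bsub>L\<^esub>\<rbrace>\<^bsub>L\<^esub>\<rparr>"

definition lower_interval :: "'l gorder \<Rightarrow> 'l \<Rightarrow> 'l gorder" where
  "lower_interval L a = L\<lparr>carrier := \<lbrace>\<bottom>\<^bsub>L\<^esub>..a\<rbrace>\<^bsub>L\<^esub>\<rparr>"

definition interval_quotient :: "'l gorder \<Rightarrow> 'l \<Rightarrow> ('l, 'l) galois" where
  "interval_quotient L a =
     \<lparr>orderA = L, orderB = upper_interval L a,
      lower = (\<lambda>x \<in> carrier L. x \<squnion>\<^bsub>L\<^esub> a),
      upper = (\<lambda>z \<in> carrier (upper_interval L a). z)\<rparr>"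

definition interval_embedding :: "'l gorder \<Rightarrow> 'l \<Rightarrow> ('l, 'l) galois" where
  "interval_embedding L a =
     \<lparr>orderA = lower_interval L a, orderB = L,
      lower = (\<lambda>z \<in> carrier (lower_interval L a). z),
      upper = (\<lambda>x \<in> carrier L. x \<sqinter>\<^bsub>L\<^esub> a)\<rparr>"

definition Mlc :: "'u itself \<Rightarrow> ('l gorder, ('l, 'l) galois) system_category" where
  "Mlc U = category.extend (Mlc_category U)
     (system_category.fields
        {f. \<exists>L \<in> Mlc_obj U. \<exists>a \<in> carrier L.
              isomorphic_arrows (Mlc_category U) f (interval_quotient L a)}
        {f. \<exists>L \<in> Mlc_obj U. \<exists>a \<in> carrier L.
              isomorphic_arrows (Mlc_category U) f (interval_embedding L a)})"


section \<open>Sets and abelian groups with their surjection-injection systems\<close>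

record ('s, 'x) typed_map =
  source :: 's
  target :: 's
  action :: "'x \<Rightarrow> 'x"

definition Set_arr :: "'u itself \<Rightarrow> ('x set, 'x) typed_map set" where
  "Set_arr U = {f. small U (source f) \<and> small U (target f) \<and>
                   action f \<in> source f \<rightarrow>\<^sub>E target f}"

definition Set_cat :: "'u itself \<Rightarrow> ('x set, ('x set, 'x) typed_map) system_category" where
  "Set_cat U =
     \<lparr>Obj = {X. small U X},
      Arr = Set_arr U,
      Dom = source,
      Cod = target,
      Id = (\<lambda>X. \<lparr>source = X, target = X, action = (\<lambda>x \<in> X. x)\<rparr>),
      Comp = (\<lambda>g f. \<lparr>source = source f, target = target g,
                     action = compose (source f) (action g) (action f)\<rparr>),
      Left = {f \<in> Set_arr U. action f ` source f = target f},
      Right = {f \<in> Set_arr U. inj_on (action f) (source f)}\<rparr>"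

definition Ab_obj :: "'u itself \<Rightarrow> 'g monoid set" where
  "Ab_obj U = {A. comm_group A \<and> small U (carrier A)}"

definition Ab_arr :: "'u itself \<Rightarrow> ('g monoid, 'g) typed_map set" where
  "Ab_arr U = {h. source h \<in> Ab_obj U \<and> target h \<in> Ab_obj U \<and>
                  action h \<in> hom (source h) (target h) \<inter> extensional (carrier (source h))}"

definition Ab_cat :: "'u itself \<Rightarrow> ('g monoid, ('g monoid, 'g) typed_map) system_category" where
  "Ab_cat U =
     \<lparr>Obj = Ab_obj U,
      Arr = Ab_arr U,
      Dom = source,
      Cod = target,
      Id = (\<lambda>A. \<lparr>source = A, target = A, action = (\<lambda>x \<in> carrier A. x)\<rparr>),
      Comp = (\<lambda>g f. \<lparr>source = source f, target = target g,
                     action = compose (carrier (source f)) (action g) (action f)\<rparr>),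
      Left = {h \<in> Ab_arr U. action h ` carrier (source h) = carrier (target h)},
      Right = {h \<in> Ab_arr U. inj_on (action h) (carrier (source h))}\<rparr>"

text \<open>The library's \<^const>\<open>free_Abelian_group\<close> on \<open>X\<close> consists of the finitely supported integer-valued functions
  with support in \<open>X\<close>; a map \<open>f\<close> acts by the additive extension of \<open>x \<mapsto> f x\<close> on generators.\<close>

definition free_ab_functor ::
  "('x set, ('x set, 'x) typed_map,
    ('x \<Rightarrow>\<^sub>0 int) monoid, (('x \<Rightarrow>\<^sub>0 int) monoid, 'x \<Rightarrow>\<^sub>0 int) typed_map) functor_data" where
  "free_ab_functor =
     \<lparr>on_obj = free_Abelian_group,
      on_arr = (\<lambda>f. \<lparr>source = free_Abelian_group (source f),
                     target = free_Abelian_group (target f),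
                     action = (\<lambda>c \<in> carrier (free_Abelian_group (source f)).
                                 frag_extend (\<lambda>x. frag_of (action f x)) c)\<rparr>)\<rparr>"

definition Sub :: "'g monoid \<Rightarrow> 'g set gorder" where
  "Sub A = \<lparr>carrier = {H. subgroup H A}, eq = (=), le = (\<subseteq>)\<rparr>"

definition Sub_functor ::
  "('g monoid, ('g monoid, 'g) typed_map,
    'g set gorder, ('g set, 'g set) galois) functor_data" where
  "Sub_functor =
     \<lparr>on_obj = Sub,
      on_arr = (\<lambda>h. \<lparr>orderA = Sub (source h),
                     orderB = Sub (target h),
                     lower = (\<lambda>H \<in> carrier (Sub (source h)). action h ` H),
                     upper = (\<lambda>K \<in> carrier (Sub (target h)).
                                {x \<in> carrier (source h). action h x \<in> K})\<rparr>)\<rparr>"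

end

theory Submission
  imports Defs "HOL-Algebra.Weak_Morphisms"
begin

text \<open>
  The fibres of a noetherian form need not be modular, so a form does not itself give a functor to
  \<open>Mlc\<close>.  It does give one to \<open>Set\<close>: send \<open>X\<close> to the underlying set of its fibre and \<open>f\<close> to
  the map \<open>f\<^sub>!\<close>.  Since \<open>f\<^sub>! x = f\<^sub>! y\<close> iff \<open>x \<squnion> Ker f = y \<squnion> Ker f\<close> and the image of \<open>f\<^sub>!\<close>
  is the lower interval below \<open>Im f\<close>, this is a transfer functor by (N3).  Composing it with
  \<open>X \<mapsto> Sub (\<int>\<^sup>(\<^sup>X\<^sup>))\<close> leads to \<open>Mlc\<close>.

  Conversely a transfer functor \<open>T\<close> to \<open>Mlc\<close> is itself a form: \<open>m \<in> \<M>\<close> is an embedding of its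
  image because, for \<open>m' \<in> \<M>\<close> with \<open>Im m' \<le> Im m\<close>, the pullback of \<open>m\<close> along \<open>m'\<close> is sent by
  \<open>T\<close> to an isomorphism and hence is one; dually for \<open>\<E>\<close>.
\<close>

section \<open>Small sets\<close>

text \<open>Arrows of \<open>Mlc\<close> compose because the middle lattice is modular, whereas
  composites in a form satisfy (N1) by assumption. Forgetting a fibre down to its set avoids this
  clash: a pushout of surjections of sets joins two equivalence relations, and for a form the join
  of the relations given by Ker f and Ker g is reached in two steps, from x to its join with Ker f
  and on to the join with both kernels. The free abelian group then replaces an equivalence relation
  by the subgroup generated by the differences x - x' of related elements, so joins of relations
  become sums of subgroups, and subgroup lattices of abelian groups are modular.

  \<open>Set\<close>, \<open>Ab\<close> and \<open>Mlc\<close> share one locale,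
  \<open>concrete_system\<close>, in which pullbacks and pushouts are read off from images and
  kernel pairs of functions. Element types form the remaining obstacle: clusters of a form are
  elements of \<open>'u\<close>, while subgroups of free groups are sets of integer combinations.
  Transport of lattices along injections stands between the two.\<close>

lemma small_subset: "small U B \<Longrightarrow> A \<subseteq> B \<Longrightarrow> small U A"
  unfolding small_def by (rule ordLeq_ordLess_trans[OF card_of_mono1])

lemma small_image: "small U A \<Longrightarrow> small U (f ` A)"
  unfolding small_def by (rule ordLeq_ordLess_trans[OF card_of_image])

lemma small_inj_on:
  assumes "inj_on f A" "f ` A \<subseteq> B" "small U B"
  shows "small U A"
proof -
  have "|A| \<le>o |B|"
    using assms(1,2) card_of_ordLeq by blast
  then show ?thesis
    using assms(3) unfolding small_def by (rule ordLeq_ordLess_trans)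
qed

lemma small_embeds:
  fixes U :: "'u itself" and A :: "'x set"
  assumes "small U A" "|UNIV :: 'u set| \<le>o |UNIV :: 'l set|"
  shows "\<exists>f :: 'x \<Rightarrow> 'l. inj_on f A"
proof -
  have "|A| \<le>o |UNIV :: 'u set|"
    using assms(1) unfolding small_def by (rule ordLess_imp_ordLeq)
  then have "|A| \<le>o |UNIV :: 'l set|"
    using assms(2) by (rule ordLeq_transitive)
  then show ?thesis
    using card_of_ordLeq[of A "UNIV :: 'l set"] by auto
qed

lemma infinite_universe:
  assumes "inaccessible_universe (U :: 'u itself)"
  shows "infinite (UNIV :: 'u set)"
proof -
  have "natLeq \<le>o |UNIV :: 'u set|"
    using assms unfolding inaccessible_universe_def by (simp add: ordLess_imp_ordLeq)
  then show ?thesis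
    using infinite_iff_natLeq_ordLeq by blast
qed

lemma small_Times:
  assumes "inaccessible_universe U" "small U A" "small U B"
  shows "small U (A \<times> B)"
  using assms(2,3) unfolding small_def
  by (rule card_of_Times_ordLess_infinite[OF infinite_universe[OF assms(1)]])

text \<open>The strict inequality \<open>natLeq <o |UNIV|\<close> enters here. It makes the integer
  coefficients of free abelian groups a small set.\<close>

lemma small_countable:
  fixes U :: "'u itself"
  assumes "inaccessible_universe U" "countable A"
  shows "small U A"
proof (rule small_inj_on)
  show "inj_on (to_nat_on A) A"
    using assms(2) by (rule inj_on_to_nat_on)
  show "to_nat_on A ` A \<subseteq> UNIV"
    by simp
  have "natLeq <o |UNIV :: 'u set|"
    using assms(1) unfolding inaccessible_universe_def by simp
  then show "small U (UNIV :: nat set)"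
    unfolding small_def using card_of_nat by (rule ordIso_ordLess_trans[rotated])
qed

text \<open>The closure axiom of the universe speaks only of subsets of \<open>'u\<close>, so
  \<open>A\<close> is first copied there along an injection.\<close>

lemma small_Pow:
  fixes U :: "'u itself" and A :: "'x set"
  assumes "inaccessible_universe U" "small U A"
  shows "small U (Pow A)"
proof -
  obtain f :: "'x \<Rightarrow> 'u" where f: "inj_on f A"
    using small_embeds[OF assms(2) card_of_mono1[OF subset_UNIV]] by auto
  have sm: "small U (Pow (f ` A))"
    using assms small_image unfolding inaccessible_universe_def by blast
  have inj: "inj_on ((`) f) (Pow A)"
    using f by (simp add: inj_on_image_Pow)
  have sub: "(`) f ` Pow A \<subseteq> Pow (f ` A)"
    by blast
  show ?thesis
    by (rule small_inj_on[OF inj sub sm])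
qed

text \<open>An extensional function is determined by its graph over \<open>A\<close>, and graphs are
  members of \<open>Pow (A \<times> B)\<close>. Smallness of hom-sets in the concrete categories
  rests on this bound.\<close>

lemma small_PiE:
  assumes "inaccessible_universe U" "small U A" "small U B"
  shows "small U (A \<rightarrow>\<^sub>E B)"
proof (rule small_inj_on)
  show "inj_on (\<lambda>f. (\<lambda>x. (x, f x)) ` A) (A \<rightarrow>\<^sub>E B)"
  proof (rule inj_onI)
    fix f g assume fg: "f \<in> A \<rightarrow>\<^sub>E B" "g \<in> A \<rightarrow>\<^sub>E B"
      and eq: "(\<lambda>x. (x, f x)) ` A = (\<lambda>x. (x, g x)) ` A"
    have "f x = g x" if "x \<in> A" for x
    proof -
      have "(x, f x) \<in> (\<lambda>x. (x, g x)) ` A"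
        using that eq by blast
      then show ?thesis by auto
    qed
    then show "f = g"
      using fg PiE_ext by blast
  qed
  show "(\<lambda>f. (\<lambda>x. (x, f x)) ` A) ` (A \<rightarrow>\<^sub>E B) \<subseteq> Pow (A \<times> B)"
    by auto
  show "small U (Pow (A \<times> B))"
    using assms small_Pow small_Times by blast
qed


section \<open>Arrows and factorization systems\<close>

lemma HomD: "f \<in> Hom C X Y \<Longrightarrow> f \<in> Arr C \<and> Dom C f = X \<and> Cod C f = Y"
  by (simp add: Hom_def)

lemma arr_hom: "f \<in> Arr C \<Longrightarrow> f \<in> Hom C (Dom C f) (Cod C f)"
  by (simp add: Hom_def)

lemma is_pullbackD:
  assumes "is_pullback C f g p q"
  shows "f \<in> Arr C" "g \<in> Arr C" "Cod C f = Cod C g"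
    "p \<in> Hom C (Dom C p) (Dom C f)" "q \<in> Hom C (Dom C p) (Dom C g)"
    "Comp C f p = Comp C g q"
  using assms unfolding is_pullback_def by simp_all

lemma is_pullback_ex1:
  assumes "is_pullback C f g p q" "h \<in> Hom C Z (Dom C f)" "k \<in> Hom C Z (Dom C g)"
    "Comp C f h = Comp C g k"
  shows "\<exists>!u. u \<in> Hom C Z (Dom C p) \<and> Comp C p u = h \<and> Comp C q u = k"
  using assms(1) unfolding is_pullback_def using assms(2-4) by simp

lemma is_pullback_lift:
  assumes "is_pullback C f g p q" "h \<in> Hom C Z (Dom C f)" "k \<in> Hom C Z (Dom C g)"
    "Comp C f h = Comp C g k"
  obtains u where "u \<in> Hom C Z (Dom C p)" "Comp C p u = h" "Comp C q u = k"
  using is_pullback_ex1[OF assms(1-4)] that by blast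

lemma is_pullback_unique:
  assumes "is_pullback C f g p q" "h \<in> Hom C Z (Dom C f)" "k \<in> Hom C Z (Dom C g)"
    "Comp C f h = Comp C g k"
    "u \<in> Hom C Z (Dom C p)" "Comp C p u = h" "Comp C q u = k"
    "v \<in> Hom C Z (Dom C p)" "Comp C p v = h" "Comp C q v = k"
  shows "u = v"
  using is_pullback_ex1[OF assms(1-4)] assms(5-10) by blast

lemma is_pushoutD:
  assumes "is_pushout C f g p q"
  shows "f \<in> Arr C" "g \<in> Arr C" "Dom C f = Dom C g"
    "p \<in> Hom C (Cod C f) (Cod C p)" "q \<in> Hom C (Cod C g) (Cod C p)"
    "Comp C p f = Comp C q g"
  using assms unfolding is_pushout_def by simp_all

lemma is_pushout_ex1:
  assumes "is_pushout C f g p q" "h \<in> Hom C (Cod C f) Z" "k \<in> Hom C (Cod C g) Z"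
    "Comp C h f = Comp C k g"
  shows "\<exists>!u. u \<in> Hom C (Cod C p) Z \<and> Comp C u p = h \<and> Comp C u q = k"
  using assms(1) unfolding is_pushout_def using assms(2-4) by simp

lemma is_pushout_desc:
  assumes "is_pushout C f g p q" "h \<in> Hom C (Cod C f) Z" "k \<in> Hom C (Cod C g) Z"
    "Comp C h f = Comp C k g"
  obtains u where "u \<in> Hom C (Cod C p) Z" "Comp C u p = h" "Comp C u q = k"
  using is_pushout_ex1[OF assms(1-4)] that by blast

lemma is_pushout_unique:
  assumes "is_pushout C f g p q" "h \<in> Hom C (Cod C f) Z" "k \<in> Hom C (Cod C g) Z"
    "Comp C h f = Comp C k g"
    "u \<in> Hom C (Cod C p) Z" "Comp C u p = h" "Comp C u q = k"
    "v \<in> Hom C (Cod C p) Z" "Comp C v p = h" "Comp C v q = k"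
  shows "u = v"
  using is_pushout_ex1[OF assms(1-4)] assms(5-10) by blast

context locally_small_category
begin

lemma iso_arrowI:
  assumes "f \<in> Hom C X Y" "g \<in> Hom C Y X" "Comp C g f = Id C X" "Comp C f g = Id C Y"
  shows "iso_arrow C f"
  using assms(2-4) HomD[OF assms(1)] unfolding iso_arrow_def by blast

lemma epi_cancel:
  assumes "epi_arrow C e" "e \<in> Hom C X Y" "g \<in> Hom C Y Z" "h \<in> Hom C Y Z"
    "Comp C g e = Comp C h e"
  shows "g = h"
  using assms(1,3-5) HomD[OF assms(2)] unfolding epi_arrow_def by blast

lemma mono_cancel:
  assumes "mono_arrow C m" "m \<in> Hom C Y Z" "g \<in> Hom C X Y" "h \<in> Hom C X Y"
    "Comp C m g = Comp C m h"
  shows "g = h"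
  using assms(1,3-5) HomD[OF assms(2)] unfolding mono_arrow_def by blast

text \<open>From \<open>r e = id\<close> one gets \<open>(e r) e = e = id e\<close>, and
  \<open>e\<close> cancels on the right.\<close>

lemma epi_section_iso:
  assumes e: "epi_arrow C e" "e \<in> Hom C X Y" and r: "r \<in> Hom C Y X" "Comp C r e = Id C X"
  shows "iso_arrow C e"
proof (rule iso_arrowI[OF e(2) r(1) r(2)])
  have Y: "Y \<in> Obj C" using e(2) cod_obj HomD by metis
  have "Comp C (Comp C e r) e = Comp C e (Comp C r e)"
    using comp_assoc e(2) r(1) by metis
  also have "\<dots> = Comp C (Id C Y) e"
    using r(2) comp_id id_comp e(2) by metis
  finally show "Comp C e r = Id C Y"
    using epi_cancel[OF e] comp_hom[OF r(1) e(2)] id_hom[OF Y] by blast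
qed

lemma mono_retraction_iso:
  assumes m: "mono_arrow C m" "m \<in> Hom C X Y" and s: "s \<in> Hom C Y X" "Comp C m s = Id C Y"
  shows "iso_arrow C m"
proof (rule iso_arrowI[OF m(2) s(1) _ s(2)])
  have X: "X \<in> Obj C" using m(2) dom_obj HomD by metis
  have "Comp C m (Comp C s m) = Comp C (Comp C m s) m"
    using comp_assoc m(2) s(1) by metis
  also have "\<dots> = Comp C m (Id C X)"
    using s(2) comp_id id_comp m(2) by metis
  finally show "Comp C s m = Id C X"
    using mono_cancel[OF m] comp_hom[OF m(2) s(1)] id_hom[OF X] by blast
qed

lemma iso_arrow_comp:
  assumes "iso_arrow C f" "iso_arrow C g" "Cod C f = Dom C g"
  shows "iso_arrow C (Comp C g f)"
proof -
  let ?X = "Dom C f" and ?Y = "Dom C g" and ?Z = "Cod C g"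
  obtain f' g' where f: "f \<in> Hom C ?X ?Y" and g: "g \<in> Hom C ?Y ?Z"
    and f': "f' \<in> Hom C ?Y ?X" "Comp C f' f = Id C ?X" "Comp C f f' = Id C ?Y"
    and g': "g' \<in> Hom C ?Z ?Y" "Comp C g' g = Id C ?Y" "Comp C g g' = Id C ?Z"
    using assms arr_hom[of _ C] unfolding iso_arrow_def by metis
  have gf: "Comp C g f \<in> Hom C ?X ?Z" and fg': "Comp C f' g' \<in> Hom C ?Z ?X"
    using comp_hom f g f'(1) g'(1) by blast+
  have "Comp C (Comp C f' g') (Comp C g f) = Comp C f' (Comp C g' (Comp C g f))"
    using comp_assoc[OF gf g'(1) f'(1)] by simp
  also have "\<dots> = Id C ?X"
    using comp_assoc[OF f g g'(1)] g'(2) id_comp[OF f] f'(2) by simp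
  finally have 1: "Comp C (Comp C f' g') (Comp C g f) = Id C ?X" .
  have "Comp C (Comp C g f) (Comp C f' g') = Comp C g (Comp C f (Comp C f' g'))"
    using comp_assoc[OF fg' f g] by simp
  also have "\<dots> = Id C ?Z"
    using comp_assoc[OF g'(1) f'(1) f] g'(3) id_comp[OF g'(1)] f'(3) by simp
  finally have 2: "Comp C (Comp C g f) (Comp C f' g') = Id C ?Z" .
  show ?thesis
    using iso_arrowI[OF gf fg' 1 2] .
qed

end

section \<open>Stability of the two classes under pullback and pushout\<close>

context proper_factorization_system
begin

text \<open>Orthogonality yields the stability. If \<open>p = m e\<close>, the square from
  \<open>e\<close> to \<open>g\<close> has a diagonal \<open>d\<close>, and \<open>m\<close>,
  \<open>d\<close> form a cone over \<open>f\<close>, \<open>g\<close>. The induced map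
  \<open>u\<close> into the pullback is left inverse to the epimorphism \<open>e\<close>, which is
  therefore invertible.\<close>

lemma pullback_right:
  assumes pb: "is_pullback C f g p q" and g: "g \<in> Right C"
  shows "p \<in> Right C"
proof -
  note D = is_pullbackD[OF pb]
  have pA: "p \<in> Arr C" using D(4) HomD by metis
  obtain e m where em: "e \<in> Left C" "m \<in> Right C" "Cod C e = Dom C m" "p = Comp C m e"
    using factorization[OF pA] by blast
  have eA: "e \<in> Arr C" and mA: "m \<in> Arr C"
    using em left_arr right_arr by auto
  have "Comp C m e \<in> Hom C (Dom C e) (Cod C m)"
    using comp_hom arr_hom[OF eA] arr_hom[OF mA] em(3) by metis
  then have de: "Dom C e = Dom C p" and cm: "Cod C m = Dom C f"
    using em(4) D(4) HomD by metis+
  have e: "e \<in> Hom C (Dom C p) (Dom C m)" using arr_hom[OF eA] de em(3) by simp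
  have m: "m \<in> Hom C (Dom C m) (Dom C f)" using arr_hom[OF mA] cm by simp
  have f: "f \<in> Hom C (Dom C f) (Cod C g)" using arr_hom[OF D(1)] D(3) by simp
  have fm: "Comp C f m \<in> Hom C (Dom C m) (Cod C g)" using comp_hom m f by blast
  have sq: "Comp C g q = Comp C (Comp C f m) e"
    using D(6) em(4) comp_assoc[OF e m f] by simp
  have orth: "orthogonal_arrows C e g" using orthogonality em(1) g by blast
  obtain d where d: "d \<in> Hom C (Dom C m) (Dom C g)" "Comp C d e = q" "Comp C g d = Comp C f m"
    using orth sq D(5) fm de em(3) unfolding orthogonal_arrows_def by metis
  obtain u where u: "u \<in> Hom C (Dom C m) (Dom C p)" "Comp C p u = m" "Comp C q u = d"
    using is_pullback_lift[OF pb m d(1) d(3)[symmetric]] by blast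
  have P: "Dom C p \<in> Obj C" using dom_obj pA by blast
  \<comment> \<open>Both are endomorphisms of the pullback with components \<open>p\<close> and
    \<open>q\<close>.\<close>
  have "Comp C u e = Id C (Dom C p)"
  proof (rule is_pullback_unique[OF pb D(4) D(5) D(6)])
    show "Comp C u e \<in> Hom C (Dom C p) (Dom C p)" using comp_hom e u(1) by blast
    show "Comp C p (Comp C u e) = p" using comp_assoc[OF e u(1) D(4)] u(2) em(4) by simp
    show "Comp C q (Comp C u e) = q" using comp_assoc[OF e u(1) D(5)] u(3) d(2) by simp
    show "Id C (Dom C p) \<in> Hom C (Dom C p) (Dom C p)" using id_hom P by blast
    show "Comp C p (Id C (Dom C p)) = p" using comp_id D(4) by blast
    show "Comp C q (Id C (Dom C p)) = q" using comp_id D(5) by blast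
  qed
  then have "iso_arrow C e"
    using epi_section_iso left_epi em(1) e u(1) by blast
  then show ?thesis
    using em comp_right iso_right by metis
qed

text \<open>Dual argument: the diagonal of the square from \<open>g\<close> to \<open>m\<close>,
  together with \<open>e\<close>, is a cocone, and the map it induces out of the pushout is right
  inverse to the monomorphism \<open>m\<close>.\<close>

lemma pushout_left:
  assumes po: "is_pushout C f g p q" and g: "g \<in> Left C"
  shows "p \<in> Left C"
proof -
  note D = is_pushoutD[OF po]
  have pA: "p \<in> Arr C" using D(4) HomD by metis
  obtain e m where em: "e \<in> Left C" "m \<in> Right C" "Cod C e = Dom C m" "p = Comp C m e"
    using factorization[OF pA] by blast
  have eA: "e \<in> Arr C" and mA: "m \<in> Arr C"
    using em left_arr right_arr by auto
  have "Comp C m e \<in> Hom C (Dom C e) (Cod C m)"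
    using comp_hom arr_hom[OF eA] arr_hom[OF mA] em(3) by metis
  then have de: "Dom C e = Cod C f" and cm: "Cod C m = Cod C p"
    using em(4) D(4) HomD by metis+
  have e: "e \<in> Hom C (Cod C f) (Dom C m)" using arr_hom[OF eA] de em(3) by simp
  have m: "m \<in> Hom C (Dom C m) (Cod C p)" using arr_hom[OF mA] cm by simp
  have f: "f \<in> Hom C (Dom C g) (Cod C f)" using arr_hom[OF D(1)] D(3) by simp
  have ef: "Comp C e f \<in> Hom C (Dom C g) (Dom C m)" using comp_hom e f by blast
  have sq: "Comp C m (Comp C e f) = Comp C q g"
    using D(6) em(4) comp_assoc[OF f e m] by simp
  have orth: "orthogonal_arrows C g m" using orthogonality em(2) g by blast
  obtain d where d: "d \<in> Hom C (Cod C g) (Dom C m)" "Comp C d g = Comp C e f" "Comp C m d = q"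
    using orth sq D(5) ef cm unfolding orthogonal_arrows_def by metis
  obtain u where u: "u \<in> Hom C (Cod C p) (Dom C m)" "Comp C u p = e" "Comp C u q = d"
    using is_pushout_desc[OF po e d(1) d(2)[symmetric]] by blast
  have P: "Cod C p \<in> Obj C" using cod_obj pA by blast
  have "Comp C m u = Id C (Cod C p)"
  proof (rule is_pushout_unique[OF po D(4) D(5) D(6)])
    show "Comp C m u \<in> Hom C (Cod C p) (Cod C p)" using comp_hom m u(1) by blast
    show "Comp C (Comp C m u) p = p" using comp_assoc[OF D(4) u(1) m] u(2) em(4) by simp
    show "Comp C (Comp C m u) q = q" using comp_assoc[OF D(5) u(1) m] u(3) d(3) by simp
    show "Id C (Cod C p) \<in> Hom C (Cod C p) (Cod C p)" using id_hom P by blast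
    show "Comp C (Id C (Cod C p)) p = p" using id_comp D(4) by blast
    show "Comp C (Id C (Cod C p)) q = q" using id_comp D(5) by blast
  qed
  then have "iso_arrow C m"
    using mono_retraction_iso right_mono em(2) m u(1) by blast
  then show ?thesis
    using em comp_left iso_left by metis
qed

end

section \<open>Concrete categories with surjection-injection systems\<close>

text \<open>An equivalence relation on the carrier serves as the common notion of kernel: it stands
  for the kernel subgroup in \<open>Ab\<close> and for the kernel element in
  \<open>Mlc\<close>.\<close>

definition kernel_pair :: "'x set \<Rightarrow> ('x \<Rightarrow> 'y) \<Rightarrow> ('x \<times> 'x) set" where
  "kernel_pair A h = {(x, y). x \<in> A \<and> y \<in> A \<and> h x = h y}"

text \<open>Common frame for \<open>Set\<close>, \<open>Ab\<close> and \<open>Mlc\<close>: arrows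
  act faithfully by functions on carriers, they lift along injections under an inclusion of images,
  and they descend along surjections under an inclusion of kernel pairs. In
  \<open>cointersection\<close> the kernel pair of \<open>n\<close> is least only among kernel pairs
  of arrows, which is all that a pushout in the category can test.\<close>

locale concrete_system =
  fixes U :: "'u itself" and C :: "('o, 'a, 'm) system_category_scheme"
    and car :: "'o \<Rightarrow> 'x set" and act :: "'a \<Rightarrow> 'x \<Rightarrow> 'x"
  assumes universe: "inaccessible_universe U"
    and dom_obj: "f \<in> Arr C \<Longrightarrow> Dom C f \<in> Obj C"
    and cod_obj: "f \<in> Arr C \<Longrightarrow> Cod C f \<in> Obj C"
    and id_hom: "X \<in> Obj C \<Longrightarrow> Id C X \<in> Hom C X X"
    and comp_hom: "\<lbrakk>f \<in> Hom C X Y; g \<in> Hom C Y Z\<rbrakk> \<Longrightarrow> Comp C g f \<in> Hom C X Z"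
    and small_car: "X \<in> Obj C \<Longrightarrow> small U (car X)"
    and act_PiE: "f \<in> Hom C X Y \<Longrightarrow> act f \<in> car X \<rightarrow>\<^sub>E car Y"
    and act_id: "\<lbrakk>X \<in> Obj C; x \<in> car X\<rbrakk> \<Longrightarrow> act (Id C X) x = x"
    and act_comp: "\<lbrakk>f \<in> Hom C X Y; g \<in> Hom C Y Z; x \<in> car X\<rbrakk> \<Longrightarrow>
           act (Comp C g f) x = act g (act f x)"
    and faithful: "\<lbrakk>f \<in> Hom C X Y; g \<in> Hom C X Y; act f = act g\<rbrakk> \<Longrightarrow> f = g"
    and left_iff: "f \<in> Hom C X Y \<Longrightarrow> f \<in> Left C \<longleftrightarrow> act f ` car X = car Y"
    and right_iff: "f \<in> Hom C X Y \<Longrightarrow> f \<in> Right C \<longleftrightarrow> inj_on (act f) (car X)"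
    and left_sub: "Left C \<subseteq> Arr C"
    and right_sub: "Right C \<subseteq> Arr C"
    and lift: "\<lbrakk>f \<in> Right C; f \<in> Hom C Y Z; g \<in> Hom C X Z; act g ` car X \<subseteq> act f ` car Y\<rbrakk> \<Longrightarrow>
           \<exists>h \<in> Hom C X Y. Comp C f h = g"
    and descend: "\<lbrakk>e \<in> Left C; e \<in> Hom C X Y; g \<in> Hom C X Z;
             kernel_pair (car X) (act e) \<subseteq> kernel_pair (car X) (act g)\<rbrakk> \<Longrightarrow>
           \<exists>h \<in> Hom C Y Z. Comp C h e = g"
    and factor: "f \<in> Hom C X Y \<Longrightarrow>
           \<exists>Z. \<exists>e \<in> Left C \<inter> Hom C X Z. \<exists>m \<in> Right C \<inter> Hom C Z Y. f = Comp C m e"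
    and intersection: "\<lbrakk>f \<in> Right C; f \<in> Hom C X Z; g \<in> Right C; g \<in> Hom C Y Z\<rbrakk> \<Longrightarrow>
           \<exists>W. \<exists>n \<in> Right C \<inter> Hom C W Z. act n ` car W = act f ` car X \<inter> act g ` car Y"
    and cointersection: "\<lbrakk>f \<in> Left C; f \<in> Hom C X Y; g \<in> Left C; g \<in> Hom C X Z\<rbrakk> \<Longrightarrow>
           \<exists>W. \<exists>n \<in> Left C \<inter> Hom C X W.
             kernel_pair (car X) (act f) \<subseteq> kernel_pair (car X) (act n) \<and>
             kernel_pair (car X) (act g) \<subseteq> kernel_pair (car X) (act n) \<and>
             (\<forall>V. \<forall>w \<in> Hom C X V.
                kernel_pair (car X) (act f) \<subseteq> kernel_pair (car X) (act w) \<longrightarrow>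
                kernel_pair (car X) (act g) \<subseteq> kernel_pair (car X) (act w) \<longrightarrow>
                kernel_pair (car X) (act n) \<subseteq> kernel_pair (car X) (act w))"
begin

lemma act_closed: "f \<in> Hom C X Y \<Longrightarrow> x \<in> car X \<Longrightarrow> act f x \<in> car Y"
  using act_PiE by (rule PiE_mem)

lemma hom_eqI:
  assumes "f \<in> Hom C X Y" "g \<in> Hom C X Y" "\<And>x. x \<in> car X \<Longrightarrow> act f x = act g x"
  shows "f = g"
  using faithful[OF assms(1,2)] PiE_ext[OF act_PiE[OF assms(1)] act_PiE[OF assms(2)]] assms(3)
  by blast

text \<open>Unit and associativity laws hold for functions and are reflected by faithfulness.
  Smallness holds because \<open>act\<close> embeds each hom-set into a set of extensional
  functions.\<close>

sublocale locally_small_category U C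
proof (rule locally_small_category.intro)
  show "Comp C f (Id C X) = f" if f: "f \<in> Hom C X Y" for f X Y
  proof -
    have X: "X \<in> Obj C" using dom_obj HomD[OF f] by blast
    show ?thesis
      using hom_eqI[OF comp_hom[OF id_hom[OF X] f] f] act_comp[OF id_hom[OF X] f] act_id[OF X]
      by simp
  qed
  show "Comp C (Id C Y) f = f" if f: "f \<in> Hom C X Y" for f X Y
  proof -
    have Y: "Y \<in> Obj C" using cod_obj HomD[OF f] by blast
    show ?thesis
      using hom_eqI[OF comp_hom[OF f id_hom[OF Y]] f] act_comp[OF f id_hom[OF Y]] act_id[OF Y]
        act_closed[OF f] by simp
  qed
  show "Comp C h (Comp C g f) = Comp C (Comp C h g) f"
    if f: "f \<in> Hom C X Y" and g: "g \<in> Hom C Y Z" and h: "h \<in> Hom C Z W" for f g h X Y Z W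
  proof (rule hom_eqI)
    show "Comp C h (Comp C g f) \<in> Hom C X W" using comp_hom f g h by blast
    show "Comp C (Comp C h g) f \<in> Hom C X W" using comp_hom f g h by blast
    fix x assume x: "x \<in> car X"
    show "act (Comp C h (Comp C g f)) x = act (Comp C (Comp C h g) f) x"
      using act_comp[OF comp_hom[OF f g] h x] act_comp[OF f comp_hom[OF g h] x]
        act_comp[OF f g x] act_comp[OF g h act_closed[OF f x]] by simp
  qed
  show "small U (Hom C X Y)" if "X \<in> Obj C" "Y \<in> Obj C" for X Y
  proof (rule small_inj_on)
    show "inj_on act (Hom C X Y)"
      using faithful by (auto intro: inj_onI)
    show "act ` Hom C X Y \<subseteq> car X \<rightarrow>\<^sub>E car Y"
      using act_PiE by blast
    show "small U (car X \<rightarrow>\<^sub>E car Y)"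
      using small_PiE[OF universe] small_car that by blast
  qed
qed (use dom_obj cod_obj id_hom comp_hom in blast)+

lemma surjection_epi: 
  assumes "e \<in> Left C" shows "epi_arrow C e"
proof -
  have eA: "e \<in> Arr C" using assms left_sub by blast
  have e: "e \<in> Hom C (Dom C e) (Cod C e)" by (rule arr_hom[OF eA])
  have "g = h" if g: "g \<in> Hom C (Cod C e) Z" and h: "h \<in> Hom C (Cod C e) Z"
    and eq: "Comp C g e = Comp C h e" for g h Z
  proof (rule hom_eqI[OF g h])
    fix y assume "y \<in> car (Cod C e)"
    then obtain x where "x \<in> car (Dom C e)" "y = act e x"
      using left_iff[OF e] assms by blast
    then show "act g y = act h y"
      using act_comp[OF e g] act_comp[OF e h] eq by metis
  qed
  then show ?thesis
    unfolding epi_arrow_def using eA by blast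
qed

lemma injection_mono:
  assumes "m \<in> Right C" shows "mono_arrow C m"
proof -
  have mA: "m \<in> Arr C" using assms right_sub by blast
  have m: "m \<in> Hom C (Dom C m) (Cod C m)" by (rule arr_hom[OF mA])
  have "g = h" if g: "g \<in> Hom C Z (Dom C m)" and h: "h \<in> Hom C Z (Dom C m)"
    and eq: "Comp C m g = Comp C m h" for g h Z
  proof (rule hom_eqI[OF g h])
    fix z assume z: "z \<in> car Z"
    have "act m (act g z) = act m (act h z)"
      using act_comp[OF g m z] act_comp[OF h m z] eq by simp
    then show "act g z = act h z"
      using right_iff[OF m] assms act_closed[OF g z] act_closed[OF h z]
      by (auto dest: inj_onD)
  qed
  then show ?thesis
    unfolding mono_arrow_def using mA by blast
qed

text \<open>For the converse, a surjective and injective \<open>f\<close> admits a lift of the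
  identity of \<open>Y\<close>; a monomorphism with a right inverse is invertible.\<close>

lemma iso_iff:
  assumes f: "f \<in> Hom C X Y"
  shows "iso_arrow C f \<longleftrightarrow> f \<in> Left C \<and> f \<in> Right C"
proof
  assume "iso_arrow C f"
  then obtain g where g: "g \<in> Hom C Y X" "Comp C g f = Id C X" "Comp C f g = Id C Y"
    using HomD[OF f] unfolding iso_arrow_def by blast
  have X: "X \<in> Obj C" and Y: "Y \<in> Obj C"
    using HomD[OF f] dom_obj cod_obj by blast+
  have gf: "act g (act f x) = x" if "x \<in> car X" for x
    using act_comp[OF f g(1) that] g(2) act_id[OF X that] by simp
  have fg: "act f (act g y) = y" if "y \<in> car Y" for y
    using act_comp[OF g(1) f that] g(3) act_id[OF Y that] by simp
  have "inj_on (act f) (car X)"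
    using gf by (metis inj_onI)
  moreover have "act f ` car X = car Y"
    using act_closed[OF f] act_closed[OF g(1)] fg by (metis image_eqI image_subsetI subsetI subset_antisym)
  ultimately show "f \<in> Left C \<and> f \<in> Right C"
    using left_iff[OF f] right_iff[OF f] by blast
next
  assume lr: "f \<in> Left C \<and> f \<in> Right C"
  have Y: "Y \<in> Obj C"
    using HomD[OF f] cod_obj by blast
  have "act (Id C Y) ` car Y \<subseteq> act f ` car X"
    using left_iff[OF f] lr act_id[OF Y] by force
  then obtain h where "h \<in> Hom C Y X" "Comp C f h = Id C Y"
    using lift[OF _ f id_hom[OF Y]] lr by blast
  then show "iso_arrow C f"
    using mono_retraction_iso[OF injection_mono f] lr by blast
qed

lemma iso_hom: "iso_arrow C f \<Longrightarrow> f \<in> Hom C (Dom C f) (Cod C f)"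
  unfolding iso_arrow_def using arr_hom[of f C] by blast

lemma image_comp:
  assumes "f \<in> Hom C X Y" "g \<in> Hom C Y Z"
  shows "act (Comp C g f) ` car X = act g ` act f ` car X"
  using act_comp[OF assms] by (simp add: image_image)

text \<open>Surjectivity of \<open>e\<close> makes the image of \<open>v\<close> equal to that of
  \<open>v e = m u\<close>, so \<open>v\<close> lifts along \<open>m\<close>. The upper triangle and
  uniqueness follow by cancelling \<open>m\<close>.\<close>

lemma orthogonal:
  assumes e: "e \<in> Left C" and m: "m \<in> Right C"
  shows "orthogonal_arrows C e m"
  unfolding orthogonal_arrows_def
proof (intro ballI impI)
  fix u v
  assume u: "u \<in> Hom C (Dom C e) (Dom C m)" and v: "v \<in> Hom C (Cod C e) (Cod C m)"
    and eq: "Comp C m u = Comp C v e"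
  have eh: "e \<in> Hom C (Dom C e) (Cod C e)" and mh: "m \<in> Hom C (Dom C m) (Cod C m)"
    using arr_hom[of e C] arr_hom[of m C] e m left_sub right_sub by auto
  have "act v ` car (Cod C e) = act (Comp C m u) ` car (Dom C e)"
    using image_comp[OF eh v] left_iff[OF eh] e eq by simp
  also have "\<dots> \<subseteq> act m ` car (Dom C m)"
    using image_comp[OF u mh] act_closed[OF u] by auto
  finally obtain d where d: "d \<in> Hom C (Cod C e) (Dom C m)" "Comp C m d = v"
    using lift[OF m mh v] by blast
  have "Comp C m (Comp C d e) = Comp C m u"
    using comp_assoc[OF eh d(1) mh] d(2) eq by simp
  then have "Comp C d e = u"
    using mono_cancel[OF injection_mono[OF m] mh comp_hom[OF eh d(1)] u] by blast
  then show "\<exists>!d. d \<in> Hom C (Cod C e) (Dom C m) \<and> Comp C d e = u \<and> Comp C m d = v"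
    using d mono_cancel[OF injection_mono[OF m] mh] by blast
qed

sublocale proper_factorization_system U C
proof unfold_locales
  fix f g
  show "iso_arrow C f \<Longrightarrow> f \<in> Left C" "iso_arrow C f \<Longrightarrow> f \<in> Right C"
    using iso_iff iso_hom by blast+
  show "Comp C g f \<in> Left C" if "f \<in> Left C" "g \<in> Left C" "Cod C f = Dom C g"
  proof -
    have f: "f \<in> Hom C (Dom C f) (Dom C g)" and g: "g \<in> Hom C (Dom C g) (Cod C g)"
      using that left_sub unfolding Hom_def by auto
    show ?thesis
      using left_iff[OF comp_hom[OF f g]] image_comp[OF f g] left_iff[OF f] left_iff[OF g] that
      by simp
  qed
  show "Comp C g f \<in> Right C" if "f \<in> Right C" "g \<in> Right C" "Cod C f = Dom C g"
  proof -
    have f: "f \<in> Hom C (Dom C f) (Dom C g)" and g: "g \<in> Hom C (Dom C g) (Cod C g)"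
      using that right_sub unfolding Hom_def by auto
    have "inj_on (act (Comp C g f)) (car (Dom C f))"
    proof (rule inj_onI)
      fix x y assume xy: "x \<in> car (Dom C f)" "y \<in> car (Dom C f)"
        "act (Comp C g f) x = act (Comp C g f) y"
      then have "act g (act f x) = act g (act f y)"
        using act_comp[OF f g] by simp
      then show "x = y"
        using right_iff[OF f] right_iff[OF g] that xy act_closed[OF f] by (metis inj_onD)
    qed
    then show ?thesis
      using right_iff[OF comp_hom[OF f g]] by blast
  qed
  show "\<exists>e\<in>Left C. \<exists>m\<in>Right C. Cod C e = Dom C m \<and> f = Comp C m e" if fA: "f \<in> Arr C"
  proof -
    obtain Z e m where "e \<in> Left C" "e \<in> Hom C (Dom C f) Z" "m \<in> Right C"
      "m \<in> Hom C Z (Cod C f)" "f = Comp C m e"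
      using factor[OF arr_hom[OF fA]] by blast
    then show ?thesis
      using HomD by metis
  qed
qed (use left_sub right_sub orthogonal surjection_epi injection_mono in blast)+

section \<open>Pullbacks as intersections of images, pushouts as joins of kernel pairs\<close>

text \<open>For a cone \<open>h\<close>, \<open>k\<close> the composite \<open>f h\<close> lands in
  the intersection of the images, so it lifts along the injective \<open>f p\<close>. Cancelling
  \<open>f\<close> and \<open>g\<close> recovers the two components, and \<open>p\<close> being
  monic gives uniqueness.\<close>

lemma is_pullbackI:
  assumes f: "f \<in> Right C" "f \<in> Hom C X Z" and g: "g \<in> Right C" "g \<in> Hom C Y Z"
    and p: "p \<in> Right C" "p \<in> Hom C W X" and q: "q \<in> Hom C W Y"
    and eq: "Comp C f p = Comp C g q"
    and img: "act f ` car X \<inter> act g ` car Y \<subseteq> act (Comp C f p) ` car W"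
  shows "is_pullback C f g p q"
proof -
  have fp: "Comp C f p \<in> Right C" "Comp C f p \<in> Hom C W Z"
    using comp_right f p comp_hom HomD by metis+
  have "\<exists>!u. u \<in> Hom C V W \<and> Comp C p u = h \<and> Comp C q u = k"
    if h: "h \<in> Hom C V X" and k: "k \<in> Hom C V Y" and hk: "Comp C f h = Comp C g k" for V h k
  proof -
    have "act (Comp C f h) ` car V \<subseteq> act f ` car X \<inter> act g ` car Y"
    proof (rule Int_greatest)
      show "act (Comp C f h) ` car V \<subseteq> act f ` car X"
        unfolding image_comp[OF h f(2)] using act_closed[OF h] by auto
      show "act (Comp C f h) ` car V \<subseteq> act g ` car Y"
        unfolding hk image_comp[OF k g(2)] using act_closed[OF k] by auto
    qed
    then obtain u where u: "u \<in> Hom C V W" "Comp C (Comp C f p) u = Comp C f h"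
      using lift[OF fp comp_hom[OF h f(2)]] img by blast
    have "Comp C p u = h"
      using mono_cancel[OF right_mono[OF f(1)] f(2) comp_hom[OF u(1) p(2)] h]
        comp_assoc[OF u(1) p(2) f(2)] u(2) by simp
    moreover have "Comp C q u = k"
      using mono_cancel[OF right_mono[OF g(1)] g(2) comp_hom[OF u(1) q] k]
        comp_assoc[OF u(1) q g(2)] u(2) eq hk by simp
    ultimately show ?thesis
      using u(1) mono_cancel[OF right_mono[OF p(1)] p(2)] by blast
  qed
  then show ?thesis
    unfolding is_pullback_def using HomD[OF f(2)] HomD[OF g(2)] HomD[OF p(2)] p(2) q eq by simp
qed

text \<open>Dual: a cocone \<open>h\<close>, \<open>k\<close> makes \<open>h f\<close> constant on
  both kernel pairs, so it descends along the surjective \<open>p f\<close>. The condition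
  \<open>ker\<close> is tested against arrows \<open>w\<close> of the category, matching
  \<open>cointersection\<close>.\<close>

lemma is_pushoutI:
  assumes f: "f \<in> Left C" "f \<in> Hom C X Y" and g: "g \<in> Left C" "g \<in> Hom C X Z"
    and p: "p \<in> Left C" "p \<in> Hom C Y W" and q: "q \<in> Hom C Z W"
    and eq: "Comp C p f = Comp C q g"
    and ker: "\<And>V w. w \<in> Hom C X V \<Longrightarrow>
        kernel_pair (car X) (act f) \<subseteq> kernel_pair (car X) (act w) \<Longrightarrow>
        kernel_pair (car X) (act g) \<subseteq> kernel_pair (car X) (act w) \<Longrightarrow>
        kernel_pair (car X) (act (Comp C p f)) \<subseteq> kernel_pair (car X) (act w)"
  shows "is_pushout C f g p q"
proof -
  have pf: "Comp C p f \<in> Left C" "Comp C p f \<in> Hom C X W"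
    using comp_left f p comp_hom HomD by metis+
  have "\<exists>!u. u \<in> Hom C W V \<and> Comp C u p = h \<and> Comp C u q = k"
    if h: "h \<in> Hom C Y V" and k: "k \<in> Hom C Z V" and hk: "Comp C h f = Comp C k g" for V h k
  proof -
    have "kernel_pair (car X) (act f) \<subseteq> kernel_pair (car X) (act (Comp C h f))"
      using act_comp[OF f(2) h] unfolding kernel_pair_def by auto
    moreover have "kernel_pair (car X) (act g) \<subseteq> kernel_pair (car X) (act (Comp C h f))"
      using act_comp[OF g(2) k] hk unfolding kernel_pair_def by auto
    ultimately obtain u where u: "u \<in> Hom C W V" "Comp C u (Comp C p f) = Comp C h f"
      using descend[OF pf comp_hom[OF f(2) h]] ker[OF comp_hom[OF f(2) h]] by blast
    have "Comp C u p = h"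
      using epi_cancel[OF left_epi[OF f(1)] f(2) comp_hom[OF p(2) u(1)] h]
        comp_assoc[OF f(2) p(2) u(1)] u(2) by simp
    moreover have "Comp C u q = k"
      using epi_cancel[OF left_epi[OF g(1)] g(2) comp_hom[OF q u(1)] k]
        comp_assoc[OF g(2) q u(1)] u(2) eq hk by simp
    ultimately show ?thesis
      using u(1) epi_cancel[OF left_epi[OF p(1)] p(2)] by blast
  qed
  then show ?thesis
    unfolding is_pushout_def using HomD[OF f(2)] HomD[OF g(2)] HomD[OF p(2)] p(2) q eq by simp
qed

text \<open>The arrow supplied by \<open>intersection\<close> lifts through both given arrows, and
  the two lifts are the sides of the pullback. Dually, the arrow supplied by
  \<open>cointersection\<close> descends along both.\<close>

sublocale transfer_category U C
proof unfold_locales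
  fix f g
  show "\<exists>p q. is_pullback C f g p q" if fg: "f \<in> Right C" "g \<in> Right C" and "Cod C f = Cod C g"
  proof -
    have f: "f \<in> Hom C (Dom C f) (Cod C g)" and g: "g \<in> Hom C (Dom C g) (Cod C g)"
      using that right_sub unfolding Hom_def by auto
    obtain W n where n: "n \<in> Right C" "n \<in> Hom C W (Cod C g)"
      "act n ` car W = act f ` car (Dom C f) \<inter> act g ` car (Dom C g)"
      using intersection[OF fg(1) f fg(2) g] by blast
    obtain p where p: "p \<in> Hom C W (Dom C f)" "Comp C f p = n"
      using lift[OF fg(1) f n(2)] n(3) by blast
    obtain q where q: "q \<in> Hom C W (Dom C g)" "Comp C g q = n"
      using lift[OF fg(2) g n(2)] n(3) by blast
    have "inj_on (act p) (car W)"
    proof (rule inj_onI)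
      fix x y assume "x \<in> car W" "y \<in> car W" "act p x = act p y"
      then show "x = y"
        using act_comp[OF p(1) f] p(2) n(1) right_iff[OF n(2)] by (metis inj_onD)
    qed
    then have "p \<in> Right C"
      using right_iff[OF p(1)] by blast
    moreover have "Comp C f p = Comp C g q"
      using p(2) q(2) by simp
    ultimately show ?thesis
      using is_pullbackI[OF fg(1) f fg(2) g _ p(1) q(1)] p(2) n(3) by blast
  qed
  show "\<exists>p q. is_pushout C f g p q" if fg: "f \<in> Left C" "g \<in> Left C" and "Dom C f = Dom C g"
  proof -
    have f: "f \<in> Hom C (Dom C g) (Cod C f)" and g: "g \<in> Hom C (Dom C g) (Cod C g)"
      using that left_sub unfolding Hom_def by auto
    obtain W n where n: "n \<in> Left C" "n \<in> Hom C (Dom C g) W"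
      "kernel_pair (car (Dom C g)) (act f) \<subseteq> kernel_pair (car (Dom C g)) (act n)"
      "kernel_pair (car (Dom C g)) (act g) \<subseteq> kernel_pair (car (Dom C g)) (act n)"
      and min: "\<And>V w. w \<in> Hom C (Dom C g) V \<Longrightarrow>
        kernel_pair (car (Dom C g)) (act f) \<subseteq> kernel_pair (car (Dom C g)) (act w) \<Longrightarrow>
        kernel_pair (car (Dom C g)) (act g) \<subseteq> kernel_pair (car (Dom C g)) (act w) \<Longrightarrow>
        kernel_pair (car (Dom C g)) (act n) \<subseteq> kernel_pair (car (Dom C g)) (act w)"
      using cointersection[OF fg(1) f fg(2) g] by blast
    obtain p where p: "p \<in> Hom C (Cod C f) W" "Comp C p f = n"
      using descend[OF fg(1) f n(2)] n(3) by blast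
    obtain q where q: "q \<in> Hom C (Cod C g) W" "Comp C q g = n"
      using descend[OF fg(2) g n(2)] n(4) by blast
    have "act p ` car (Cod C f) = car W"
      using image_comp[OF f p(1)] p(2) left_iff[OF n(2)] n(1) left_iff[OF f] fg(1) by simp
    then have "p \<in> Left C"
      using left_iff[OF p(1)] by blast
    moreover have "Comp C p f = Comp C q g"
      using p(2) q(2) by simp
    ultimately show ?thesis
      using is_pushoutI[OF fg(1) f fg(2) g _ p(1) q(1)] min unfolding p(2) by blast
  qed
qed

text \<open>The arrow \<open>n\<close> with the intersection as image lifts to a cone and hence
  factors through the given pullback. This bounds the image of \<open>f p\<close> from below; the
  commuting square bounds it from above.\<close>

lemma pullback_image:
  assumes f: "f \<in> Right C" and g: "g \<in> Right C" and pb: "is_pullback C f g p q"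
  shows "act (Comp C f p) ` car (Dom C p) = act f ` car (Dom C f) \<inter> act g ` car (Dom C g)"
proof -
  note D = is_pullbackD[OF pb]
  have fh: "f \<in> Hom C (Dom C f) (Cod C f)" and gh: "g \<in> Hom C (Dom C g) (Cod C f)"
    using arr_hom D by metis+
  obtain W n where n: "n \<in> Hom C W (Cod C f)"
    "act n ` car W = act f ` car (Dom C f) \<inter> act g ` car (Dom C g)"
    using intersection[OF f fh g gh] by blast
  obtain h where h: "h \<in> Hom C W (Dom C f)" "Comp C f h = n"
    using lift[OF f fh n(1)] n(2) by blast
  obtain k where k: "k \<in> Hom C W (Dom C g)" "Comp C g k = n"
    using lift[OF g gh n(1)] n(2) by blast
  obtain u where u: "u \<in> Hom C W (Dom C p)" "Comp C p u = h"
    using is_pullback_lift[OF pb h(1) k(1)] h(2) k(2) by metis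
  have "n = Comp C (Comp C f p) u"
    using comp_assoc[OF u(1) D(4) fh] u(2) h(2) by simp
  then have "act n ` car W \<subseteq> act (Comp C f p) ` car (Dom C p)"
    using image_comp[OF u(1) comp_hom[OF D(4) fh]] act_closed[OF u(1)] by auto
  moreover have "act (Comp C f p) ` car (Dom C p) \<subseteq> act f ` car (Dom C f)"
    using image_comp[OF D(4) fh] act_closed[OF D(4)] by auto
  moreover have "act (Comp C f p) ` car (Dom C p) \<subseteq> act g ` car (Dom C g)"
    using image_comp[OF D(5) gh] act_closed[OF D(5)] D(6) by auto
  ultimately show ?thesis
    unfolding n(2) by (intro subset_antisym Int_greatest)
qed

text \<open>\<open>w\<close> descends along \<open>f\<close> and along \<open>g\<close>, the two
  descents form a cocone, and so \<open>w\<close> factors through the pushout composite.\<close>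

lemma pushout_kernel:
  assumes f: "f \<in> Left C" and g: "g \<in> Left C" and po: "is_pushout C f g p q"
    and w: "w \<in> Hom C (Dom C f) V"
      "kernel_pair (car (Dom C f)) (act f) \<subseteq> kernel_pair (car (Dom C f)) (act w)"
      "kernel_pair (car (Dom C f)) (act g) \<subseteq> kernel_pair (car (Dom C f)) (act w)"
  shows "kernel_pair (car (Dom C f)) (act (Comp C p f)) \<subseteq> kernel_pair (car (Dom C f)) (act w)"
proof -
  note D = is_pushoutD[OF po]
  have fh: "f \<in> Hom C (Dom C f) (Cod C f)" and gh: "g \<in> Hom C (Dom C f) (Cod C g)"
    using arr_hom D by metis+
  obtain h where h: "h \<in> Hom C (Cod C f) V" "Comp C h f = w"
    using descend[OF f fh w(1,2)] by blast
  obtain k where k: "k \<in> Hom C (Cod C g) V" "Comp C k g = w"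
    using descend[OF g gh w(1,3)] by blast
  obtain u where u: "u \<in> Hom C (Cod C p) V" "Comp C u p = h"
    using is_pushout_desc[OF po h(1) k(1)] h(2) k(2) by metis
  have "w = Comp C u (Comp C p f)"
    using comp_assoc[OF fh D(4) u(1)] u(2) h(2) by simp
  then show ?thesis
    using act_comp[OF comp_hom[OF fh D(4)] u(1)] unfolding kernel_pair_def by auto
qed

end

section \<open>Bounded lattices and connections\<close>

lemma bounded_latticeI:
  fixes L (structure)
  assumes po: "partial_order L"
    and J: "\<And>x y. x \<in> carrier L \<Longrightarrow> y \<in> carrier L \<Longrightarrow>
        j x y \<in> carrier L \<and> x \<sqsubseteq> j x y \<and> y \<sqsubseteq> j x y \<and>
        (\<forall>z \<in> carrier L. x \<sqsubseteq> z \<longrightarrow> y \<sqsubseteq> z \<longrightarrow> j x y \<sqsubseteq> z)"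
    and M: "\<And>x y. x \<in> carrier L \<Longrightarrow> y \<in> carrier L \<Longrightarrow>
        m x y \<in> carrier L \<and> m x y \<sqsubseteq> x \<and> m x y \<sqsubseteq> y \<and>
        (\<forall>z \<in> carrier L. z \<sqsubseteq> x \<longrightarrow> z \<sqsubseteq> y \<longrightarrow> z \<sqsubseteq> m x y)"
    and t: "t \<in> carrier L" "\<And>x. x \<in> carrier L \<Longrightarrow> x \<sqsubseteq> t"
    and b: "b \<in> carrier L" "\<And>x. x \<in> carrier L \<Longrightarrow> b \<sqsubseteq> x"
  shows "bounded_lattice L"
proof -
  interpret partial_order L by (rule po)
  show ?thesis
  proof
    fix x y assume xy: "x \<in> carrier L" "y \<in> carrier L"
    have "least L (j x y) (Upper L {x, y})"
      using J[OF xy] xy by (intro least_UpperI) (auto simp: Upper_def)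
    then show "\<exists>s. least L s (Upper L {x, y})" ..
    have "greatest L (m x y) (Lower L {x, y})"
      using M[OF xy] xy by (intro greatest_LowerI) (auto simp: Lower_def)
    then show "\<exists>s. greatest L s (Lower L {x, y})" ..
  next
    have "least L b (carrier L)"
      using b by (simp add: least_def)
    then show "\<exists>x. least L x (carrier L)" ..
    have "greatest L t (carrier L)"
      using t by (simp add: greatest_def)
    then show "\<exists>x. greatest L x (carrier L)" ..
  qed
qed

context bounded_lattice
begin

lemma join_eqI:
  assumes "x \<in> carrier L" "y \<in> carrier L" "z \<in> carrier L" "x \<sqsubseteq> z" "y \<sqsubseteq> z"
    "\<And>w. w \<in> carrier L \<Longrightarrow> x \<sqsubseteq> w \<Longrightarrow> y \<sqsubseteq> w \<Longrightarrow> z \<sqsubseteq> w"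
  shows "x \<squnion> y = z"
  using assms by (simp add: join_le join_left join_right le_antisym)

lemma meet_eqI:
  assumes "x \<in> carrier L" "y \<in> carrier L" "z \<in> carrier L" "z \<sqsubseteq> x" "z \<sqsubseteq> y"
    "\<And>w. w \<in> carrier L \<Longrightarrow> w \<sqsubseteq> x \<Longrightarrow> w \<sqsubseteq> y \<Longrightarrow> w \<sqsubseteq> z"
  shows "x \<sqinter> y = z"
  using assms by (simp add: meet_le meet_left meet_right le_antisym)

lemma join_assoc:
  "x \<in> carrier L \<Longrightarrow> y \<in> carrier L \<Longrightarrow> z \<in> carrier L \<Longrightarrow> (x \<squnion> y) \<squnion> z = x \<squnion> (y \<squnion> z)"
  using weak_join_assoc by (simp add: eq_is_equal)

lemma join_bottom: "x \<in> carrier L \<Longrightarrow> x \<squnion> \<bottom> = x"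
  by (rule join_eqI) auto

lemma meet_top: "x \<in> carrier L \<Longrightarrow> x \<sqinter> \<top> = x"
  by (rule meet_eqI) auto

lemma join_absorb: "x \<in> carrier L \<Longrightarrow> y \<in> carrier L \<Longrightarrow> y \<sqsubseteq> x \<Longrightarrow> x \<squnion> y = x"
  by (rule join_eqI) auto

lemma meet_absorb: "x \<in> carrier L \<Longrightarrow> y \<in> carrier L \<Longrightarrow> x \<sqsubseteq> y \<Longrightarrow> x \<sqinter> y = x"
  by (rule meet_eqI) auto

end

text \<open>The two identities of (N1) for a single adjunction, stated with neither modularity nor
  extensionality. In this generality the locale covers the maps of a noetherian form as well as the
  arrows of \<open>Mlc\<close>.\<close>

locale image_kernel_connection =
  A: bounded_lattice A + B: bounded_lattice B
  for A :: "'k gorder" and B :: "'l gorder" and l :: "'k \<Rightarrow> 'l" and u :: "'l \<Rightarrow> 'k" +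
  assumes l_closed: "x \<in> carrier A \<Longrightarrow> l x \<in> carrier B"
    and u_closed: "y \<in> carrier B \<Longrightarrow> u y \<in> carrier A"
    and adj: "\<lbrakk>x \<in> carrier A; y \<in> carrier B\<rbrakk> \<Longrightarrow> l x \<sqsubseteq>\<^bsub>B\<^esub> y \<longleftrightarrow> x \<sqsubseteq>\<^bsub>A\<^esub> u y"
    and ul: "x \<in> carrier A \<Longrightarrow> u (l x) = x \<squnion>\<^bsub>A\<^esub> u \<bottom>\<^bsub>B\<^esub>"
    and lu: "y \<in> carrier B \<Longrightarrow> l (u y) = y \<sqinter>\<^bsub>B\<^esub> l \<top>\<^bsub>A\<^esub>"
begin

lemma ker_closed: "u \<bottom>\<^bsub>B\<^esub> \<in> carrier A"
  using u_closed by simp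

lemma im_closed: "l \<top>\<^bsub>A\<^esub> \<in> carrier B"
  using l_closed by simp

lemma le_ul: "x \<in> carrier A \<Longrightarrow> x \<sqsubseteq>\<^bsub>A\<^esub> u (l x)"
  using adj[of x "l x"] l_closed by simp

lemma lu_le: "y \<in> carrier B \<Longrightarrow> l (u y) \<sqsubseteq>\<^bsub>B\<^esub> y"
  using adj[of "u y" y] u_closed by simp

lemma l_mono: "\<lbrakk>x \<in> carrier A; y \<in> carrier A; x \<sqsubseteq>\<^bsub>A\<^esub> y\<rbrakk> \<Longrightarrow> l x \<sqsubseteq>\<^bsub>B\<^esub> l y"
  using adj[of x "l y"] A.le_trans[OF _ le_ul[of y]] l_closed u_closed by simp

lemma u_mono: "\<lbrakk>x \<in> carrier B; y \<in> carrier B; x \<sqsubseteq>\<^bsub>B\<^esub> y\<rbrakk> \<Longrightarrow> u x \<sqsubseteq>\<^bsub>A\<^esub> u y"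
  using adj[of "u x" y] B.le_trans[OF lu_le[of x]] l_closed u_closed by simp

lemma lul: "x \<in> carrier A \<Longrightarrow> l (u (l x)) = l x"
  using le_ul[of x] lu_le[of "l x"] l_mono[of x "u (l x)"] l_closed u_closed
  by (simp add: B.le_antisym)

lemma ulu: "y \<in> carrier B \<Longrightarrow> u (l (u y)) = u y"
  using lu_le[of y] le_ul[of "u y"] u_mono[of "l (u y)" y] l_closed u_closed
  by (simp add: A.le_antisym)

lemma l_bottom: "l \<bottom>\<^bsub>A\<^esub> = \<bottom>\<^bsub>B\<^esub>"
  using adj[of "\<bottom>\<^bsub>A\<^esub>" "\<bottom>\<^bsub>B\<^esub>"] l_closed u_closed by (simp add: B.le_antisym)

lemma u_top: "u \<top>\<^bsub>B\<^esub> = \<top>\<^bsub>A\<^esub>"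
  using adj[of "\<top>\<^bsub>A\<^esub>" "\<top>\<^bsub>B\<^esub>"] l_closed u_closed by (simp add: A.le_antisym)

lemma l_ker: "l (u \<bottom>\<^bsub>B\<^esub>) = \<bottom>\<^bsub>B\<^esub>"
  using lu_le[of "\<bottom>\<^bsub>B\<^esub>"] l_closed u_closed by (simp add: B.le_antisym)

lemma l_le_im: "x \<in> carrier A \<Longrightarrow> l x \<sqsubseteq>\<^bsub>B\<^esub> l \<top>\<^bsub>A\<^esub>"
  by (rule l_mono) auto

lemma ker_le_u: "y \<in> carrier B \<Longrightarrow> u \<bottom>\<^bsub>B\<^esub> \<sqsubseteq>\<^bsub>A\<^esub> u y"
  by (rule u_mono) auto

lemma l_join:
  assumes "x \<in> carrier A" "y \<in> carrier A"
  shows "l (x \<squnion>\<^bsub>A\<^esub> y) = l x \<squnion>\<^bsub>B\<^esub> l y"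
proof (rule sym, rule B.join_eqI)
  fix w assume w: "w \<in> carrier B" "l x \<sqsubseteq>\<^bsub>B\<^esub> w" "l y \<sqsubseteq>\<^bsub>B\<^esub> w"
  then have "x \<squnion>\<^bsub>A\<^esub> y \<sqsubseteq>\<^bsub>A\<^esub> u w"
    using assms adj[of x w] adj[of y w] u_closed by (simp add: A.join_le)
  then show "l (x \<squnion>\<^bsub>A\<^esub> y) \<sqsubseteq>\<^bsub>B\<^esub> w"
    using adj[of "x \<squnion>\<^bsub>A\<^esub> y" w] assms w by simp
qed (use assms l_closed l_mono A.join_left A.join_right in auto)

lemma u_meet:
  assumes "x \<in> carrier B" "y \<in> carrier B"
  shows "u (x \<sqinter>\<^bsub>B\<^esub> y) = u x \<sqinter>\<^bsub>A\<^esub> u y"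
proof (rule sym, rule A.meet_eqI)
  fix w assume w: "w \<in> carrier A" "w \<sqsubseteq>\<^bsub>A\<^esub> u x" "w \<sqsubseteq>\<^bsub>A\<^esub> u y"
  then have "l w \<sqsubseteq>\<^bsub>B\<^esub> x \<sqinter>\<^bsub>B\<^esub> y"
    using assms adj[of w x] adj[of w y] l_closed by (simp add: B.meet_le)
  then show "w \<sqsubseteq>\<^bsub>A\<^esub> u (x \<sqinter>\<^bsub>B\<^esub> y)"
    using adj[of w "x \<sqinter>\<^bsub>B\<^esub> y"] assms w by simp
qed (use assms u_closed u_mono B.meet_left B.meet_right in auto)

text \<open>\<open>u (l x)\<close> is the join of \<open>x\<close> with the kernel, and
  \<open>l u l = l\<close>. Hence the single element \<open>u \<bottom>\<close> governs the whole
  kernel pair of \<open>l\<close>.\<close>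

lemma l_eq_iff:
  assumes "x \<in> carrier A" "y \<in> carrier A"
  shows "l x = l y \<longleftrightarrow> x \<squnion>\<^bsub>A\<^esub> u \<bottom>\<^bsub>B\<^esub> = y \<squnion>\<^bsub>A\<^esub> u \<bottom>\<^bsub>B\<^esub>"
  using ul lul assms by metis

text \<open>By \<open>lu\<close>, an element below \<open>l \<top>\<close> is fixed by
  \<open>l u\<close>. The image is therefore a full principal ideal and not merely contained in
  one.\<close>

lemma image_l: "l ` carrier A = {y \<in> carrier B. y \<sqsubseteq>\<^bsub>B\<^esub> l \<top>\<^bsub>A\<^esub>}"
proof (intro subset_antisym subsetI)
  fix y assume "y \<in> {y \<in> carrier B. y \<sqsubseteq>\<^bsub>B\<^esub> l \<top>\<^bsub>A\<^esub>}"
  then have "y \<in> carrier B" "l (u y) = y"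
    using lu B.meet_absorb im_closed by auto
  then show "y \<in> l ` carrier A"
    using u_closed by (metis image_eqI)
qed (use l_closed l_le_im in auto)

lemma surj_iff: "l ` carrier A = carrier B \<longleftrightarrow> l \<top>\<^bsub>A\<^esub> = \<top>\<^bsub>B\<^esub>"
proof
  assume "l ` carrier A = carrier B"
  then have "\<top>\<^bsub>B\<^esub> \<sqsubseteq>\<^bsub>B\<^esub> l \<top>\<^bsub>A\<^esub>"
    using image_l B.top_closed by blast
  then show "l \<top>\<^bsub>A\<^esub> = \<top>\<^bsub>B\<^esub>"
    using im_closed by (simp add: B.le_antisym)
qed (use image_l in auto)

lemma inj_iff: "inj_on l (carrier A) \<longleftrightarrow> u \<bottom>\<^bsub>B\<^esub> = \<bottom>\<^bsub>A\<^esub>"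
proof
  assume "inj_on l (carrier A)"
  then show "u \<bottom>\<^bsub>B\<^esub> = \<bottom>\<^bsub>A\<^esub>"
    using l_ker l_bottom ker_closed A.bottom_closed by (metis inj_onD)
next
  assume "u \<bottom>\<^bsub>B\<^esub> = \<bottom>\<^bsub>A\<^esub>"
  then show "inj_on l (carrier A)"
    using l_eq_iff A.join_bottom by (simp add: inj_on_def)
qed

text \<open>One pair, consisting of the kernel element and bottom, decides the inclusion: if
  \<open>h\<close> sends the kernel of \<open>l\<close> to bottom, preservation of joins gives that
  \<open>h\<close> identifies \<open>x\<close> with its join with that kernel, and
  \<open>l_eq_iff\<close> covers the remaining pairs.\<close>

lemma kernel_pair_subset_iff:
  assumes h: "image_kernel_connection A D h k"
  shows "kernel_pair (carrier A) l \<subseteq> kernel_pair (carrier A) h \<longleftrightarrow> u \<bottom>\<^bsub>B\<^esub> \<sqsubseteq>\<^bsub>A\<^esub> k \<bottom>\<^bsub>D\<^esub>"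
proof -
  interpret H: image_kernel_connection A D h k by (rule h)
  show ?thesis
  proof
    assume "kernel_pair (carrier A) l \<subseteq> kernel_pair (carrier A) h"
    moreover have "(u \<bottom>\<^bsub>B\<^esub>, \<bottom>\<^bsub>A\<^esub>) \<in> kernel_pair (carrier A) l"
      using ker_closed l_ker l_bottom unfolding kernel_pair_def by simp
    ultimately have "h (u \<bottom>\<^bsub>B\<^esub>) = \<bottom>\<^bsub>D\<^esub>"
      using H.l_bottom unfolding kernel_pair_def by auto
    then show "u \<bottom>\<^bsub>B\<^esub> \<sqsubseteq>\<^bsub>A\<^esub> k \<bottom>\<^bsub>D\<^esub>"
      using H.adj[OF ker_closed H.B.bottom_closed] H.B.bottom_closed by simp
  next
    assume le: "u \<bottom>\<^bsub>B\<^esub> \<sqsubseteq>\<^bsub>A\<^esub> k \<bottom>\<^bsub>D\<^esub>"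
    then have bot: "h (u \<bottom>\<^bsub>B\<^esub>) = \<bottom>\<^bsub>D\<^esub>"
      using H.adj[OF ker_closed H.B.bottom_closed] H.l_closed[OF ker_closed]
      by (simp add: H.B.le_antisym)
    have "h x = h (x \<squnion>\<^bsub>A\<^esub> u \<bottom>\<^bsub>B\<^esub>)" if "x \<in> carrier A" for x
      using H.l_join[OF that ker_closed] bot H.B.join_bottom H.l_closed that by simp
    then show "kernel_pair (carrier A) l \<subseteq> kernel_pair (carrier A) h"
      unfolding kernel_pair_def by (clarsimp simp: l_eq_iff)
  qed
qed

end

text \<open>Over a non-modular middle lattice the composite can violate the two image-kernel identities.\<close>

lemma image_kernel_connection_comp:
  assumes "image_kernel_connection A B l u" "image_kernel_connection B D h k"
    and modular: "modular_lattice B"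
  shows "image_kernel_connection A D (\<lambda>x. h (l x)) (\<lambda>z. u (k z))"
proof -
  interpret F: image_kernel_connection A B l u by fact
  interpret G: image_kernel_connection B D h k by fact
  let ?K = "k \<bottom>\<^bsub>D\<^esub>" and ?I = "l \<top>\<^bsub>A\<^esub>"
  have K: "?K \<in> carrier B" "u ?K \<in> carrier A" and I: "?I \<in> carrier B" "h ?I \<in> carrier D"
    using G.ker_closed F.u_closed F.im_closed G.l_closed by auto
  show ?thesis
  proof
    fix x assume x: "x \<in> carrier A"
    note lx = F.l_closed[OF x]
    show "h (l x) \<in> carrier D"
      using lx G.l_closed by blast
    have J: "l x \<squnion>\<^bsub>B\<^esub> ?K \<in> carrier B" "x \<squnion>\<^bsub>A\<^esub> u ?K \<in> carrier A"
      using K x lx by auto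
    have "l (u (l x \<squnion>\<^bsub>B\<^esub> ?K)) = (l x \<squnion>\<^bsub>B\<^esub> ?K) \<sqinter>\<^bsub>B\<^esub> ?I"
      using F.lu J by blast
    \<comment> \<open>Modular law in \<open>B\<close>, applicable because \<open>l x\<close> lies
      below \<open>?I\<close>. It cuts the kernel of the second map down to the image of the first,
      where it equals \<open>l (u ?K)\<close>.\<close>
    also have "\<dots> = l x \<squnion>\<^bsub>B\<^esub> (?K \<sqinter>\<^bsub>B\<^esub> ?I)"
      using modular lx K(1) I(1) F.l_le_im[OF x] unfolding modular_lattice_def by auto
    also have "\<dots> = l (x \<squnion>\<^bsub>A\<^esub> u ?K)"
      using F.l_join[OF x K(2)] F.lu[OF K(1)] by simp
    \<comment> \<open>Applying \<open>u\<close> once more collapses \<open>u l u\<close> to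
      \<open>u\<close>, which turns the equation between images into one between preimages.\<close>
    finally have "u (l (u (l x \<squnion>\<^bsub>B\<^esub> ?K))) = u (l (x \<squnion>\<^bsub>A\<^esub> u ?K))"
      by simp
    moreover have "u (l (x \<squnion>\<^bsub>A\<^esub> u ?K)) = (x \<squnion>\<^bsub>A\<^esub> u ?K) \<squnion>\<^bsub>A\<^esub> u \<bottom>\<^bsub>B\<^esub>"
      using F.ul J by blast
    moreover have "u \<bottom>\<^bsub>B\<^esub> \<sqsubseteq>\<^bsub>A\<^esub> x \<squnion>\<^bsub>A\<^esub> u ?K"
      using F.A.le_trans[OF F.ker_le_u[OF K(1)] F.A.join_right[OF x K(2)]] F.ker_closed K(2) J(2)
      by simp
    ultimately show "u (k (h (l x))) = x \<squnion>\<^bsub>A\<^esub> u (k \<bottom>\<^bsub>D\<^esub>)"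
      using G.ul[OF lx] F.ulu[OF J(1)] F.A.join_absorb[OF J(2) F.ker_closed] by simp
  next
    fix z assume z: "z \<in> carrier D"
    note kz = G.u_closed[OF z]
    show "u (k z) \<in> carrier A"
      using F.u_closed kz by blast
    have J: "k z \<sqinter>\<^bsub>B\<^esub> ?I \<in> carrier B" "z \<sqinter>\<^bsub>D\<^esub> h ?I \<in> carrier D"
      using kz I z by auto
    have "k (h (k z \<sqinter>\<^bsub>B\<^esub> ?I)) = (k z \<sqinter>\<^bsub>B\<^esub> ?I) \<squnion>\<^bsub>B\<^esub> ?K"
      using G.ul J by blast
    also have "\<dots> = ?K \<squnion>\<^bsub>B\<^esub> (?I \<sqinter>\<^bsub>B\<^esub> k z)"
      by (simp add: join_comm meet_comm)
    \<comment> \<open>Modular law again, now with \<open>?K\<close> below \<open>k z\<close>, since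
      a kernel lies below every preimage.\<close>
    also have "\<dots> = (?K \<squnion>\<^bsub>B\<^esub> ?I) \<sqinter>\<^bsub>B\<^esub> k z"
      using modular kz K(1) I(1) G.ker_le_u[OF z] unfolding modular_lattice_def by auto
    also have "\<dots> = k (z \<sqinter>\<^bsub>D\<^esub> h ?I)"
      using G.u_meet[OF z I(2)] G.ul[OF I(1)] by (simp add: join_comm meet_comm)
    finally have "h (k (h (k z \<sqinter>\<^bsub>B\<^esub> ?I))) = h (k (z \<sqinter>\<^bsub>D\<^esub> h ?I))"
      by simp
    moreover have "h (k (z \<sqinter>\<^bsub>D\<^esub> h ?I)) = (z \<sqinter>\<^bsub>D\<^esub> h ?I) \<sqinter>\<^bsub>D\<^esub> h \<top>\<^bsub>B\<^esub>"
      using G.lu J by blast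
    moreover have "z \<sqinter>\<^bsub>D\<^esub> h ?I \<sqsubseteq>\<^bsub>D\<^esub> h \<top>\<^bsub>B\<^esub>"
      using G.B.le_trans[OF G.B.meet_right[OF z I(2)] G.l_le_im[OF I(1)]] G.im_closed I(2) J(2)
      by simp
    ultimately show "h (l (u (k z))) = z \<sqinter>\<^bsub>D\<^esub> h (l \<top>\<^bsub>A\<^esub>)"
      using F.lu[OF kz] G.lul[OF J(1)] G.B.meet_absorb[OF J(2) G.im_closed] by simp
  next
    fix x z assume x: "x \<in> carrier A" and z: "z \<in> carrier D"
    show "h (l x) \<sqsubseteq>\<^bsub>D\<^esub> z \<longleftrightarrow> x \<sqsubseteq>\<^bsub>A\<^esub> u (k z)"
      using F.adj[OF x G.u_closed[OF z]] G.adj[OF F.l_closed[OF x] z] by simp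
  qed
qed

text \<open>A trivial kernel gives \<open>u l = id\<close>, and on the principal ideal below
  \<open>l \<top>\<close> also \<open>l u = id\<close>. So \<open>u\<close> inverts \<open>l\<close>
  on its image, \<open>u h\<close> is the lift, and its right adjoint is \<open>k l\<close>.\<close>

lemma connection_lift:
  assumes "image_kernel_connection Y Z l u" "image_kernel_connection X Z h k"
    and ker: "u \<bottom>\<^bsub>Z\<^esub> = \<bottom>\<^bsub>Y\<^esub>" and im: "h \<top>\<^bsub>X\<^esub> \<sqsubseteq>\<^bsub>Z\<^esub> l \<top>\<^bsub>Y\<^esub>"
  shows "image_kernel_connection X Y (\<lambda>x. u (h x)) (\<lambda>y. k (l y))"
    and "x \<in> carrier X \<Longrightarrow> l (u (h x)) = h x"
proof -
  interpret F: image_kernel_connection Y Z l u by fact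
  interpret G: image_kernel_connection X Z h k by fact
  have ul: "u (l y) = y" if "y \<in> carrier Y" for y
    using F.ul[OF that] ker F.A.join_bottom[OF that] by simp
  have lu: "l (u (h x)) = h x" if x: "x \<in> carrier X" for x
  proof -
    have "h x \<sqsubseteq>\<^bsub>Z\<^esub> l \<top>\<^bsub>Y\<^esub>"
      using F.B.le_trans[OF G.l_le_im[OF x] im] G.l_closed[OF x] F.im_closed G.im_closed by simp
    then show ?thesis
      using F.lu F.B.meet_absorb G.l_closed[OF x] F.im_closed by simp
  qed
  then show "x \<in> carrier X \<Longrightarrow> l (u (h x)) = h x" .
  show "image_kernel_connection X Y (\<lambda>x. u (h x)) (\<lambda>y. k (l y))"
  proof
    fix x assume x: "x \<in> carrier X"
    show "u (h x) \<in> carrier Y"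
      using x F.u_closed G.l_closed by blast
    show "k (l (u (h x))) = x \<squnion>\<^bsub>X\<^esub> k (l \<bottom>\<^bsub>Y\<^esub>)"
      using lu[OF x] G.ul[OF x] F.l_bottom by simp
  next
    fix y assume y: "y \<in> carrier Y"
    show "k (l y) \<in> carrier X"
      using y G.u_closed F.l_closed by blast
    show "u (h (k (l y))) = y \<sqinter>\<^bsub>Y\<^esub> u (h \<top>\<^bsub>X\<^esub>)"
      using F.u_meet[OF F.l_closed[OF y] G.im_closed] G.lu[OF F.l_closed[OF y]] ul[OF y] by simp
  next
    fix x y assume x: "x \<in> carrier X" and y: "y \<in> carrier Y"
    have "u (h x) \<sqsubseteq>\<^bsub>Y\<^esub> y \<longleftrightarrow> h x \<sqsubseteq>\<^bsub>Z\<^esub> l y"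
    proof
      assume "u (h x) \<sqsubseteq>\<^bsub>Y\<^esub> y"
      then show "h x \<sqsubseteq>\<^bsub>Z\<^esub> l y"
        using F.l_mono[of "u (h x)" y] lu[OF x] y F.u_closed G.l_closed[OF x] by simp
    next
      assume "h x \<sqsubseteq>\<^bsub>Z\<^esub> l y"
      then show "u (h x) \<sqsubseteq>\<^bsub>Y\<^esub> y"
        using F.u_mono[of "h x" "l y"] ul[OF y] F.l_closed[OF y] G.l_closed[OF x] by simp
    qed
    then show "u (h x) \<sqsubseteq>\<^bsub>Y\<^esub> y \<longleftrightarrow> x \<sqsubseteq>\<^bsub>X\<^esub> k (l y)"
      using G.adj[OF x F.l_closed[OF y]] by simp
  qed
qed

text \<open>A full image gives \<open>l u = id\<close>, and above the kernel also
  \<open>u l = id\<close>. So \<open>u\<close> is a section of \<open>l\<close>, the descended map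
  is \<open>h u\<close>, and its right adjoint is \<open>l k\<close>.\<close>

lemma connection_descend:
  assumes "image_kernel_connection X Y l u" "image_kernel_connection X Z h k"
    and im: "l \<top>\<^bsub>X\<^esub> = \<top>\<^bsub>Y\<^esub>" and ker: "u \<bottom>\<^bsub>Y\<^esub> \<sqsubseteq>\<^bsub>X\<^esub> k \<bottom>\<^bsub>Z\<^esub>"
  shows "image_kernel_connection Y Z (\<lambda>y. h (u y)) (\<lambda>z. l (k z))"
    and "x \<in> carrier X \<Longrightarrow> h (u (l x)) = h x"
proof -
  interpret F: image_kernel_connection X Y l u by fact
  interpret G: image_kernel_connection X Z h k by fact
  have lu: "l (u y) = y" if "y \<in> carrier Y" for y
    using F.lu[OF that] im F.B.meet_top[OF that] by simp
  have ul: "u (l (k z)) = k z" if z: "z \<in> carrier Z" for z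
  proof -
    have "u \<bottom>\<^bsub>Y\<^esub> \<sqsubseteq>\<^bsub>X\<^esub> k z"
      using F.A.le_trans[OF ker G.ker_le_u[OF z]] G.u_closed[OF z] F.ker_closed G.ker_closed by simp
    then show ?thesis
      using F.ul F.A.join_absorb G.u_closed[OF z] F.ker_closed by simp
  qed
  show "h (u (l x)) = h x" if x: "x \<in> carrier X"
  proof -
    have "h (u \<bottom>\<^bsub>Y\<^esub>) = \<bottom>\<^bsub>Z\<^esub>"
      using G.adj[OF F.ker_closed G.B.bottom_closed] ker G.l_closed[OF F.ker_closed]
      by (simp add: G.B.le_antisym)
    then show ?thesis
      using F.ul[OF x] G.l_join[OF x F.ker_closed] G.B.join_bottom[OF G.l_closed[OF x]] by simp
  qed
  show "image_kernel_connection Y Z (\<lambda>y. h (u y)) (\<lambda>z. l (k z))"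
  proof
    fix y assume y: "y \<in> carrier Y"
    show "h (u y) \<in> carrier Z"
      using y F.u_closed G.l_closed by blast
    show "l (k (h (u y))) = y \<squnion>\<^bsub>Y\<^esub> l (k \<bottom>\<^bsub>Z\<^esub>)"
      using F.l_join[OF F.u_closed[OF y] G.ker_closed] G.ul[OF F.u_closed[OF y]] lu[OF y] by simp
  next
    fix z assume z: "z \<in> carrier Z"
    show "l (k z) \<in> carrier Y"
      using z G.u_closed F.l_closed by blast
    show "h (u (l (k z))) = z \<sqinter>\<^bsub>Z\<^esub> h (u \<top>\<^bsub>Y\<^esub>)"
      using ul[OF z] G.lu[OF z] F.u_top by simp
  next
    fix y z assume y: "y \<in> carrier Y" and z: "z \<in> carrier Z"
    have "u y \<sqsubseteq>\<^bsub>X\<^esub> k z \<longleftrightarrow> y \<sqsubseteq>\<^bsub>Y\<^esub> l (k z)"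
    proof
      assume "u y \<sqsubseteq>\<^bsub>X\<^esub> k z"
      then show "y \<sqsubseteq>\<^bsub>Y\<^esub> l (k z)"
        using F.l_mono[of "u y" "k z"] lu[OF y] F.u_closed[OF y] G.u_closed[OF z] by simp
    next
      assume "y \<sqsubseteq>\<^bsub>Y\<^esub> l (k z)"
      then show "u y \<sqsubseteq>\<^bsub>X\<^esub> k z"
        using F.u_mono[of y "l (k z)"] ul[OF z] F.l_closed[OF G.u_closed[OF z]] y by simp
    qed
    then show "h (u y) \<sqsubseteq>\<^bsub>Z\<^esub> z \<longleftrightarrow> y \<sqsubseteq>\<^bsub>Y\<^esub> l (k z)"
      using G.adj[OF F.u_closed[OF y] z] by simp
  qed
qed

lemma image_kernel_connection_cong:
  assumes "image_kernel_connection A B l u"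
    and l: "\<And>x. x \<in> carrier A \<Longrightarrow> l' x = l x" and u: "\<And>y. y \<in> carrier B \<Longrightarrow> u' y = u y"
  shows "image_kernel_connection A B l' u'"
proof -
  interpret F: image_kernel_connection A B l u by fact
  show ?thesis
    by unfold_locales
      (simp_all add: l u F.l_closed F.u_closed F.ul F.lu F.adj)
qed

lemma image_kernel_connection_id:
  assumes "bounded_lattice A"
  shows "image_kernel_connection A A (\<lambda>x. x) (\<lambda>x. x)"
proof -
  interpret bounded_lattice A by fact
  show ?thesis
    by unfold_locales (simp_all add: join_bottom meet_top)
qed

subsection \<open>Intervals\<close>

text \<open>The bounds \<open>t\<close> and \<open>b\<close> of \<open>D\<close> may differ from
  those of \<open>L\<close>: an upper interval changes the bottom element, a lower interval the
  top.\<close>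

lemma sublattice:
  fixes L :: "'l gorder"
  assumes "bounded_lattice L" and D: "D \<subseteq> carrier L"
    and J: "\<And>x y. x \<in> D \<Longrightarrow> y \<in> D \<Longrightarrow> x \<squnion>\<^bsub>L\<^esub> y \<in> D"
    and M: "\<And>x y. x \<in> D \<Longrightarrow> y \<in> D \<Longrightarrow> x \<sqinter>\<^bsub>L\<^esub> y \<in> D"
    and t: "t \<in> D" "\<And>x. x \<in> D \<Longrightarrow> x \<sqsubseteq>\<^bsub>L\<^esub> t"
    and b: "b \<in> D" "\<And>x. x \<in> D \<Longrightarrow> b \<sqsubseteq>\<^bsub>L\<^esub> x"
  defines "S \<equiv> L\<lparr>carrier := D\<rparr>"
  shows "bounded_lattice S"
    and "\<And>x y. x \<in> D \<Longrightarrow> y \<in> D \<Longrightarrow> x \<squnion>\<^bsub>S\<^esub> y = x \<squnion>\<^bsub>L\<^esub> y"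
    and "\<And>x y. x \<in> D \<Longrightarrow> y \<in> D \<Longrightarrow> x \<sqinter>\<^bsub>S\<^esub> y = x \<sqinter>\<^bsub>L\<^esub> y"
    and "\<top>\<^bsub>S\<^esub> = t" and "\<bottom>\<^bsub>S\<^esub> = b"
proof -
  interpret L: bounded_lattice L by fact
  have S: "carrier S = D" "le S = le L" "eq S = eq L"
    unfolding S_def by simp_all
  have jL: "x \<sqsubseteq>\<^bsub>L\<^esub> x \<squnion>\<^bsub>L\<^esub> y" "y \<sqsubseteq>\<^bsub>L\<^esub> x \<squnion>\<^bsub>L\<^esub> y"
    "\<And>z. z \<in> D \<Longrightarrow> x \<sqsubseteq>\<^bsub>L\<^esub> z \<Longrightarrow> y \<sqsubseteq>\<^bsub>L\<^esub> z \<Longrightarrow> x \<squnion>\<^bsub>L\<^esub> y \<sqsubseteq>\<^bsub>L\<^esub> z"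
    if "x \<in> D" "y \<in> D" for x y
    using that D by (auto intro: L.join_left L.join_right L.join_le)
  have mL: "x \<sqinter>\<^bsub>L\<^esub> y \<sqsubseteq>\<^bsub>L\<^esub> x" "x \<sqinter>\<^bsub>L\<^esub> y \<sqsubseteq>\<^bsub>L\<^esub> y"
    "\<And>z. z \<in> D \<Longrightarrow> z \<sqsubseteq>\<^bsub>L\<^esub> x \<Longrightarrow> z \<sqsubseteq>\<^bsub>L\<^esub> y \<Longrightarrow> z \<sqsubseteq>\<^bsub>L\<^esub> x \<sqinter>\<^bsub>L\<^esub> y"
    if "x \<in> D" "y \<in> D" for x y
    using that D by (auto intro: L.meet_left L.meet_right L.meet_le)
  have "partial_order S"
    using weak_partial_order_subset[OF L.weak_partial_order_axioms D] L.eq_is_equal S(3)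
    unfolding partial_order_def partial_order_axioms_def S_def by simp
  then show bl: "bounded_lattice S"
    by (rule bounded_latticeI[where j = "join L" and m = "meet L" and t = t and b = b])
      (use jL mL J M t b S in auto)
  interpret S: bounded_lattice S by (rule bl)
  show "\<And>x y. x \<in> D \<Longrightarrow> y \<in> D \<Longrightarrow> x \<squnion>\<^bsub>S\<^esub> y = x \<squnion>\<^bsub>L\<^esub> y"
    using J jL by (intro S.join_eqI) (auto simp: S)
  show "\<And>x y. x \<in> D \<Longrightarrow> y \<in> D \<Longrightarrow> x \<sqinter>\<^bsub>S\<^esub> y = x \<sqinter>\<^bsub>L\<^esub> y"
    using M mL by (intro S.meet_eqI) (auto simp: S)
  show "\<top>\<^bsub>S\<^esub> = t"
    using S.top_eq[of t] t S by simp
  show "\<bottom>\<^bsub>S\<^esub> = b"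
    using S.bottom_eq[of b] b S by simp
qed

lemma Mlc_objD:
  assumes "L \<in> Mlc_obj U"
  shows "bounded_lattice L" "modular_lattice L" "small U (carrier L)"
  using assms unfolding Mlc_obj_def by auto

lemma sublattice_Mlc_obj:
  fixes L :: "'l gorder"
  assumes L: "L \<in> Mlc_obj U" and D: "D \<subseteq> carrier L"
    and J: "\<And>x y. x \<in> D \<Longrightarrow> y \<in> D \<Longrightarrow> x \<squnion>\<^bsub>L\<^esub> y \<in> D"
    and M: "\<And>x y. x \<in> D \<Longrightarrow> y \<in> D \<Longrightarrow> x \<sqinter>\<^bsub>L\<^esub> y \<in> D"
    and t: "t \<in> D" "\<And>x. x \<in> D \<Longrightarrow> x \<sqsubseteq>\<^bsub>L\<^esub> t"
    and b: "b \<in> D" "\<And>x. x \<in> D \<Longrightarrow> b \<sqsubseteq>\<^bsub>L\<^esub> x"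
  shows "L\<lparr>carrier := D\<rparr> \<in> Mlc_obj U"
proof -
  note S = sublattice[OF Mlc_objD(1)[OF L] D J M t b]
  have "modular_lattice (L\<lparr>carrier := D\<rparr>)"
    using Mlc_objD(2)[OF L] D unfolding modular_lattice_def
    by (auto simp: S(2) S(3) J M subset_iff)
  then show ?thesis
    using S(1) small_subset[OF Mlc_objD(3)[OF L] D] unfolding Mlc_obj_def by simp
qed

context
  fixes L :: "'l gorder" and a :: 'l and U :: "'u itself"
  assumes L: "L \<in> Mlc_obj U" and a: "a \<in> carrier L"
begin

interpretation bounded_lattice L by (rule Mlc_objD(1)[OF L])

lemma carrier_upper_interval: "carrier (upper_interval L a) = {x \<in> carrier L. a \<sqsubseteq>\<^bsub>L\<^esub> x}"
  unfolding upper_interval_def at_least_at_most_def by auto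

lemma carrier_lower_interval: "carrier (lower_interval L a) = {x \<in> carrier L. x \<sqsubseteq>\<^bsub>L\<^esub> a}"
  unfolding lower_interval_def at_least_at_most_def by auto

lemma upper_interval_eq: "upper_interval L a = L\<lparr>carrier := {x \<in> carrier L. a \<sqsubseteq>\<^bsub>L\<^esub> x}\<rparr>"
  using carrier_upper_interval unfolding upper_interval_def by simp

lemma lower_interval_eq: "lower_interval L a = L\<lparr>carrier := {x \<in> carrier L. x \<sqsubseteq>\<^bsub>L\<^esub> a}\<rparr>"
  using carrier_lower_interval unfolding lower_interval_def by simp

lemma upper_interval_closed:
  "x \<in> carrier L \<Longrightarrow> y \<in> carrier L \<Longrightarrow> a \<sqsubseteq>\<^bsub>L\<^esub> x \<Longrightarrow> a \<sqsubseteq>\<^bsub>L\<^esub> y \<Longrightarrow> a \<sqsubseteq>\<^bsub>L\<^esub> x \<squnion>\<^bsub>L\<^esub> y"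
  "x \<in> carrier L \<Longrightarrow> y \<in> carrier L \<Longrightarrow> a \<sqsubseteq>\<^bsub>L\<^esub> x \<Longrightarrow> a \<sqsubseteq>\<^bsub>L\<^esub> y \<Longrightarrow> a \<sqsubseteq>\<^bsub>L\<^esub> x \<sqinter>\<^bsub>L\<^esub> y"
  using a le_trans[OF _ join_left] meet_le by simp_all

lemma lower_interval_closed:
  "x \<in> carrier L \<Longrightarrow> y \<in> carrier L \<Longrightarrow> x \<sqsubseteq>\<^bsub>L\<^esub> a \<Longrightarrow> y \<sqsubseteq>\<^bsub>L\<^esub> a \<Longrightarrow> x \<squnion>\<^bsub>L\<^esub> y \<sqsubseteq>\<^bsub>L\<^esub> a"
  "x \<in> carrier L \<Longrightarrow> y \<in> carrier L \<Longrightarrow> x \<sqsubseteq>\<^bsub>L\<^esub> a \<Longrightarrow> y \<sqsubseteq>\<^bsub>L\<^esub> a \<Longrightarrow> x \<sqinter>\<^bsub>L\<^esub> y \<sqsubseteq>\<^bsub>L\<^esub> a"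
  using a le_trans[OF meet_left] join_le by simp_all

lemma upper_interval_Mlc_obj: "upper_interval L a \<in> Mlc_obj U"
  unfolding upper_interval_eq
  by (rule sublattice_Mlc_obj[OF L, where t = "\<top>\<^bsub>L\<^esub>" and b = a])
    (use a upper_interval_closed in auto)

lemma lower_interval_Mlc_obj: "lower_interval L a \<in> Mlc_obj U"
  unfolding lower_interval_eq
  by (rule sublattice_Mlc_obj[OF L, where t = a and b = "\<bottom>\<^bsub>L\<^esub>"])
    (use a lower_interval_closed in auto)

lemma upper_interval_lattice:
  shows "x \<in> carrier L \<Longrightarrow> a \<sqsubseteq>\<^bsub>L\<^esub> x \<Longrightarrow> y \<in> carrier L \<Longrightarrow> a \<sqsubseteq>\<^bsub>L\<^esub> y \<Longrightarrow>
      x \<squnion>\<^bsub>upper_interval L a\<^esub> y = x \<squnion>\<^bsub>L\<^esub> y"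
    and "x \<in> carrier L \<Longrightarrow> a \<sqsubseteq>\<^bsub>L\<^esub> x \<Longrightarrow> y \<in> carrier L \<Longrightarrow> a \<sqsubseteq>\<^bsub>L\<^esub> y \<Longrightarrow>
      x \<sqinter>\<^bsub>upper_interval L a\<^esub> y = x \<sqinter>\<^bsub>L\<^esub> y"
    and "\<top>\<^bsub>upper_interval L a\<^esub> = \<top>\<^bsub>L\<^esub>" "\<bottom>\<^bsub>upper_interval L a\<^esub> = a"
  unfolding upper_interval_eq
  by ((rule sublattice[OF bounded_lattice_axioms, where t = "\<top>\<^bsub>L\<^esub>" and b = a];
    use a upper_interval_closed in auto)+)

lemma lower_interval_lattice:
  shows "x \<in> carrier L \<Longrightarrow> x \<sqsubseteq>\<^bsub>L\<^esub> a \<Longrightarrow> y \<in> carrier L \<Longrightarrow> y \<sqsubseteq>\<^bsub>L\<^esub> a \<Longrightarrow>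
      x \<squnion>\<^bsub>lower_interval L a\<^esub> y = x \<squnion>\<^bsub>L\<^esub> y"
    and "x \<in> carrier L \<Longrightarrow> x \<sqsubseteq>\<^bsub>L\<^esub> a \<Longrightarrow> y \<in> carrier L \<Longrightarrow> y \<sqsubseteq>\<^bsub>L\<^esub> a \<Longrightarrow>
      x \<sqinter>\<^bsub>lower_interval L a\<^esub> y = x \<sqinter>\<^bsub>L\<^esub> y"
    and "\<top>\<^bsub>lower_interval L a\<^esub> = a" "\<bottom>\<^bsub>lower_interval L a\<^esub> = \<bottom>\<^bsub>L\<^esub>"
  unfolding lower_interval_eq
  by ((rule sublattice[OF bounded_lattice_axioms, where t = a and b = "\<bottom>\<^bsub>L\<^esub>"];
    use a lower_interval_closed in auto)+)

lemma upper_interval_connection: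
  "image_kernel_connection L (upper_interval L a) (\<lambda>x. x \<squnion>\<^bsub>L\<^esub> a) (\<lambda>z. z)"
proof -
  interpret I: bounded_lattice "upper_interval L a"
    by (rule Mlc_objD(1)[OF upper_interval_Mlc_obj])
  show ?thesis
  proof
    fix x assume x: "x \<in> carrier L"
    then show "x \<squnion>\<^bsub>L\<^esub> a \<in> carrier (upper_interval L a)"
      using a by (simp add: carrier_upper_interval join_right)
    show "x \<squnion>\<^bsub>L\<^esub> a = x \<squnion>\<^bsub>L\<^esub> \<bottom>\<^bsub>upper_interval L a\<^esub>"
      by (simp add: upper_interval_lattice)
  next
    fix z assume z: "z \<in> carrier (upper_interval L a)"
    then show "z \<in> carrier L"
      by (simp add: carrier_upper_interval)
    have "\<top>\<^bsub>L\<^esub> \<squnion>\<^bsub>L\<^esub> a = \<top>\<^bsub>L\<^esub>" "z \<squnion>\<^bsub>L\<^esub> a = z"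
      using z a by (auto simp: carrier_upper_interval join_absorb)
    then show "z \<squnion>\<^bsub>L\<^esub> a = z \<sqinter>\<^bsub>upper_interval L a\<^esub> (\<top>\<^bsub>L\<^esub> \<squnion>\<^bsub>L\<^esub> a)"
      using z a by (simp add: carrier_upper_interval upper_interval_lattice meet_top)
  next
    fix x z assume x: "x \<in> carrier L" and z: "z \<in> carrier (upper_interval L a)"
    then have "x \<squnion>\<^bsub>L\<^esub> a \<sqsubseteq>\<^bsub>L\<^esub> z \<longleftrightarrow> x \<sqsubseteq>\<^bsub>L\<^esub> z"
      using a le_trans[OF join_left[of x a], of z] by (auto simp: carrier_upper_interval join_le)
    then show "x \<squnion>\<^bsub>L\<^esub> a \<sqsubseteq>\<^bsub>upper_interval L a\<^esub> z \<longleftrightarrow> x \<sqsubseteq>\<^bsub>L\<^esub> z"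
      by (simp add: upper_interval_def)
  qed
qed

lemma lower_interval_connection:
  "image_kernel_connection (lower_interval L a) L (\<lambda>z. z) (\<lambda>x. x \<sqinter>\<^bsub>L\<^esub> a)"
proof -
  interpret I: bounded_lattice "lower_interval L a"
    by (rule Mlc_objD(1)[OF lower_interval_Mlc_obj])
  show ?thesis
  proof
    fix x assume x: "x \<in> carrier L"
    then show "x \<sqinter>\<^bsub>L\<^esub> a \<in> carrier (lower_interval L a)"
      using a by (simp add: carrier_lower_interval meet_right)
    show "x \<sqinter>\<^bsub>L\<^esub> a = x \<sqinter>\<^bsub>L\<^esub> \<top>\<^bsub>lower_interval L a\<^esub>"
      by (simp add: lower_interval_lattice)
  next
    fix z assume z: "z \<in> carrier (lower_interval L a)"
    then show "z \<in> carrier L"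
      by (simp add: carrier_lower_interval)
    have "\<bottom>\<^bsub>L\<^esub> \<sqinter>\<^bsub>L\<^esub> a = \<bottom>\<^bsub>L\<^esub>" "z \<sqinter>\<^bsub>L\<^esub> a = z"
      using z a by (auto simp: carrier_lower_interval meet_absorb)
    then show "z \<sqinter>\<^bsub>L\<^esub> a = z \<squnion>\<^bsub>lower_interval L a\<^esub> (\<bottom>\<^bsub>L\<^esub> \<sqinter>\<^bsub>L\<^esub> a)"
      using z a by (simp add: carrier_lower_interval lower_interval_lattice join_bottom)
  next
    fix z x assume z: "z \<in> carrier (lower_interval L a)" and x: "x \<in> carrier L"
    then have "z \<sqsubseteq>\<^bsub>L\<^esub> x \<longleftrightarrow> z \<sqsubseteq>\<^bsub>L\<^esub> x \<sqinter>\<^bsub>L\<^esub> a"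
      using a le_trans[OF _ meet_left[of x a], of z] by (auto simp: carrier_lower_interval meet_le)
    then show "z \<sqsubseteq>\<^bsub>L\<^esub> x \<longleftrightarrow> z \<sqsubseteq>\<^bsub>lower_interval L a\<^esub> x \<sqinter>\<^bsub>L\<^esub> a"
      by (simp add: lower_interval_def)
  qed
qed

end

section \<open>The category of modular lattices\<close>

text \<open>Restriction to the carriers makes both maps extensional, so that an adjoint pair given
  by ordinary functions becomes an arrow of \<open>Mlc\<close>.\<close>

definition galcon_of :: "'l gorder \<Rightarrow> 'l gorder \<Rightarrow> ('l \<Rightarrow> 'l) \<Rightarrow> ('l \<Rightarrow> 'l) \<Rightarrow> ('l, 'l) galois" where
  "galcon_of A B l u =
     \<lparr>orderA = A, orderB = B, lower = restrict l (carrier A), upper = restrict u (carrier B)\<rparr>"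

lemma galcon_of_simps [simp]:
  "orderA (galcon_of A B l u) = A" "orderB (galcon_of A B l u) = B"
  "x \<in> carrier A \<Longrightarrow> lower (galcon_of A B l u) x = l x"
  "y \<in> carrier B \<Longrightarrow> upper (galcon_of A B l u) y = u y"
  unfolding galcon_of_def by simp_all

definition conn_im :: "('l, 'l) galois \<Rightarrow> 'l" where
  "conn_im f = lower f \<top>\<^bsub>orderA f\<^esub>"

definition conn_ker :: "('l, 'l) galois \<Rightarrow> 'l" where
  "conn_ker f = upper f \<bottom>\<^bsub>orderB f\<^esub>"

text \<open>\<open>galois_connection\<close> records only partial orders; the bounded lattice
  structure contained in \<open>image_kernel_connection\<close> has to come from the two
  hypotheses.\<close>

lemma modular_connection_iff:
  assumes "bounded_lattice (orderA f)" "bounded_lattice (orderB f)"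
  shows "modular_connection f \<longleftrightarrow>
    image_kernel_connection (orderA f) (orderB f) (lower f) (upper f) \<and>
    lower f \<in> extensional (carrier (orderA f)) \<and> upper f \<in> extensional (carrier (orderB f))"
proof -
  interpret A: bounded_lattice "orderA f" by fact
  interpret B: bounded_lattice "orderB f" by fact
  have "image_kernel_connection (orderA f) (orderB f) (lower f) (upper f) \<longleftrightarrow>
    galois_connection f \<and>
    (\<forall>x \<in> carrier (orderA f).
        upper f (lower f x) = x \<squnion>\<^bsub>orderA f\<^esub> upper f \<bottom>\<^bsub>orderB f\<^esub>) \<and>
     (\<forall>y \<in> carrier (orderB f).
        lower f (upper f y) = y \<sqinter>\<^bsub>orderB f\<^esub> lower f \<top>\<^bsub>orderA f\<^esub>)"
    using assms A.partial_order_axioms B.partial_order_axioms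
    unfolding image_kernel_connection_def image_kernel_connection_axioms_def
      galois_connection_def galois_connection_axioms_def connection_def
    by (simp add: Pi_iff) blast
  then show ?thesis
    unfolding modular_connection_def by blast
qed

lemma Mlc_simps [simp]:
  "Obj (Mlc U) = Mlc_obj U" "Arr (Mlc U) = Arr (Mlc_category U)"
  "Dom (Mlc U) = orderA" "Cod (Mlc U) = orderB"
  "Id (Mlc U) = Id (Mlc_category U)" "Comp (Mlc U) = Comp (Mlc_category U)"
  "Dom (Mlc_category U) = orderA" "Cod (Mlc_category U) = orderB"
  "Obj (Mlc_category U) = Mlc_obj U"
  unfolding Mlc_def Mlc_category_def by (simp_all add: category.defs)

lemma Hom_Mlc: "Hom (Mlc U) = Hom (Mlc_category U)"
  unfolding Hom_def by simp

lemma Mlc_hom_iff: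
  "f \<in> Hom (Mlc_category U) A B \<longleftrightarrow> A \<in> Mlc_obj U \<and> B \<in> Mlc_obj U \<and>
     orderA f = A \<and> orderB f = B \<and> image_kernel_connection A B (lower f) (upper f) \<and>
     lower f \<in> extensional (carrier A) \<and> upper f \<in> extensional (carrier B)"
proof -
  have "f \<in> Hom (Mlc_category U) A B \<longleftrightarrow> A \<in> Mlc_obj U \<and> B \<in> Mlc_obj U \<and>
     orderA f = A \<and> orderB f = B \<and> modular_connection f"
    unfolding Hom_def by (auto simp: Mlc_category_def)
  then show ?thesis
    using modular_connection_iff Mlc_objD(1) by metis
qed

lemma galcon_of_hom:
  assumes "A \<in> Mlc_obj U" "B \<in> Mlc_obj U" "image_kernel_connection A B l u"
  shows "galcon_of A B l u \<in> Hom (Mlc_category U) A B"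
  using assms image_kernel_connection_cong[OF assms(3), of "lower (galcon_of A B l u)" "upper (galcon_of A B l u)"]
  unfolding Mlc_hom_iff by (simp add: galcon_of_def)

lemma Mlc_comp_apply:
  "x \<in> carrier (orderA f) \<Longrightarrow> lower (Comp (Mlc_category U) g f) x = lower g (lower f x)"
  "z \<in> carrier (orderB g) \<Longrightarrow> upper (Comp (Mlc_category U) g f) z = upper f (upper g z)"
  "orderA (Comp (Mlc_category U) g f) = orderA f" "orderB (Comp (Mlc_category U) g f) = orderB g"
  unfolding Mlc_category_def by (simp_all add: compose_eq)

lemma Mlc_id_apply:
  "x \<in> carrier L \<Longrightarrow> lower (Id (Mlc_category U) L) x = x"
  "x \<in> carrier L \<Longrightarrow> upper (Id (Mlc_category U) L) x = x"
  unfolding Mlc_category_def by simp_all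

lemma Mlc_id_hom:
  assumes "L \<in> Mlc_obj U"
  shows "Id (Mlc_category U) L \<in> Hom (Mlc_category U) L L"
proof -
  have "Id (Mlc_category U) L = galcon_of L L (\<lambda>x. x) (\<lambda>x. x)"
    unfolding Mlc_category_def galcon_of_def by simp
  then show ?thesis
    using galcon_of_hom[OF assms assms image_kernel_connection_id[OF Mlc_objD(1)[OF assms]]] by simp
qed

text \<open>Closure under composition is where modularity of the objects enters, through the middle
  object \<open>B\<close>.\<close>

lemma Mlc_comp_hom:
  assumes "f \<in> Hom (Mlc_category U) A B" "g \<in> Hom (Mlc_category U) B D"
  shows "Comp (Mlc_category U) g f \<in> Hom (Mlc_category U) A D"
proof -
  have f: "A \<in> Mlc_obj U" "B \<in> Mlc_obj U" "orderA f = A" "orderB f = B"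
      "image_kernel_connection A B (lower f) (upper f)"
    and g: "D \<in> Mlc_obj U" "orderA g = B" "orderB g = D"
      "image_kernel_connection B D (lower g) (upper g)"
    using assms unfolding Mlc_hom_iff by auto
  have "Comp (Mlc_category U) g f =
      galcon_of A D (\<lambda>x. lower g (lower f x)) (\<lambda>z. upper f (upper g z))"
    unfolding Mlc_category_def galcon_of_def by (simp add: f g compose_def)
  then show ?thesis
    using galcon_of_hom[OF f(1) g(1) image_kernel_connection_comp[OF f(5) g(4) Mlc_objD(2)[OF f(2)]]]
    by simp
qed

text \<open>A left adjoint determines its right adjoint, so agreement of the lower maps suffices.
  This makes \<open>lower\<close> a faithful action.\<close>

lemma Mlc_hom_eqI:
  assumes f: "f \<in> Hom (Mlc_category U) A B" and g: "g \<in> Hom (Mlc_category U) A B"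
    and eq: "\<And>x. x \<in> carrier A \<Longrightarrow> lower f x = lower g x"
  shows "f = g"
proof -
  have fp: "orderA f = A" "orderB f = B" "image_kernel_connection A B (lower f) (upper f)"
      "lower f \<in> extensional (carrier A)" "upper f \<in> extensional (carrier B)"
    and gp: "orderA g = A" "orderB g = B" "image_kernel_connection A B (lower g) (upper g)"
      "lower g \<in> extensional (carrier A)" "upper g \<in> extensional (carrier B)"
    using f g unfolding Mlc_hom_iff by auto
  interpret F: image_kernel_connection A B "lower f" "upper f" by fact
  interpret G: image_kernel_connection A B "lower g" "upper g" by fact
  have "lower f = lower g"
    using eq fp(4) gp(4) extensionalityI by blast
  moreover have "upper f = upper g"
  proof (rule extensionalityI[OF fp(5) gp(5)])
    fix y assume y: "y \<in> carrier B"
    have "upper f y \<sqsubseteq>\<^bsub>A\<^esub> upper g y"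
      using G.adj[OF F.u_closed[OF y] y] F.lu_le[OF y] \<open>lower f = lower g\<close> by simp
    moreover have "upper g y \<sqsubseteq>\<^bsub>A\<^esub> upper f y"
      using F.adj[OF G.u_closed[OF y] y] G.lu_le[OF y] \<open>lower f = lower g\<close> by simp
    ultimately show "upper f y = upper g y"
      using F.u_closed[OF y] G.u_closed[OF y] F.A.le_antisym by blast
  qed
  ultimately show ?thesis
    using fp(1,2) gp(1,2) by (simp add: galcon.equality)
qed

lemma interval_quotient_hom:
  assumes "L \<in> Mlc_obj U" "a \<in> carrier L"
  shows "interval_quotient L a \<in> Hom (Mlc_category U) L (upper_interval L a)"
proof -
  have "interval_quotient L a = galcon_of L (upper_interval L a) (\<lambda>x. x \<squnion>\<^bsub>L\<^esub> a) (\<lambda>z. z)"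
    unfolding interval_quotient_def galcon_of_def by simp
  then show ?thesis
    using galcon_of_hom[OF assms(1) upper_interval_Mlc_obj[OF assms] upper_interval_connection[OF assms]]
    by simp
qed

lemma interval_embedding_hom:
  assumes "L \<in> Mlc_obj U" "a \<in> carrier L"
  shows "interval_embedding L a \<in> Hom (Mlc_category U) (lower_interval L a) L"
proof -
  have "interval_embedding L a = galcon_of (lower_interval L a) L (\<lambda>z. z) (\<lambda>x. x \<sqinter>\<^bsub>L\<^esub> a)"
    unfolding interval_embedding_def galcon_of_def by simp
  then show ?thesis
    using galcon_of_hom[OF lower_interval_Mlc_obj[OF assms] assms(1) lower_interval_connection[OF assms]]
    by simp
qed

lemma interval_quotient_im_ker:
  assumes "L \<in> Mlc_obj U" "a \<in> carrier L"
  shows "conn_im (interval_quotient L a) = \<top>\<^bsub>upper_interval L a\<^esub>"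
    and "conn_ker (interval_quotient L a) = a"
proof -
  interpret L: bounded_lattice L by (rule Mlc_objD(1)[OF assms(1)])
  interpret I: bounded_lattice "upper_interval L a"
    by (rule Mlc_objD(1)[OF upper_interval_Mlc_obj[OF assms]])
  show "conn_im (interval_quotient L a) = \<top>\<^bsub>upper_interval L a\<^esub>"
    unfolding conn_im_def interval_quotient_def
    using assms(2) by (simp add: upper_interval_lattice[OF assms] L.join_absorb)
  show "conn_ker (interval_quotient L a) = a"
    unfolding conn_ker_def interval_quotient_def
    using I.bottom_closed upper_interval_lattice(4)[OF assms] by simp
qed

lemma interval_embedding_im_ker:
  assumes "L \<in> Mlc_obj U" "a \<in> carrier L"
  shows "conn_im (interval_embedding L a) = a"
    and "conn_ker (interval_embedding L a) = \<bottom>\<^bsub>lower_interval L a\<^esub>"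
proof -
  interpret L: bounded_lattice L by (rule Mlc_objD(1)[OF assms(1)])
  interpret I: bounded_lattice "lower_interval L a"
    by (rule Mlc_objD(1)[OF lower_interval_Mlc_obj[OF assms]])
  show "conn_im (interval_embedding L a) = a"
    unfolding conn_im_def interval_embedding_def
    using I.top_closed lower_interval_lattice(3)[OF assms] by simp
  show "conn_ker (interval_embedding L a) = \<bottom>\<^bsub>lower_interval L a\<^esub>"
    unfolding conn_ker_def interval_embedding_def
    using assms(2) by (simp add: lower_interval_lattice[OF assms] L.meet_absorb)
qed

lemma Mlc_homD:
  assumes "f \<in> Hom (Mlc_category U) A B"
  shows "image_kernel_connection A B (lower f) (upper f)" "A \<in> Mlc_obj U" "B \<in> Mlc_obj U"
    "orderA f = A" "orderB f = B" "conn_im f = lower f \<top>\<^bsub>A\<^esub>" "conn_ker f = upper f \<bottom>\<^bsub>B\<^esub>"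
  using assms unfolding Mlc_hom_iff conn_im_def conn_ker_def by auto

lemma Mlc_surj_iff:
  assumes "f \<in> Hom (Mlc_category U) A B"
  shows "lower f ` carrier A = carrier B \<longleftrightarrow> conn_im f = \<top>\<^bsub>B\<^esub>"
  using image_kernel_connection.surj_iff[OF Mlc_homD(1)[OF assms]] Mlc_homD(6)[OF assms] by simp

lemma Mlc_inj_iff:
  assumes "f \<in> Hom (Mlc_category U) A B"
  shows "inj_on (lower f) (carrier A) \<longleftrightarrow> conn_ker f = \<bottom>\<^bsub>A\<^esub>"
  using image_kernel_connection.inj_iff[OF Mlc_homD(1)[OF assms]] Mlc_homD(7)[OF assms] by simp

lemma Mlc_lift:
  assumes f: "f \<in> Hom (Mlc_category U) Y Z" "conn_ker f = \<bottom>\<^bsub>Y\<^esub>"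
    and g: "g \<in> Hom (Mlc_category U) X Z" "conn_im g \<sqsubseteq>\<^bsub>Z\<^esub> conn_im f"
  shows "\<exists>h \<in> Hom (Mlc_category U) X Y. Comp (Mlc_category U) f h = g"
proof -
  note F = Mlc_homD[OF f(1)] and G = Mlc_homD[OF g(1)]
  let ?h = "galcon_of X Y (\<lambda>x. upper f (lower g x)) (\<lambda>y. upper g (lower f y))"
  note L = connection_lift[OF F(1) G(1) f(2)[unfolded F] g(2)[unfolded F G]]
  have h: "?h \<in> Hom (Mlc_category U) X Y"
    by (rule galcon_of_hom[OF G(2) F(2) L(1)])
  have "Comp (Mlc_category U) f ?h = g"
    by (rule Mlc_hom_eqI[OF Mlc_comp_hom[OF h f(1)] g(1)]) (simp add: Mlc_comp_apply L(2))
  then show ?thesis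
    using h by blast
qed

lemma Mlc_descend:
  assumes e: "e \<in> Hom (Mlc_category U) X Y" "conn_im e = \<top>\<^bsub>Y\<^esub>"
    and g: "g \<in> Hom (Mlc_category U) X Z" "conn_ker e \<sqsubseteq>\<^bsub>X\<^esub> conn_ker g"
  shows "\<exists>h \<in> Hom (Mlc_category U) Y Z. Comp (Mlc_category U) h e = g"
proof -
  note E = Mlc_homD[OF e(1)] and G = Mlc_homD[OF g(1)]
  let ?h = "galcon_of Y Z (\<lambda>y. lower g (upper e y)) (\<lambda>z. lower e (upper g z))"
  note L = connection_descend[OF E(1) G(1) e(2)[unfolded E] g(2)[unfolded E G]]
  have h: "?h \<in> Hom (Mlc_category U) Y Z"
    by (rule galcon_of_hom[OF E(3) G(3) L(1)])
  have "Comp (Mlc_category U) ?h e = g"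
  proof (rule Mlc_hom_eqI[OF Mlc_comp_hom[OF e(1) h] g(1)])
    fix x assume "x \<in> carrier X"
    then show "lower (Comp (Mlc_category U) ?h e) x = lower g x"
      using E image_kernel_connection.l_closed[OF E(1)] L(2) by (simp add: Mlc_comp_apply)
  qed
  then show ?thesis
    using h by blast
qed

lemma Mlc_arr_hom: "f \<in> Arr (Mlc_category U) \<Longrightarrow> f \<in> Hom (Mlc_category U) (orderA f) (orderB f)"
  using arr_hom[of f "Mlc_category U"] by simp

lemma Mlc_iso_bij:
  assumes "iso_arrow (Mlc_category U) f" "f \<in> Hom (Mlc_category U) A B"
  shows "inj_on (lower f) (carrier A)" "lower f ` carrier A = carrier B"
proof -
  note F = Mlc_homD[OF assms(2)]
  obtain g where g: "g \<in> Hom (Mlc_category U) B A"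
    "Comp (Mlc_category U) g f = Id (Mlc_category U) A"
    "Comp (Mlc_category U) f g = Id (Mlc_category U) B"
    using assms(1) F unfolding iso_arrow_def by auto
  note G = Mlc_homD[OF g(1)]
  have gf: "lower g (lower f x) = x" if "x \<in> carrier A" for x
    using Mlc_comp_apply(1)[of x f U g] g(2) Mlc_id_apply(1)[OF that, of U] that F by simp
  have fg: "lower f (lower g x) = x" if "x \<in> carrier B" for x
    using Mlc_comp_apply(1)[of x g U f] g(3) Mlc_id_apply(1)[OF that, of U] that G by simp
  show "inj_on (lower f) (carrier A)"
    using gf by (metis inj_onI)
  show "lower f ` carrier A = carrier B"
  proof (intro subset_antisym subsetI)
    fix y assume y: "y \<in> carrier B"
    then show "y \<in> lower f ` carrier A"
      using fg[OF y] image_kernel_connection.l_closed[OF G(1) y] by (metis image_eqI)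
  qed (use image_kernel_connection.l_closed[OF F(1)] in auto)
qed

lemma Mlc_isoI:
  assumes i: "i \<in> Hom (Mlc_category U) A B" and j: "j \<in> Hom (Mlc_category U) B A"
    and ji: "\<And>x. x \<in> carrier A \<Longrightarrow> lower j (lower i x) = x"
    and ij: "\<And>y. y \<in> carrier B \<Longrightarrow> lower i (lower j y) = y"
  shows "iso_arrow (Mlc_category U) i"
proof -
  note I = Mlc_homD[OF i] and J = Mlc_homD[OF j]
  have "Comp (Mlc_category U) j i = Id (Mlc_category U) A"
    by (rule Mlc_hom_eqI[OF Mlc_comp_hom[OF i j] Mlc_id_hom[OF I(2)]])
      (simp add: Mlc_comp_apply Mlc_id_apply I ji)
  moreover have "Comp (Mlc_category U) i j = Id (Mlc_category U) B"
    by (rule Mlc_hom_eqI[OF Mlc_comp_hom[OF j i] Mlc_id_hom[OF I(3)]])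
      (simp add: Mlc_comp_apply Mlc_id_apply J ij)
  ultimately show ?thesis
    using i j I HomD[OF i] unfolding iso_arrow_def by auto
qed

lemma Mlc_id_iso: "L \<in> Mlc_obj U \<Longrightarrow> iso_arrow (Mlc_category U) (Id (Mlc_category U) L)"
  by (rule Mlc_isoI[OF Mlc_id_hom Mlc_id_hom]) (simp_all add: Mlc_id_apply)

lemma isomorphic_arrowsI:
  assumes "f \<in> Hom C A B" "g \<in> Hom C A' B'" "i \<in> Hom C A A'" "j \<in> Hom C B B'"
    "iso_arrow C i" "iso_arrow C j" "Comp C j f = Comp C g i"
  shows "isomorphic_arrows C f g"
  unfolding isomorphic_arrows_def
  using assms(3-7) HomD[OF assms(1)] HomD[OF assms(2)] by blast

section \<open>The specified classes of \<open>Mlc\<close> as surjective and injective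
  connections\<close>

text \<open>Descending each arrow along the other gives \<open>h f = g\<close> and
  \<open>k g = f\<close>, and surjectivity of \<open>f\<close> and \<open>g\<close> makes
  \<open>h\<close> and \<open>k\<close> mutually inverse. Taking \<open>g\<close> to be an interval
  quotient identifies every surjective connection from its kernel.\<close>

lemma Mlc_quotients_isomorphic:
  assumes f: "f \<in> Hom (Mlc_category U) A B" "conn_im f = \<top>\<^bsub>B\<^esub>"
    and g: "g \<in> Hom (Mlc_category U) A D" "conn_im g = \<top>\<^bsub>D\<^esub>" and ker: "conn_ker f = conn_ker g"
  shows "isomorphic_arrows (Mlc_category U) f g"
proof -
  note F = Mlc_homD[OF f(1)] and G = Mlc_homD[OF g(1)]
  interpret A: bounded_lattice A by (rule Mlc_objD(1)[OF F(2)])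
  have K: "conn_ker f \<in> carrier A"
    using F image_kernel_connection.ker_closed[OF F(1)] by simp
  obtain h where h: "h \<in> Hom (Mlc_category U) B D" "Comp (Mlc_category U) h f = g"
    using Mlc_descend[OF f g(1)] ker K by auto
  obtain k where k: "k \<in> Hom (Mlc_category U) D B" "Comp (Mlc_category U) k g = f"
    using Mlc_descend[OF g f(1)] ker K by auto
  have hf: "lower h (lower f x) = lower g x" and kg: "lower k (lower g x) = lower f x"
    if "x \<in> carrier A" for x
    using that h(2) k(2) F G Mlc_comp_apply(1)[of x f U h] Mlc_comp_apply(1)[of x g U k] by auto
  have "iso_arrow (Mlc_category U) h"
  proof (rule Mlc_isoI[OF h(1) k(1)])
    fix y assume "y \<in> carrier B"
    then obtain x where "x \<in> carrier A" "y = lower f x"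
      using Mlc_surj_iff[OF f(1)] f(2) by blast
    then show "lower k (lower h y) = y"
      using hf kg by simp
  next
    fix y assume "y \<in> carrier D"
    then obtain x where "x \<in> carrier A" "y = lower g x"
      using Mlc_surj_iff[OF g(1)] g(2) by blast
    then show "lower h (lower k y) = y"
      using hf kg by simp
  qed
  moreover have "Comp (Mlc_category U) h f = Comp (Mlc_category U) g (Id (Mlc_category U) A)"
    using h(2) by (intro Mlc_hom_eqI[OF Mlc_comp_hom[OF f(1) h(1)] Mlc_comp_hom[OF Mlc_id_hom[OF F(2)] g(1)]])
      (use Mlc_homD(4)[OF Mlc_id_hom[OF F(2)]] in \<open>simp add: Mlc_comp_apply Mlc_id_apply\<close>)
  ultimately show ?thesis
    using isomorphic_arrowsI[OF f(1) g(1) Mlc_id_hom[OF F(2)] h(1) Mlc_id_iso[OF F(2)]] by blast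
qed

text \<open>Dual, with lifts in place of descents; injectivity of \<open>f\<close> and
  \<open>g\<close> shows that the lifts are mutually inverse.\<close>

lemma Mlc_embeddings_isomorphic:
  assumes f: "f \<in> Hom (Mlc_category U) B A" "conn_ker f = \<bottom>\<^bsub>B\<^esub>"
    and g: "g \<in> Hom (Mlc_category U) D A" "conn_ker g = \<bottom>\<^bsub>D\<^esub>" and im: "conn_im f = conn_im g"
  shows "isomorphic_arrows (Mlc_category U) f g"
proof -
  note F = Mlc_homD[OF f(1)]
  interpret A: bounded_lattice A by (rule Mlc_objD(1)[OF F(3)])
  have I: "conn_im f \<in> carrier A"
    using F image_kernel_connection.im_closed[OF F(1)] by simp
  obtain h where h: "h \<in> Hom (Mlc_category U) B D" "Comp (Mlc_category U) g h = f"
    using Mlc_lift[OF g f(1)] im I by auto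
  obtain k where k: "k \<in> Hom (Mlc_category U) D B" "Comp (Mlc_category U) f k = g"
    using Mlc_lift[OF f g(1)] im I by auto
  note H = Mlc_homD[OF h(1)] and K = Mlc_homD[OF k(1)]
  have gh: "lower g (lower h x) = lower f x" "lower h x \<in> carrier D" if "x \<in> carrier B" for x
    using that h(2) H Mlc_comp_apply(1)[of x h U g] image_kernel_connection.l_closed[OF H(1)] by auto
  have fk: "lower f (lower k x) = lower g x" "lower k x \<in> carrier B" if "x \<in> carrier D" for x
    using that k(2) K Mlc_comp_apply(1)[of x k U f] image_kernel_connection.l_closed[OF K(1)] by auto
  have "iso_arrow (Mlc_category U) h"
  proof (rule Mlc_isoI[OF h(1) k(1)])
    have finj: "inj_on (lower f) (carrier B)" and ginj: "inj_on (lower g) (carrier D)"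
      using Mlc_inj_iff[OF f(1)] f(2) Mlc_inj_iff[OF g(1)] g(2) by auto
    show "lower k (lower h y) = y" if y: "y \<in> carrier B" for y
      using inj_onD[OF finj, of "lower k (lower h y)" y] gh[OF y] fk[of "lower h y"] y by simp
    show "lower h (lower k y) = y" if y: "y \<in> carrier D" for y
      using inj_onD[OF ginj, of "lower h (lower k y)" y] fk[OF y] gh[of "lower k y"] y by simp
  qed
  moreover have "Comp (Mlc_category U) (Id (Mlc_category U) A) f = Comp (Mlc_category U) g h"
    using h(2) by (intro Mlc_hom_eqI[OF Mlc_comp_hom[OF f(1) Mlc_id_hom[OF F(3)]] Mlc_comp_hom[OF h(1) g(1)]])
      (simp add: Mlc_comp_apply F Mlc_id_apply image_kernel_connection.l_closed[OF F(1)])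
  ultimately show ?thesis
    using isomorphic_arrowsI[OF f(1) g(1) h(1) Mlc_id_hom[OF F(3)] _ Mlc_id_iso[OF F(3)]] by blast
qed

text \<open>Surjectivity is transported along isomorphisms of arrows from
  \<open>interval_quotient L a\<close>. Conversely, the interval quotient at
  \<open>conn_ker f\<close> has the same kernel as \<open>f\<close>, hence is isomorphic to
  it.\<close>

lemma Left_Mlc_iff:
  assumes f: "f \<in> Hom (Mlc_category U) A B"
  shows "f \<in> Left (Mlc U) \<longleftrightarrow> lower f ` carrier A = carrier B"
proof -
  note F = Mlc_homD[OF f]
  have L: "f \<in> Left (Mlc U) \<longleftrightarrow> (\<exists>L \<in> Mlc_obj U. \<exists>a \<in> carrier L.
      isomorphic_arrows (Mlc_category U) f (interval_quotient L a))"
    unfolding Mlc_def category.defs system_category.defs by simp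
  show ?thesis
  proof
    assume "f \<in> Left (Mlc U)"
    then obtain L a where La: "L \<in> Mlc_obj U" "a \<in> carrier L"
      "isomorphic_arrows (Mlc_category U) f (interval_quotient L a)"
      using L by blast
    let ?q = "interval_quotient L a"
    note qh = interval_quotient_hom[OF La(1,2)]
    note Q = Mlc_homD[OF qh]
    obtain i j where i: "i \<in> Hom (Mlc_category U) A L" "iso_arrow (Mlc_category U) i"
      and j: "j \<in> Hom (Mlc_category U) B (upper_interval L a)" "iso_arrow (Mlc_category U) j"
      and eq: "Comp (Mlc_category U) j f = Comp (Mlc_category U) ?q i"
      using La(3) F Q unfolding isomorphic_arrows_def by auto
    have "lower j ` lower f ` carrier A = lower ?q ` lower i ` carrier A"
      unfolding image_image
    proof (rule image_cong[OF refl])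
      fix x assume "x \<in> carrier A"
      then show "lower j (lower f x) = lower ?q (lower i x)"
        using eq Mlc_comp_apply(1)[of x f U j] Mlc_comp_apply(1)[of x i U ?q] F Mlc_homD(4)[OF i(1)]
        by simp
    qed
    also have "\<dots> = lower j ` carrier B"
      using Mlc_iso_bij[OF i(2,1)] Mlc_iso_bij[OF j(2,1)] Mlc_surj_iff[OF qh]
        interval_quotient_im_ker[OF La(1,2)] by simp
    finally show "lower f ` carrier A = carrier B"
      using inj_on_image_eq_iff[OF Mlc_iso_bij(1)[OF j(2,1)]]
        image_kernel_connection.l_closed[OF F(1)] by (simp add: image_subset_iff)
  next
    assume s: "lower f ` carrier A = carrier B"
    have K: "conn_ker f \<in> carrier A"
      using F image_kernel_connection.ker_closed[OF F(1)] by simp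
    have "isomorphic_arrows (Mlc_category U) f (interval_quotient A (conn_ker f))"
      using Mlc_quotients_isomorphic[OF f _ interval_quotient_hom[OF F(2) K]] Mlc_surj_iff[OF f] s
        interval_quotient_im_ker[OF F(2) K] by simp
    then show "f \<in> Left (Mlc U)"
      using L K F(2) by blast
  qed
qed

text \<open>Here the arrow of comparison is the interval embedding at
  \<open>conn_im f\<close>.\<close>

lemma Right_Mlc_iff:
  assumes f: "f \<in> Hom (Mlc_category U) A B"
  shows "f \<in> Right (Mlc U) \<longleftrightarrow> inj_on (lower f) (carrier A)"
proof -
  note F = Mlc_homD[OF f]
  have L: "f \<in> Right (Mlc U) \<longleftrightarrow> (\<exists>L \<in> Mlc_obj U. \<exists>a \<in> carrier L.
      isomorphic_arrows (Mlc_category U) f (interval_embedding L a))"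
    unfolding Mlc_def category.defs system_category.defs by simp
  show ?thesis
  proof
    assume "f \<in> Right (Mlc U)"
    then obtain L a where La: "L \<in> Mlc_obj U" "a \<in> carrier L"
      "isomorphic_arrows (Mlc_category U) f (interval_embedding L a)"
      using L by blast
    let ?q = "interval_embedding L a"
    note qh = interval_embedding_hom[OF La(1,2)]
    note Q = Mlc_homD[OF qh]
    obtain i j where i: "i \<in> Hom (Mlc_category U) A (lower_interval L a)" "iso_arrow (Mlc_category U) i"
      and j: "j \<in> Hom (Mlc_category U) B L" "iso_arrow (Mlc_category U) j"
      and eq: "Comp (Mlc_category U) j f = Comp (Mlc_category U) ?q i"
      using La(3) F Q unfolding isomorphic_arrows_def by auto
    have qinj: "inj_on (lower ?q) (carrier (lower_interval L a))"
      using Mlc_inj_iff[OF qh] interval_embedding_im_ker[OF La(1,2)] by simp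
    show "inj_on (lower f) (carrier A)"
    proof (rule inj_onI)
      fix x y assume xy: "x \<in> carrier A" "y \<in> carrier A" "lower f x = lower f y"
      then have "lower ?q (lower i x) = lower ?q (lower i y)"
        using eq Mlc_comp_apply(1)[of x f U j] Mlc_comp_apply(1)[of x i U ?q]
          Mlc_comp_apply(1)[of y f U j] Mlc_comp_apply(1)[of y i U ?q] F Mlc_homD(4)[OF i(1)]
        by simp
      then have "lower i x = lower i y"
        using inj_onD[OF qinj] xy image_kernel_connection.l_closed[OF Mlc_homD(1)[OF i(1)]] by simp
      then show "x = y"
        using inj_onD[OF Mlc_iso_bij(1)[OF i(2,1)]] xy by simp
    qed
  next
    assume s: "inj_on (lower f) (carrier A)"
    have K: "conn_im f \<in> carrier B"
      using F image_kernel_connection.im_closed[OF F(1)] by simp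
    have "isomorphic_arrows (Mlc_category U) f (interval_embedding B (conn_im f))"
      using Mlc_embeddings_isomorphic[OF f _ interval_embedding_hom[OF F(3) K]] Mlc_inj_iff[OF f] s
        interval_embedding_im_ker[OF F(3) K] by simp
    then show "f \<in> Right (Mlc U)"
      using L K F(3) by blast
  qed
qed

text \<open>Both images are principal ideals, so inclusion amounts to comparing their greatest
  elements.\<close>

lemma Mlc_image_subset_iff:
  assumes f: "f \<in> Hom (Mlc_category U) A B" and g: "g \<in> Hom (Mlc_category U) D B"
  shows "lower g ` carrier D \<subseteq> lower f ` carrier A \<longleftrightarrow> conn_im g \<sqsubseteq>\<^bsub>B\<^esub> conn_im f"
proof -
  note F = Mlc_homD[OF f] and G = Mlc_homD[OF g]
  interpret F: image_kernel_connection A B "lower f" "upper f" by (rule F(1))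
  interpret G: image_kernel_connection D B "lower g" "upper g" by (rule G(1))
  show ?thesis
    unfolding F.image_l G.image_l F(6) G(6)
    using F.im_closed G.im_closed F.B.le_trans by blast
qed

lemma Mlc_kernel_pair_subset_iff:
  assumes f: "f \<in> Hom (Mlc_category U) A B" and g: "g \<in> Hom (Mlc_category U) A D"
  shows "kernel_pair (carrier A) (lower f) \<subseteq> kernel_pair (carrier A) (lower g) \<longleftrightarrow>
    conn_ker f \<sqsubseteq>\<^bsub>A\<^esub> conn_ker g"
  using image_kernel_connection.kernel_pair_subset_iff[OF Mlc_homD(1)[OF f] Mlc_homD(1)[OF g]]
    Mlc_homD(7)[OF f] Mlc_homD(7)[OF g] by simp

lemma conn_im_closed: "f \<in> Hom (Mlc_category U) A B \<Longrightarrow> conn_im f \<in> carrier B"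
  using image_kernel_connection.im_closed Mlc_homD(1,6) by metis

lemma conn_ker_closed: "f \<in> Hom (Mlc_category U) A B \<Longrightarrow> conn_ker f \<in> carrier A"
  using image_kernel_connection.ker_closed Mlc_homD(1,7) by metis

lemma conn_im_comp:
  assumes "f \<in> Hom (Mlc_category U) A B" "g \<in> Hom (Mlc_category U) B D"
  shows "conn_im (Comp (Mlc_category U) g f) = lower g (conn_im f)"
proof -
  interpret bounded_lattice A by (rule Mlc_objD(1)[OF Mlc_homD(2)[OF assms(1)]])
  show ?thesis
    using Mlc_homD(4)[OF assms(1)] unfolding conn_im_def by (simp add: Mlc_comp_apply)
qed

lemma conn_ker_comp:
  assumes "f \<in> Hom (Mlc_category U) A B" "g \<in> Hom (Mlc_category U) B D"
  shows "conn_ker (Comp (Mlc_category U) g f) = upper f (conn_ker g)"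
proof -
  interpret bounded_lattice D by (rule Mlc_objD(1)[OF Mlc_homD(3)[OF assms(2)]])
  show ?thesis
    using Mlc_homD(5)[OF assms(2)] unfolding conn_ker_def by (simp add: Mlc_comp_apply)
qed

lemma concrete_system_Mlc:
  assumes universe: "inaccessible_universe U"
  shows "concrete_system U (Mlc U :: ('l gorder, ('l, 'l) galois) system_category) carrier lower"
proof (unfold_locales, unfold Hom_Mlc)
  let ?M = "Mlc_category U :: ('l gorder, ('l, 'l) galois) category"
  show "inaccessible_universe U" by fact
  show "Dom (Mlc U) f \<in> Obj (Mlc U)" "Cod (Mlc U) f \<in> Obj (Mlc U)"
    if "f \<in> Arr (Mlc U)" for f :: "('l, 'l) galois"
    using that Mlc_arr_hom[of f U] Mlc_homD(2,3)[of f U] by simp_all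
  show "Id (Mlc U) X \<in> Hom ?M X X" if "X \<in> Obj (Mlc U)" for X
    using that Mlc_id_hom by simp
  show "Comp (Mlc U) g f \<in> Hom ?M X Z" if "f \<in> Hom ?M X Y" "g \<in> Hom ?M Y Z" for f g X Y Z
    using Mlc_comp_hom[OF that] by simp
  show "small U (carrier X)" if "X \<in> Obj (Mlc U)" for X :: "'l gorder"
    using that Mlc_objD(3) by simp
  show "lower f \<in> carrier X \<rightarrow>\<^sub>E carrier Y" if "f \<in> Hom ?M X Y" for f X Y
    using that image_kernel_connection.l_closed[of X Y "lower f" "upper f"]
    unfolding Mlc_hom_iff PiE_iff by simp
  show "lower (Id (Mlc U) X) x = x" if "X \<in> Obj (Mlc U)" "x \<in> carrier X" for x :: 'l and X
    using that Mlc_id_apply(1) by simp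
  show "lower (Comp (Mlc U) g f) x = lower g (lower f x)"
    if "f \<in> Hom ?M X Y" "g \<in> Hom ?M Y Z" "x \<in> carrier X" for f g X Y Z x
    using that(3) Mlc_homD(4)[OF that(1)] by (simp add: Mlc_comp_apply)
  show "f = g" if "f \<in> Hom ?M X Y" "g \<in> Hom ?M X Y" "lower f = lower g" for f g X Y
    using Mlc_hom_eqI[OF that(1,2)] that(3) by simp
  show "f \<in> Left (Mlc U) \<longleftrightarrow> lower f ` carrier X = carrier Y" if "f \<in> Hom ?M X Y" for f X Y
    by (rule Left_Mlc_iff[OF that])
  show "f \<in> Right (Mlc U) \<longleftrightarrow> inj_on (lower f) (carrier X)" if "f \<in> Hom ?M X Y" for f X Y
    by (rule Right_Mlc_iff[OF that])
  show "Left (Mlc U) \<subseteq> Arr (Mlc U :: ('l gorder, ('l, 'l) galois) system_category)"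
    "Right (Mlc U) \<subseteq> Arr (Mlc U :: ('l gorder, ('l, 'l) galois) system_category)"
    unfolding Mlc_def category.defs system_category.defs isomorphic_arrows_def
    by (auto simp: Mlc_category_def)
  show "\<exists>h \<in> Hom ?M X Y. Comp (Mlc U) f h = g"
    if "f \<in> Right (Mlc U)" "f \<in> Hom ?M Y Z" "g \<in> Hom ?M X Z"
      "lower g ` carrier X \<subseteq> lower f ` carrier Y" for f g X Y Z
    using Mlc_lift[OF that(2) _ that(3)] that Right_Mlc_iff[OF that(2)] Mlc_inj_iff[OF that(2)]
      Mlc_image_subset_iff[OF that(2,3)] by simp
  show "\<exists>h \<in> Hom ?M Y Z. Comp (Mlc U) h e = g"
    if "e \<in> Left (Mlc U)" "e \<in> Hom ?M X Y" "g \<in> Hom ?M X Z"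
      "kernel_pair (carrier X) (lower e) \<subseteq> kernel_pair (carrier X) (lower g)" for e g X Y Z
    using Mlc_descend[OF that(2) _ that(3)] that Left_Mlc_iff[OF that(2)] Mlc_surj_iff[OF that(2)]
      Mlc_kernel_pair_subset_iff[OF that(2,3)] by simp
  show "\<exists>Z. \<exists>e \<in> Left (Mlc U) \<inter> Hom ?M X Z. \<exists>m \<in> Right (Mlc U) \<inter> Hom ?M Z Y.
      f = Comp (Mlc U) m e" if f: "f \<in> Hom ?M X Y" for f X Y
  proof -
    note F = Mlc_homD[OF f]
    \<comment> \<open>The factorization runs through the interval below \<open>conn_im f\<close>.
      The lift \<open>e\<close> is surjective because its image element is the top of that
      interval.\<close>
    let ?m = "interval_embedding Y (conn_im f)" and ?Z = "lower_interval Y (conn_im f)"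
    have I: "conn_im f \<in> carrier Y" by (rule conn_im_closed[OF f])
    interpret Y: bounded_lattice Y by (rule Mlc_objD(1)[OF F(3)])
    note m = interval_embedding_hom[OF F(3) I] and mi = interval_embedding_im_ker[OF F(3) I]
    obtain e where e: "e \<in> Hom ?M X ?Z" "Comp ?M ?m e = f"
      using Mlc_lift[OF m mi(2) f] mi(1) I by auto
    note E = Mlc_homD[OF e(1)]
    have "conn_im e \<in> carrier ?Z"
      by (rule conn_im_closed[OF e(1)])
    then have "conn_im e = conn_im f"
      using conn_im_comp[OF e(1) m] e(2) by (simp add: interval_embedding_def)
    then have "e \<in> Left (Mlc U)"
      using Left_Mlc_iff[OF e(1)] Mlc_surj_iff[OF e(1)] lower_interval_lattice(3)[OF F(3) I] by simp
    moreover have "?m \<in> Right (Mlc U)"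
      using Right_Mlc_iff[OF m] Mlc_inj_iff[OF m] mi(2) by simp
    ultimately show ?thesis
      using e m by (intro exI[of _ ?Z] bexI[of _ e] bexI[of _ ?m]) simp_all
  qed
  show "\<exists>W. \<exists>n \<in> Right (Mlc U) \<inter> Hom ?M W Z.
      lower n ` carrier W = lower f ` carrier X \<inter> lower g ` carrier Y"
    if f: "f \<in> Hom ?M X Z" and g: "g \<in> Hom ?M Y Z" for f g X Y Z
  proof -
    note F = Mlc_homD[OF f] and G = Mlc_homD[OF g]
    interpret F: image_kernel_connection X Z "lower f" "upper f" by (rule F(1))
    interpret G: image_kernel_connection Y Z "lower g" "upper g" by (rule G(1))
    \<comment> \<open>Two principal ideals intersect in the principal ideal of the meet of their
      generators.\<close>
    let ?a = "conn_im f \<sqinter>\<^bsub>Z\<^esub> conn_im g"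
    have I: "conn_im f \<in> carrier Z" "conn_im g \<in> carrier Z"
      using conn_im_closed f g by blast+
    then have a: "?a \<in> carrier Z" by simp
    note m = interval_embedding_hom[OF F(3) a] and mi = interval_embedding_im_ker[OF F(3) a]
    interpret N: image_kernel_connection "lower_interval Z ?a" Z
      "lower (interval_embedding Z ?a)" "upper (interval_embedding Z ?a)" by (rule Mlc_homD(1)[OF m])
    have "lower (interval_embedding Z ?a) ` carrier (lower_interval Z ?a) =
        {z \<in> carrier Z. z \<sqsubseteq>\<^bsub>Z\<^esub> ?a}"
      using N.image_l mi(1) Mlc_homD(6)[OF m] by simp
    also have "\<dots> = {z \<in> carrier Z. z \<sqsubseteq>\<^bsub>Z\<^esub> conn_im f} \<inter> {z \<in> carrier Z. z \<sqsubseteq>\<^bsub>Z\<^esub> conn_im g}"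
    proof -
      have "z \<sqsubseteq>\<^bsub>Z\<^esub> ?a \<longleftrightarrow> z \<sqsubseteq>\<^bsub>Z\<^esub> conn_im f \<and> z \<sqsubseteq>\<^bsub>Z\<^esub> conn_im g" if z: "z \<in> carrier Z" for z
        using F.B.le_trans[OF _ F.B.meet_left[OF I] z a I(1)]
          F.B.le_trans[OF _ F.B.meet_right[OF I] z a I(2)] F.B.meet_le[OF _ _ I z] by blast
      then show ?thesis by auto
    qed
    also have "\<dots> = lower f ` carrier X \<inter> lower g ` carrier Y"
      using F.image_l G.image_l F(6) G(6) by simp
    finally show ?thesis
      using m Right_Mlc_iff[OF m] Mlc_inj_iff[OF m] mi(2) by auto
  qed
  show "\<exists>W. \<exists>n \<in> Left (Mlc U) \<inter> Hom ?M X W.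
             kernel_pair (carrier X) (lower f) \<subseteq> kernel_pair (carrier X) (lower n) \<and>
             kernel_pair (carrier X) (lower g) \<subseteq> kernel_pair (carrier X) (lower n) \<and>
             (\<forall>V. \<forall>w \<in> Hom ?M X V.
                kernel_pair (carrier X) (lower f) \<subseteq> kernel_pair (carrier X) (lower w) \<longrightarrow>
                kernel_pair (carrier X) (lower g) \<subseteq> kernel_pair (carrier X) (lower w) \<longrightarrow>
                kernel_pair (carrier X) (lower n) \<subseteq> kernel_pair (carrier X) (lower w))"
    if f: "f \<in> Hom ?M X Y" and g: "g \<in> Hom ?M X Z" for f g X Y Z
  proof -
    note F = Mlc_homD[OF f] and G = Mlc_homD[OF g]
    interpret X: bounded_lattice X by (rule Mlc_objD(1)[OF F(2)])
    \<comment> \<open>Kernel pairs are ordered like kernel elements, so the least one above both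
      belongs to the join.\<close>
    let ?a = "conn_ker f \<squnion>\<^bsub>X\<^esub> conn_ker g"
    have K: "conn_ker f \<in> carrier X" "conn_ker g \<in> carrier X"
      using conn_ker_closed f g by blast+
    then have a: "?a \<in> carrier X" by simp
    note q = interval_quotient_hom[OF F(2) a] and qi = interval_quotient_im_ker[OF F(2) a]
    have "interval_quotient X ?a \<in> Left (Mlc U)"
      using Left_Mlc_iff[OF q] Mlc_surj_iff[OF q] qi(1) by simp
    moreover have "conn_ker f \<sqsubseteq>\<^bsub>X\<^esub> ?a" "conn_ker g \<sqsubseteq>\<^bsub>X\<^esub> ?a"
      using K X.join_left X.join_right by auto
    moreover have "?a \<sqsubseteq>\<^bsub>X\<^esub> conn_ker w"
      if "w \<in> Hom ?M X V" "conn_ker f \<sqsubseteq>\<^bsub>X\<^esub> conn_ker w" "conn_ker g \<sqsubseteq>\<^bsub>X\<^esub> conn_ker w" for w V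
      using that K conn_ker_closed[OF that(1)] X.join_le by blast
    ultimately show ?thesis
      using q by (intro exI[of _ "upper_interval X ?a"] bexI[of _ "interval_quotient X ?a"])
        (auto simp: Mlc_kernel_pair_subset_iff[OF f] Mlc_kernel_pair_subset_iff[OF g]
          Mlc_kernel_pair_subset_iff[OF q] qi(2))
  qed
qed

lemma transfer_category_Mlc:
  assumes "inaccessible_universe U"
  shows "transfer_category U (Mlc U :: ('l gorder, ('l, 'l) galois) system_category)"
proof -
  interpret concrete_system U "Mlc U :: ('l gorder, ('l, 'l) galois) system_category" carrier lower
    by (rule concrete_system_Mlc[OF assms])
  show ?thesis by (rule transfer_category_axioms)
qed

text \<open>The embedding of the interval below the meet is a test arrow: its image lies in both
  images, hence in their intersection, which is the image of \<open>f p\<close>.\<close>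

lemma Mlc_pullback_im:
  assumes universe: "inaccessible_universe U"
    and f: "f \<in> Right (Mlc U)" and g: "g \<in> Right (Mlc U)" and pb: "is_pullback (Mlc U) f g p q"
  shows "conn_im (Comp (Mlc_category U) f p) = conn_im f \<sqinter>\<^bsub>orderB f\<^esub> conn_im g"
proof -
  interpret C: concrete_system U "Mlc U" carrier lower
    by (rule concrete_system_Mlc[OF universe])
  note D = is_pullbackD[OF pb, unfolded Hom_Mlc, simplified]
  have fh: "f \<in> Hom (Mlc_category U) (orderA f) (orderB f)"
    and gh: "g \<in> Hom (Mlc_category U) (orderA g) (orderB f)"
    using Mlc_arr_hom[OF D(1)] Mlc_arr_hom[OF D(2)] D(3) by simp_all
  note n = Mlc_comp_hom[OF D(4) fh]
  interpret B: bounded_lattice "orderB f" by (rule Mlc_objD(1)[OF Mlc_homD(3)[OF fh]])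
  have I: "conn_im f \<in> carrier (orderB f)" "conn_im g \<in> carrier (orderB f)"
    "conn_im (Comp (Mlc_category U) f p) \<in> carrier (orderB f)"
    using conn_im_closed fh gh n by blast+
  have img: "lower (Comp (Mlc_category U) f p) ` carrier (orderA p) =
      lower f ` carrier (orderA f) \<inter> lower g ` carrier (orderA g)"
    using C.pullback_image[OF f g pb] by simp
  let ?i = "interval_embedding (orderB f) (conn_im f \<sqinter>\<^bsub>orderB f\<^esub> conn_im g)"
  have a: "conn_im f \<sqinter>\<^bsub>orderB f\<^esub> conn_im g \<in> carrier (orderB f)"
    using I by simp
  note m = interval_embedding_hom[OF Mlc_homD(3)[OF fh] a]
    and mi = interval_embedding_im_ker[OF Mlc_homD(3)[OF fh] a]
  have "lower ?i ` carrier (lower_interval (orderB f) (conn_im f \<sqinter>\<^bsub>orderB f\<^esub> conn_im g))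
      \<subseteq> lower f ` carrier (orderA f) \<inter> lower g ` carrier (orderA g)"
    using Mlc_image_subset_iff[OF fh m] Mlc_image_subset_iff[OF gh m] mi(1)
      B.meet_left[OF I(1,2)] B.meet_right[OF I(1,2)] by simp
  then have "conn_im f \<sqinter>\<^bsub>orderB f\<^esub> conn_im g \<sqsubseteq>\<^bsub>orderB f\<^esub> conn_im (Comp (Mlc_category U) f p)"
    using Mlc_image_subset_iff[OF n m] img mi(1) by simp
  moreover have "conn_im (Comp (Mlc_category U) f p) \<sqsubseteq>\<^bsub>orderB f\<^esub> conn_im f \<sqinter>\<^bsub>orderB f\<^esub> conn_im g"
    using Mlc_image_subset_iff[OF fh n] Mlc_image_subset_iff[OF gh n] img I B.meet_le by simp
  ultimately show ?thesis
    using I a B.le_antisym by blast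
qed

text \<open>The interval quotient at the join of the kernels is the test arrow: it factors through
  the pushout, so the kernel of \<open>p f\<close> is at most the join. The opposite inequality only
  uses that the square commutes.\<close>

lemma Mlc_pushout_ker:
  assumes universe: "inaccessible_universe U"
    and f: "f \<in> Left (Mlc U)" and g: "g \<in> Left (Mlc U)" and po: "is_pushout (Mlc U) f g p q"
  shows "conn_ker (Comp (Mlc_category U) p f) = conn_ker f \<squnion>\<^bsub>orderA f\<^esub> conn_ker g"
proof -
  interpret C: concrete_system U "Mlc U" carrier lower
    by (rule concrete_system_Mlc[OF universe])
  note D = is_pushoutD[OF po, unfolded Hom_Mlc, simplified]
  have fh: "f \<in> Hom (Mlc_category U) (orderA f) (orderB f)"
    and gh: "g \<in> Hom (Mlc_category U) (orderA f) (orderB g)"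
    using Mlc_arr_hom[OF D(1)] Mlc_arr_hom[OF D(2)] D(3) by simp_all
  note n = Mlc_comp_hom[OF fh D(4)]
  interpret A: bounded_lattice "orderA f" by (rule Mlc_objD(1)[OF Mlc_homD(2)[OF fh]])
  have K: "conn_ker f \<in> carrier (orderA f)" "conn_ker g \<in> carrier (orderA f)"
    "conn_ker (Comp (Mlc_category U) p f) \<in> carrier (orderA f)"
    using conn_ker_closed fh gh n by blast+
  let ?a = "conn_ker f \<squnion>\<^bsub>orderA f\<^esub> conn_ker g"
  have a: "?a \<in> carrier (orderA f)"
    using K by simp
  note w = interval_quotient_hom[OF Mlc_homD(2)[OF fh] a]
    and wi = interval_quotient_im_ker[OF Mlc_homD(2)[OF fh] a]
  have "kernel_pair (carrier (orderA f)) (lower (Comp (Mlc_category U) p f)) \<subseteq>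
      kernel_pair (carrier (orderA f)) (lower (interval_quotient (orderA f) ?a))"
    using C.pushout_kernel[OF f g po, unfolded Hom_Mlc, simplified, OF w]
      Mlc_kernel_pair_subset_iff[OF fh w] Mlc_kernel_pair_subset_iff[OF gh w] wi(2)
      A.join_left[OF K(1,2)] A.join_right[OF K(1,2)] by simp
  then have "conn_ker (Comp (Mlc_category U) p f) \<sqsubseteq>\<^bsub>orderA f\<^esub> ?a"
    using Mlc_kernel_pair_subset_iff[OF n w] wi(2) by simp
  moreover have "conn_ker f \<sqsubseteq>\<^bsub>orderA f\<^esub> conn_ker (Comp (Mlc_category U) p f)"
    using conn_ker_comp[OF fh D(4)] image_kernel_connection.ker_le_u[OF Mlc_homD(1)[OF fh]]
      conn_ker_closed[OF D(4)] Mlc_homD(7)[OF fh] by simp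
  moreover have "conn_ker g \<sqsubseteq>\<^bsub>orderA f\<^esub> conn_ker (Comp (Mlc_category U) p f)"
    using conn_ker_comp[OF gh D(5)] image_kernel_connection.ker_le_u[OF Mlc_homD(1)[OF gh]]
      conn_ker_closed[OF D(5)] Mlc_homD(7)[OF gh] D(6) by simp
  ultimately show ?thesis
    using K a A.le_antisym A.join_le by blast
qed

lemma Mlc_iso_iff:
  assumes "inaccessible_universe U" "f \<in> Hom (Mlc_category U) A B"
  shows "iso_arrow (Mlc U) f \<longleftrightarrow> conn_im f = \<top>\<^bsub>B\<^esub> \<and> conn_ker f = \<bottom>\<^bsub>A\<^esub>"
proof -
  interpret C: concrete_system U "Mlc U" carrier lower
    by (rule concrete_system_Mlc[OF assms(1)])
  show ?thesis
    using C.iso_iff[unfolded Hom_Mlc, OF assms(2)] Left_Mlc_iff[OF assms(2)] Right_Mlc_iff[OF assms(2)]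
      Mlc_surj_iff[OF assms(2)] Mlc_inj_iff[OF assms(2)] by simp
qed

section \<open>Transfer functors into \<open>Mlc\<close> described by images and kernels\<close>

lemma is_functorD:
  assumes "is_functor C D T"
  shows "\<And>X. X \<in> Obj C \<Longrightarrow> on_obj T X \<in> Obj D"
    and "\<And>f X Y. f \<in> Hom C X Y \<Longrightarrow> on_arr T f \<in> Hom D (on_obj T X) (on_obj T Y)"
    and "\<And>X. X \<in> Obj C \<Longrightarrow> on_arr T (Id C X) = Id D (on_obj T X)"
    and "\<And>f g X Y Z. f \<in> Hom C X Y \<Longrightarrow> g \<in> Hom C Y Z \<Longrightarrow>
       on_arr T (Comp C g f) = Comp D (on_arr T g) (on_arr T f)"
  using assms unfolding is_functor_def Hom_def by auto

text \<open>\<open>pull\<close> and \<open>push\<close> ask for one inequality each, since the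
  opposite one holds for every commuting square. That \<open>p\<close> lies in the right or left
  class follows from the factorization system of \<open>C\<close>, so its image under
  \<open>T\<close> is injective or surjective, as the recognition lemmas for \<open>Mlc\<close>
  require.\<close>

lemma transfer_functor_MlcI:
  fixes T :: "('o, 'a, 'l gorder, ('l, 'l) galois) functor_data"
    and C :: "('o, 'a, 'm) system_category_scheme" and U :: "'u itself"
  assumes universe: "inaccessible_universe U" and C: "transfer_category U C"
    and T: "is_functor C (Mlc U) T"
    and left: "\<And>f. f \<in> Left C \<Longrightarrow> conn_im (on_arr T f) = \<top>\<^bsub>on_obj T (Cod C f)\<^esub>"
    and right: "\<And>f. f \<in> Right C \<Longrightarrow> conn_ker (on_arr T f) = \<bottom>\<^bsub>on_obj T (Dom C f)\<^esub>"
    and iso: "\<And>f. f \<in> Arr C \<Longrightarrow> conn_im (on_arr T f) = \<top>\<^bsub>on_obj T (Cod C f)\<^esub> \<Longrightarrow>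
        conn_ker (on_arr T f) = \<bottom>\<^bsub>on_obj T (Dom C f)\<^esub> \<Longrightarrow> iso_arrow C f"
    and pull: "\<And>f g p q. f \<in> Right C \<Longrightarrow> g \<in> Right C \<Longrightarrow> is_pullback C f g p q \<Longrightarrow>
        conn_im (on_arr T f) \<sqinter>\<^bsub>on_obj T (Cod C f)\<^esub> conn_im (on_arr T g)
          \<sqsubseteq>\<^bsub>on_obj T (Cod C f)\<^esub> conn_im (on_arr T (Comp C f p))"
    and push: "\<And>f g p q. f \<in> Left C \<Longrightarrow> g \<in> Left C \<Longrightarrow> is_pushout C f g p q \<Longrightarrow>
        conn_ker (on_arr T (Comp C p f))
          \<sqsubseteq>\<^bsub>on_obj T (Dom C f)\<^esub> conn_ker (on_arr T f) \<squnion>\<^bsub>on_obj T (Dom C f)\<^esub> conn_ker (on_arr T g)"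
  shows "transfer_functor U C (Mlc U) T"
proof -
  interpret C: transfer_category U C by (rule C)
  interpret M: concrete_system U "Mlc U :: ('l gorder, ('l, 'l) galois) system_category" carrier lower
    by (rule concrete_system_Mlc[OF universe])
  note TD = is_functorD[OF T, unfolded Hom_Mlc, simplified]
  have Th: "on_arr T f \<in> Hom (Mlc_category U) (on_obj T (Dom C f)) (on_obj T (Cod C f))"
    if "f \<in> Arr C" for f
    using TD(2)[OF arr_hom[OF that]] .
  have tl: "on_arr T f \<in> Left (Mlc U)" if "f \<in> Left C" for f
  proof -
    have h: "on_arr T f \<in> Hom (Mlc_category U) (on_obj T (Dom C f)) (on_obj T (Cod C f))"
      using Th that C.left_arr by blast
    show ?thesis
      using Left_Mlc_iff[OF h] Mlc_surj_iff[OF h] left[OF that] by simp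
  qed
  have tr: "on_arr T f \<in> Right (Mlc U)" if "f \<in> Right C" for f
  proof -
    have h: "on_arr T f \<in> Hom (Mlc_category U) (on_obj T (Dom C f)) (on_obj T (Cod C f))"
      using Th that C.right_arr by blast
    show ?thesis
      using Right_Mlc_iff[OF h] Mlc_inj_iff[OF h] right[OF that] by simp
  qed
  have "conservative C (Mlc U) T"
    unfolding conservative_def
  proof (intro ballI impI)
    fix f assume f: "f \<in> Arr C" "iso_arrow (Mlc U) (on_arr T f)"
    then show "iso_arrow C f"
      using iso[OF f(1)] Mlc_iso_iff[OF universe Th[OF f(1)]] by simp
  qed
  moreover have "is_pullback (Mlc U) (on_arr T f) (on_arr T g) (on_arr T p) (on_arr T q)"
    if f: "f \<in> Right C" and g: "g \<in> Right C" and pb: "is_pullback C f g p q" for f g p q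
  proof -
    note D = is_pullbackD[OF pb]
    have fh: "f \<in> Hom C (Dom C f) (Cod C f)" and gh: "g \<in> Hom C (Dom C g) (Cod C f)"
      using arr_hom D(1-3) by metis+
    note h = TD(2)[OF fh] TD(2)[OF gh] TD(2)[OF D(4)] TD(2)[OF D(5)]
    have p: "p \<in> Right C"
      by (rule C.pullback_right[OF pb g])
    have c: "on_arr T (Comp C f p) = Comp (Mlc_category U) (on_arr T f) (on_arr T p)"
      "on_arr T (Comp C g q) = Comp (Mlc_category U) (on_arr T g) (on_arr T q)"
      using TD(4)[OF D(4) fh] TD(4)[OF D(5) gh] by auto
    note n = Mlc_comp_hom[OF h(3) h(1)]
    let ?B = "on_obj T (Cod C f)"
    let ?a = "conn_im (on_arr T f) \<sqinter>\<^bsub>?B\<^esub> conn_im (on_arr T g)"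
    interpret F: image_kernel_connection "on_obj T (Dom C f)" ?B "lower (on_arr T f)" "upper (on_arr T f)"
      by (rule Mlc_homD(1)[OF h(1)])
    interpret G: image_kernel_connection "on_obj T (Dom C g)" ?B "lower (on_arr T g)" "upper (on_arr T g)"
      by (rule Mlc_homD(1)[OF h(2)])
    interpret N: image_kernel_connection "on_obj T (Dom C p)" ?B
      "lower (on_arr T (Comp C f p))" "upper (on_arr T (Comp C f p))"
      unfolding c by (rule Mlc_homD(1)[OF n])
    have I: "conn_im (on_arr T f) \<in> carrier ?B" "conn_im (on_arr T g) \<in> carrier ?B"
      "conn_im (on_arr T (Comp C f p)) \<in> carrier ?B"
      using conn_im_closed h(1,2) n c(1) by auto
    have "lower (on_arr T f) ` carrier (on_obj T (Dom C f)) \<inter>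
        lower (on_arr T g) ` carrier (on_obj T (Dom C g))
        \<subseteq> lower (on_arr T (Comp C f p)) ` carrier (on_obj T (Dom C p))"
    proof
      fix y assume "y \<in> lower (on_arr T f) ` carrier (on_obj T (Dom C f)) \<inter>
        lower (on_arr T g) ` carrier (on_obj T (Dom C g))"
      then have y: "y \<in> carrier ?B" "y \<sqsubseteq>\<^bsub>?B\<^esub> conn_im (on_arr T f)" "y \<sqsubseteq>\<^bsub>?B\<^esub> conn_im (on_arr T g)"
        using F.image_l G.image_l Mlc_homD(6)[OF h(1)] Mlc_homD(6)[OF h(2)] by auto
      then have "y \<sqsubseteq>\<^bsub>?B\<^esub> ?a"
        using I F.B.meet_le by blast
      then have "y \<sqsubseteq>\<^bsub>?B\<^esub> conn_im (on_arr T (Comp C f p))"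
        using F.B.le_trans[OF _ pull[OF f g pb]] y(1) I by simp
      then show "y \<in> lower (on_arr T (Comp C f p)) ` carrier (on_obj T (Dom C p))"
        using N.image_l y(1) Mlc_homD(6)[OF n] c(1) by simp
    qed
    then show ?thesis
      using M.is_pullbackI[unfolded Hom_Mlc, OF tr[OF f] h(1) tr[OF g] h(2) tr[OF p] h(3,4)] c D(6)
      by simp
  qed
  moreover have "is_pushout (Mlc U) (on_arr T f) (on_arr T g) (on_arr T p) (on_arr T q)"
    if f: "f \<in> Left C" and g: "g \<in> Left C" and po: "is_pushout C f g p q" for f g p q
  proof -
    note D = is_pushoutD[OF po]
    have fh: "f \<in> Hom C (Dom C f) (Cod C f)" and gh: "g \<in> Hom C (Dom C f) (Cod C g)"
      using arr_hom D(1-3) by metis+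
    note h = TD(2)[OF fh] TD(2)[OF gh] TD(2)[OF D(4)] TD(2)[OF D(5)]
    have p: "p \<in> Left C"
      by (rule C.pushout_left[OF po g])
    have c: "on_arr T (Comp C p f) = Comp (Mlc_category U) (on_arr T p) (on_arr T f)"
      "on_arr T (Comp C q g) = Comp (Mlc_category U) (on_arr T q) (on_arr T g)"
      using TD(4)[OF fh D(4)] TD(4)[OF gh D(5)] by auto
    note n = Mlc_comp_hom[OF h(1) h(3)]
    let ?A = "on_obj T (Dom C f)"
    interpret A: bounded_lattice ?A by (rule Mlc_objD(1)[OF Mlc_homD(2)[OF h(1)]])
    have ker: "kernel_pair (carrier ?A) (lower (Comp (Mlc U) (on_arr T p) (on_arr T f)))
        \<subseteq> kernel_pair (carrier ?A) (lower w)"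
      if w: "w \<in> Hom (Mlc_category U) ?A V"
        and le: "kernel_pair (carrier ?A) (lower (on_arr T f)) \<subseteq> kernel_pair (carrier ?A) (lower w)"
          "kernel_pair (carrier ?A) (lower (on_arr T g)) \<subseteq> kernel_pair (carrier ?A) (lower w)" for w V
    proof -
      note K = conn_ker_closed[OF h(1)] conn_ker_closed[OF h(2)] conn_ker_closed[OF w] conn_ker_closed[OF n]
      have "conn_ker (on_arr T f) \<squnion>\<^bsub>?A\<^esub> conn_ker (on_arr T g) \<sqsubseteq>\<^bsub>?A\<^esub> conn_ker w"
        using le Mlc_kernel_pair_subset_iff[OF h(1) w] Mlc_kernel_pair_subset_iff[OF h(2) w] K A.join_le
        by blast
      then have "conn_ker (on_arr T (Comp C p f)) \<sqsubseteq>\<^bsub>?A\<^esub> conn_ker w"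
        using A.le_trans[OF push[OF f g po]] K c(1) by simp
      then show ?thesis
        using Mlc_kernel_pair_subset_iff[OF n w] c(1) by simp
    qed
    show ?thesis
      using M.is_pushoutI[unfolded Hom_Mlc, OF tl[OF f] h(1) tl[OF g] h(2) tl[OF p] h(3,4) _ ker] c D(6)
      by simp
  qed
  ultimately show ?thesis
    unfolding transfer_functor_def using C M.transfer_category_axioms T tl tr by blast
qed

text \<open>Converse of the criterion, with equalities: preservation turns squares of
  \<open>C\<close> into pullbacks and pushouts of \<open>Mlc\<close>, whose images and kernels are
  known exactly.\<close>

lemma transfer_functor_MlcD:
  fixes T :: "('o, 'a, 'l gorder, ('l, 'l) galois) functor_data"
    and C :: "('o, 'a, 'm) system_category_scheme" and U :: "'u itself"
  assumes universe: "inaccessible_universe U" and T: "transfer_functor U C (Mlc U) T"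
  shows "\<And>f. f \<in> Left C \<Longrightarrow> conn_im (on_arr T f) = \<top>\<^bsub>on_obj T (Cod C f)\<^esub>"
    and "\<And>f. f \<in> Right C \<Longrightarrow> conn_ker (on_arr T f) = \<bottom>\<^bsub>on_obj T (Dom C f)\<^esub>"
    and "\<And>f. f \<in> Arr C \<Longrightarrow> conn_im (on_arr T f) = \<top>\<^bsub>on_obj T (Cod C f)\<^esub> \<Longrightarrow>
        conn_ker (on_arr T f) = \<bottom>\<^bsub>on_obj T (Dom C f)\<^esub> \<Longrightarrow> iso_arrow C f"
    and "\<And>f g p q. f \<in> Right C \<Longrightarrow> g \<in> Right C \<Longrightarrow> is_pullback C f g p q \<Longrightarrow>
        conn_im (on_arr T (Comp C f p)) =
          conn_im (on_arr T f) \<sqinter>\<^bsub>on_obj T (Cod C f)\<^esub> conn_im (on_arr T g)"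
    and "\<And>f g p q. f \<in> Left C \<Longrightarrow> g \<in> Left C \<Longrightarrow> is_pushout C f g p q \<Longrightarrow>
        conn_ker (on_arr T (Comp C p f)) =
          conn_ker (on_arr T f) \<squnion>\<^bsub>on_obj T (Dom C f)\<^esub> conn_ker (on_arr T g)"
proof -
  have C: "transfer_category U C" and F: "is_functor C (Mlc U) T" and cons: "conservative C (Mlc U) T"
    and tl: "\<And>f. f \<in> Left C \<Longrightarrow> on_arr T f \<in> Left (Mlc U)"
    and tr: "\<And>f. f \<in> Right C \<Longrightarrow> on_arr T f \<in> Right (Mlc U)"
    and pb: "\<And>f g p q. f \<in> Right C \<Longrightarrow> g \<in> Right C \<Longrightarrow> is_pullback C f g p q \<Longrightarrow>
      is_pullback (Mlc U) (on_arr T f) (on_arr T g) (on_arr T p) (on_arr T q)"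
    and po: "\<And>f g p q. f \<in> Left C \<Longrightarrow> g \<in> Left C \<Longrightarrow> is_pushout C f g p q \<Longrightarrow>
      is_pushout (Mlc U) (on_arr T f) (on_arr T g) (on_arr T p) (on_arr T q)"
    using T unfolding transfer_functor_def by auto
  interpret C: transfer_category U C by (rule C)
  note TD = is_functorD[OF F, unfolded Hom_Mlc, simplified]
  have Th: "on_arr T f \<in> Hom (Mlc_category U) (on_obj T (Dom C f)) (on_obj T (Cod C f))"
    if "f \<in> Arr C" for f
    using TD(2)[OF arr_hom[OF that]] .
  show "conn_im (on_arr T f) = \<top>\<^bsub>on_obj T (Cod C f)\<^esub>" if f: "f \<in> Left C" for f
  proof -
    have fa: "f \<in> Arr C" using f C.left_arr by blast
    show ?thesis
      using Left_Mlc_iff[OF Th[OF fa]] Mlc_surj_iff[OF Th[OF fa]] tl[OF f] by simp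
  qed
  show "conn_ker (on_arr T f) = \<bottom>\<^bsub>on_obj T (Dom C f)\<^esub>" if f: "f \<in> Right C" for f
  proof -
    have fa: "f \<in> Arr C" using f C.right_arr by blast
    show ?thesis
      using Right_Mlc_iff[OF Th[OF fa]] Mlc_inj_iff[OF Th[OF fa]] tr[OF f] by simp
  qed
  show "iso_arrow C f" if f: "f \<in> Arr C" and "conn_im (on_arr T f) = \<top>\<^bsub>on_obj T (Cod C f)\<^esub>"
    "conn_ker (on_arr T f) = \<bottom>\<^bsub>on_obj T (Dom C f)\<^esub>" for f
    using that cons Mlc_iso_iff[OF universe Th[OF f]] unfolding conservative_def by simp
  show "conn_im (on_arr T (Comp C f p)) =
      conn_im (on_arr T f) \<sqinter>\<^bsub>on_obj T (Cod C f)\<^esub> conn_im (on_arr T g)"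
    if f: "f \<in> Right C" and g: "g \<in> Right C" and pbk: "is_pullback C f g p q" for f g p q
  proof -
    note D = is_pullbackD[OF pbk]
    show ?thesis
      using Mlc_pullback_im[OF universe tr[OF f] tr[OF g] pb[OF f g pbk]]
        TD(4)[OF D(4) arr_hom[OF D(1)]] Mlc_homD(5)[OF Th[OF D(1)]] by simp
  qed
  show "conn_ker (on_arr T (Comp C p f)) =
      conn_ker (on_arr T f) \<squnion>\<^bsub>on_obj T (Dom C f)\<^esub> conn_ker (on_arr T g)"
    if f: "f \<in> Left C" and g: "g \<in> Left C" and pou: "is_pushout C f g p q" for f g p q
  proof -
    note D = is_pushoutD[OF pou]
    show ?thesis
      using Mlc_pushout_ker[OF universe tl[OF f] tl[OF g] po[OF f g pou]]
        TD(4)[OF arr_hom[OF D(1)] D(4)] Mlc_homD(4)[OF Th[OF D(1)]] by simp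
  qed
qed

lemma is_functor_comp:
  assumes T: "is_functor C D T" and S: "is_functor D E S"
  shows "is_functor C E (comp_functor S T)"
proof -
  have S1: "on_obj S X \<in> Obj E" "on_arr S (Id D X) = Id E (on_obj S X)" if "X \<in> Obj D" for X
    using S that unfolding is_functor_def by auto
  note TD = is_functorD[OF T] and SD = is_functorD[OF S]
  show ?thesis
    unfolding is_functor_def comp_functor_def
  proof (simp, intro conjI ballI impI)
    fix f assume "f \<in> Arr C"
    then show "on_arr S (on_arr T f) \<in> Hom E (on_obj S (on_obj T (Dom C f))) (on_obj S (on_obj T (Cod C f)))"
      using SD(2)[OF TD(2)[OF arr_hom]] by blast
  next
    fix f g assume f: "f \<in> Arr C" and g: "g \<in> Arr C" and eq: "Cod C f = Dom C g"
    have fh: "f \<in> Hom C (Dom C f) (Dom C g)" and gh: "g \<in> Hom C (Dom C g) (Cod C g)"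
      using f g eq unfolding Hom_def by auto
    show "on_arr S (on_arr T (Comp C g f)) = Comp E (on_arr S (on_arr T g)) (on_arr S (on_arr T f))"
      using TD(4)[OF fh gh] SD(4)[OF TD(2)[OF fh] TD(2)[OF gh]] by simp
  qed (use S1 TD(1,3) in auto)
qed

lemma transfer_functor_comp:
  assumes T: "transfer_functor U C D T" and S: "transfer_functor U D E S"
  shows "transfer_functor U C E (comp_functor S T)"
proof -
  have fT: "is_functor C D T" and fS: "is_functor D E S"
    using T S unfolding transfer_functor_def by auto
  have "conservative C E (comp_functor S T)"
    unfolding conservative_def comp_functor_def
  proof (simp, intro ballI impI)
    fix f assume f: "f \<in> Arr C" "iso_arrow E (on_arr S (on_arr T f))"
    have "on_arr T f \<in> Arr D"
      using fT f(1) unfolding is_functor_def Hom_def by auto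
    then have "iso_arrow D (on_arr T f)"
      using f S unfolding transfer_functor_def conservative_def by simp
    then show "iso_arrow C f"
      using f T unfolding transfer_functor_def conservative_def by simp
  qed
  moreover have "on_arr T f \<in> Left D" if "f \<in> Left C" for f
    using T that unfolding transfer_functor_def image_subset_iff by simp
  moreover have "on_arr T f \<in> Right D" if "f \<in> Right C" for f
    using T that unfolding transfer_functor_def image_subset_iff by simp
  moreover have "on_arr S f \<in> Left E" if "f \<in> Left D" for f
    using S that unfolding transfer_functor_def image_subset_iff by simp
  moreover have "on_arr S f \<in> Right E" if "f \<in> Right D" for f
    using S that unfolding transfer_functor_def image_subset_iff by simp
  ultimately show ?thesis
    using T S is_functor_comp[OF fT fS] unfolding transfer_functor_def
    by (simp add: image_subset_iff comp_functor_def)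
qed

section \<open>Change of the element type\<close>

text \<open>The order is pulled back along \<open>inv_into\<close>, so injectivity of
  \<open>\<phi>\<close> on the carrier is enough for an isomorphic copy. \<open>eq\<close> is set to
  equality, as a bounded lattice demands.\<close>

definition relabel_lattice :: "('k \<Rightarrow> 'l) \<Rightarrow> 'k gorder \<Rightarrow> 'l gorder" where
  "relabel_lattice \<phi> L =
     \<lparr>carrier = \<phi> ` carrier L, eq = (=),
      le = (\<lambda>x y. inv_into (carrier L) \<phi> x \<sqsubseteq>\<^bsub>L\<^esub> inv_into (carrier L) \<phi> y)\<rparr>"

lemma relabel_lattice:
  fixes L :: "'k gorder" and \<phi> :: "'k \<Rightarrow> 'l"
  assumes "bounded_lattice L" and inj: "inj_on \<phi> (carrier L)"
  defines "R \<equiv> relabel_lattice \<phi> L"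
  shows "carrier R = \<phi> ` carrier L"
    and "\<And>x y. x \<in> carrier L \<Longrightarrow> y \<in> carrier L \<Longrightarrow> \<phi> x \<sqsubseteq>\<^bsub>R\<^esub> \<phi> y \<longleftrightarrow> x \<sqsubseteq>\<^bsub>L\<^esub> y"
    and "bounded_lattice R"
    and "\<And>x y. x \<in> carrier L \<Longrightarrow> y \<in> carrier L \<Longrightarrow> \<phi> x \<squnion>\<^bsub>R\<^esub> \<phi> y = \<phi> (x \<squnion>\<^bsub>L\<^esub> y)"
    and "\<And>x y. x \<in> carrier L \<Longrightarrow> y \<in> carrier L \<Longrightarrow> \<phi> x \<sqinter>\<^bsub>R\<^esub> \<phi> y = \<phi> (x \<sqinter>\<^bsub>L\<^esub> y)"
    and "\<top>\<^bsub>R\<^esub> = \<phi> \<top>\<^bsub>L\<^esub>" and "\<bottom>\<^bsub>R\<^esub> = \<phi> \<bottom>\<^bsub>L\<^esub>"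
proof -
  interpret L: bounded_lattice L by fact
  show car: "carrier R = \<phi> ` carrier L"
    unfolding R_def relabel_lattice_def by simp
  show le: "\<phi> x \<sqsubseteq>\<^bsub>R\<^esub> \<phi> y \<longleftrightarrow> x \<sqsubseteq>\<^bsub>L\<^esub> y" if "x \<in> carrier L" "y \<in> carrier L" for x y
    using that inj unfolding R_def relabel_lattice_def by simp
  have po: "partial_order R"
  proof
    show "(.=\<^bsub>R\<^esub>) = (=)"
      unfolding R_def relabel_lattice_def by simp
    then show "x .=\<^bsub>R\<^esub> x" "x .=\<^bsub>R\<^esub> y \<Longrightarrow> y .=\<^bsub>R\<^esub> x" "x .=\<^bsub>R\<^esub> y \<Longrightarrow> y .=\<^bsub>R\<^esub> z \<Longrightarrow> x .=\<^bsub>R\<^esub> z"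
      "x .=\<^bsub>R\<^esub> y \<Longrightarrow> z .=\<^bsub>R\<^esub> w \<Longrightarrow> x \<sqsubseteq>\<^bsub>R\<^esub> z \<longleftrightarrow> y \<sqsubseteq>\<^bsub>R\<^esub> w" for x y z w
      by simp_all
    show "x \<sqsubseteq>\<^bsub>R\<^esub> x" if "x \<in> carrier R" for x
      using that le car by auto
    show "x .=\<^bsub>R\<^esub> y" if xy: "x \<sqsubseteq>\<^bsub>R\<^esub> y" "y \<sqsubseteq>\<^bsub>R\<^esub> x" "x \<in> carrier R" "y \<in> carrier R" for x y
    proof -
      obtain x' y' where "x' \<in> carrier L" "y' \<in> carrier L" "x = \<phi> x'" "y = \<phi> y'"
        using xy(3,4) car by auto
      then have "x = y"
        using xy(1,2) le L.le_antisym[of x' y'] by simp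
      then show ?thesis
        by (simp add: \<open>(.=\<^bsub>R\<^esub>) = (=)\<close>)
    qed
    show "x \<sqsubseteq>\<^bsub>R\<^esub> z" if xyz: "x \<sqsubseteq>\<^bsub>R\<^esub> y" "y \<sqsubseteq>\<^bsub>R\<^esub> z" "x \<in> carrier R" "y \<in> carrier R" "z \<in> carrier R" for x y z
    proof -
      obtain x' y' z' where "x' \<in> carrier L" "y' \<in> carrier L" "z' \<in> carrier L"
        "x = \<phi> x'" "y = \<phi> y'" "z = \<phi> z'"
        using xyz(3-5) car by auto
      then show ?thesis
        using xyz(1,2) le L.le_trans by blast
    qed
  qed
  have J: "\<phi> x \<sqsubseteq>\<^bsub>R\<^esub> \<phi> (x \<squnion>\<^bsub>L\<^esub> y)" "\<phi> y \<sqsubseteq>\<^bsub>R\<^esub> \<phi> (x \<squnion>\<^bsub>L\<^esub> y)"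
    "\<And>z. z \<in> carrier L \<Longrightarrow> \<phi> x \<sqsubseteq>\<^bsub>R\<^esub> \<phi> z \<Longrightarrow> \<phi> y \<sqsubseteq>\<^bsub>R\<^esub> \<phi> z \<Longrightarrow> \<phi> (x \<squnion>\<^bsub>L\<^esub> y) \<sqsubseteq>\<^bsub>R\<^esub> \<phi> z"
    if "x \<in> carrier L" "y \<in> carrier L" for x y
    using that by (simp_all add: le L.join_left L.join_right L.join_le)
  have M: "\<phi> (x \<sqinter>\<^bsub>L\<^esub> y) \<sqsubseteq>\<^bsub>R\<^esub> \<phi> x" "\<phi> (x \<sqinter>\<^bsub>L\<^esub> y) \<sqsubseteq>\<^bsub>R\<^esub> \<phi> y"
    "\<And>z. z \<in> carrier L \<Longrightarrow> \<phi> z \<sqsubseteq>\<^bsub>R\<^esub> \<phi> x \<Longrightarrow> \<phi> z \<sqsubseteq>\<^bsub>R\<^esub> \<phi> y \<Longrightarrow> \<phi> z \<sqsubseteq>\<^bsub>R\<^esub> \<phi> (x \<sqinter>\<^bsub>L\<^esub> y)"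
    if "x \<in> carrier L" "y \<in> carrier L" for x y
    using that by (simp_all add: le L.meet_left L.meet_right L.meet_le)
  show bl: "bounded_lattice R"
  proof (rule bounded_latticeI[OF po, where t = "\<phi> \<top>\<^bsub>L\<^esub>" and b = "\<phi> \<bottom>\<^bsub>L\<^esub>"
        and j = "\<lambda>x y. \<phi> (inv_into (carrier L) \<phi> x \<squnion>\<^bsub>L\<^esub> inv_into (carrier L) \<phi> y)"
        and m = "\<lambda>x y. \<phi> (inv_into (carrier L) \<phi> x \<sqinter>\<^bsub>L\<^esub> inv_into (carrier L) \<phi> y)"])
  qed (use J M inj le in \<open>auto simp: car\<close>)
  interpret R: bounded_lattice R by (rule bl)
  show "\<phi> x \<squnion>\<^bsub>R\<^esub> \<phi> y = \<phi> (x \<squnion>\<^bsub>L\<^esub> y)" if "x \<in> carrier L" "y \<in> carrier L" for x y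
    using that J[OF that] by (intro R.join_eqI) (auto simp: car)
  show "\<phi> x \<sqinter>\<^bsub>R\<^esub> \<phi> y = \<phi> (x \<sqinter>\<^bsub>L\<^esub> y)" if "x \<in> carrier L" "y \<in> carrier L" for x y
    using that M[OF that] by (intro R.meet_eqI) (auto simp: car)
  show "\<top>\<^bsub>R\<^esub> = \<phi> \<top>\<^bsub>L\<^esub>"
    by (rule R.top_eq[symmetric]) (auto simp: car le)
  show "\<bottom>\<^bsub>R\<^esub> = \<phi> \<bottom>\<^bsub>L\<^esub>"
    by (rule R.bottom_eq[symmetric]) (auto simp: car le)
qed

lemma relabel_Mlc_obj:
  fixes L :: "'k gorder" and \<phi> :: "'k \<Rightarrow> 'l"
  assumes L: "L \<in> Mlc_obj U" and inj: "inj_on \<phi> (carrier L)"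
  shows "relabel_lattice \<phi> L \<in> Mlc_obj U"
proof -
  interpret L: bounded_lattice L by (rule Mlc_objD(1)[OF L])
  note R = relabel_lattice[OF Mlc_objD(1)[OF L] inj]
  have "modular_lattice (relabel_lattice \<phi> L)"
    unfolding modular_lattice_def
  proof (intro ballI impI)
    let ?R = "relabel_lattice \<phi> L"
    fix x y z assume "x \<in> carrier ?R" "y \<in> carrier ?R" "z \<in> carrier ?R" and le: "x \<sqsubseteq>\<^bsub>?R\<^esub> z"
    then obtain x' y' z' where xyz: "x' \<in> carrier L" "y' \<in> carrier L" "z' \<in> carrier L"
      "x = \<phi> x'" "y = \<phi> y'" "z = \<phi> z'"
      using R(1) by auto
    then show "x \<squnion>\<^bsub>?R\<^esub> (y \<sqinter>\<^bsub>?R\<^esub> z) = (x \<squnion>\<^bsub>?R\<^esub> y) \<sqinter>\<^bsub>?R\<^esub> z"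
      using Mlc_objD(2)[OF L] le R(2,4,5) unfolding modular_lattice_def by simp
  qed
  then show ?thesis
    using R(1,3) small_image[OF Mlc_objD(3)[OF L]] unfolding Mlc_obj_def by simp
qed

lemma relabel_connection:
  fixes A :: "'k gorder" and \<phi> \<psi> :: "'k \<Rightarrow> 'l"
  assumes "image_kernel_connection A B l u" and \<phi>: "inj_on \<phi> (carrier A)" and \<psi>: "inj_on \<psi> (carrier B)"
  shows "image_kernel_connection (relabel_lattice \<phi> A) (relabel_lattice \<psi> B)
    (\<lambda>x. \<psi> (l (inv_into (carrier A) \<phi> x))) (\<lambda>y. \<phi> (u (inv_into (carrier B) \<psi> y)))"
proof -
  interpret F: image_kernel_connection A B l u by fact
  note RA = relabel_lattice[OF F.A.bounded_lattice_axioms \<phi>]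
    and RB = relabel_lattice[OF F.B.bounded_lattice_axioms \<psi>]
  interpret RA: bounded_lattice "relabel_lattice \<phi> A" by (rule RA(3))
  interpret RB: bounded_lattice "relabel_lattice \<psi> B" by (rule RB(3))
  show ?thesis
    by unfold_locales
      (use \<phi> \<psi> F.l_closed F.u_closed in
        \<open>auto simp: RA(1,2,4-7) RB(1,2,4-7) F.adj F.ul F.lu\<close>)
qed

text \<open>Arrows are conjugated by injections chosen for each lattice separately. In a composite
  the injection of the middle lattice cancels against its inverse, which gives functoriality for any
  choice.\<close>

definition relabel_functor ::
  "('k gorder \<Rightarrow> 'k \<Rightarrow> 'l) \<Rightarrow> ('k gorder, ('k, 'k) galois, 'l gorder, ('l, 'l) galois) functor_data"
  where "relabel_functor \<phi> =
    \<lparr>on_obj = (\<lambda>L. relabel_lattice (\<phi> L) L),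
     on_arr = (\<lambda>f. galcon_of (relabel_lattice (\<phi> (orderA f)) (orderA f))
       (relabel_lattice (\<phi> (orderB f)) (orderB f))
       (\<lambda>x. \<phi> (orderB f) (lower f (inv_into (carrier (orderA f)) (\<phi> (orderA f)) x)))
       (\<lambda>y. \<phi> (orderA f) (upper f (inv_into (carrier (orderB f)) (\<phi> (orderB f)) y))))\<rparr>"

text \<open>The copy of each lattice is isomorphic to it, so \<open>\<phi>\<close> carries images,
  kernels, meets, joins and bounds along. The criterion then reduces to the exact formulas for
  pullbacks and pushouts in \<open>Mlc\<close>.\<close>

lemma transfer_functor_relabel:
  fixes \<phi> :: "'k gorder \<Rightarrow> 'k \<Rightarrow> 'l" and U :: "'u itself"
  assumes universe: "inaccessible_universe U"
    and inj: "\<And>L. L \<in> Mlc_obj U \<Longrightarrow> inj_on (\<phi> L) (carrier L)"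
  shows "transfer_functor U (Mlc U) (Mlc U) (relabel_functor \<phi>)"
proof -
  let ?R = "relabel_functor \<phi>"
  have obj: "on_obj ?R L = relabel_lattice (\<phi> L) L" for L
    unfolding relabel_functor_def by simp
  note R = relabel_lattice[OF Mlc_objD(1) inj]
  have hom: "on_arr ?R f \<in> Hom (Mlc_category U) (on_obj ?R A) (on_obj ?R B)"
    and low: "\<And>x. x \<in> carrier A \<Longrightarrow> lower (on_arr ?R f) (\<phi> A x) = \<phi> B (lower f x)"
    and upp: "\<And>y. y \<in> carrier B \<Longrightarrow> upper (on_arr ?R f) (\<phi> B y) = \<phi> A (upper f y)"
    and im: "conn_im (on_arr ?R f) = \<phi> B (conn_im f)"
    and ker: "conn_ker (on_arr ?R f) = \<phi> A (conn_ker f)"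
    if f: "f \<in> Hom (Mlc_category U) A B" for f A B
  proof -
    note F = Mlc_homD[OF f]
    interpret A: bounded_lattice A by (rule Mlc_objD(1)[OF F(2)])
    interpret B: bounded_lattice B by (rule Mlc_objD(1)[OF F(3)])
    show h: "on_arr ?R f \<in> Hom (Mlc_category U) (on_obj ?R A) (on_obj ?R B)"
      using galcon_of_hom[OF relabel_Mlc_obj[OF F(2) inj[OF F(2)]] relabel_Mlc_obj[OF F(3) inj[OF F(3)]]
        relabel_connection[OF F(1) inj[OF F(2)] inj[OF F(3)]]] F(4,5)
      unfolding relabel_functor_def by simp
    show low: "lower (on_arr ?R f) (\<phi> A x) = \<phi> B (lower f x)" if "x \<in> carrier A" for x
      using that F(4,5) inj[OF F(2)] R(1)[OF F(2,2)] unfolding relabel_functor_def by simp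
    show upp: "upper (on_arr ?R f) (\<phi> B y) = \<phi> A (upper f y)" if "y \<in> carrier B" for y
      using that F(4,5) inj[OF F(3)] R(1)[OF F(3,3)] unfolding relabel_functor_def by simp
    show "conn_im (on_arr ?R f) = \<phi> B (conn_im f)"
      using Mlc_homD(6)[OF h] low[of "\<top>\<^bsub>A\<^esub>"] F(6) R(6)[OF F(2,2)] obj by simp
    show "conn_ker (on_arr ?R f) = \<phi> A (conn_ker f)"
      using Mlc_homD(7)[OF h] upp[of "\<bottom>\<^bsub>B\<^esub>"] F(7) R(7)[OF F(3,3)] obj by simp
  qed
  have fct: "is_functor (Mlc U) (Mlc U) ?R"
    unfolding is_functor_def Hom_Mlc Mlc_simps
  proof (intro conjI ballI impI)
    fix L :: "'k gorder" assume L: "L \<in> Mlc_obj U"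
    note RL = relabel_Mlc_obj[OF L inj[OF L]]
    show "on_obj ?R L \<in> Mlc_obj U"
      unfolding obj by (rule RL)
    show "on_arr ?R (Id (Mlc_category U) L) = Id (Mlc_category U) (on_obj ?R L)"
    proof (rule Mlc_hom_eqI[OF hom[OF Mlc_id_hom[OF L]]])
      show "Id (Mlc_category U) (on_obj ?R L) \<in> Hom (Mlc_category U) (on_obj ?R L) (on_obj ?R L)"
        unfolding obj by (rule Mlc_id_hom[OF RL])
      fix x assume x: "x \<in> carrier (on_obj ?R L)"
      then obtain x' where "x' \<in> carrier L" "x = \<phi> L x'"
        using R(1)[OF L L] obj by auto
      then show "lower (on_arr ?R (Id (Mlc_category U) L)) x = lower (Id (Mlc_category U) (on_obj ?R L)) x"
        using low[OF Mlc_id_hom[OF L]] x by (simp add: Mlc_id_apply)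
    qed
  next
    fix f :: "('k, 'k) galois" assume "f \<in> Arr (Mlc_category U)"
    then show "on_arr ?R f \<in> Hom (Mlc_category U) (on_obj ?R (orderA f)) (on_obj ?R (orderB f))"
      using hom Mlc_arr_hom by blast
  next
    fix f g :: "('k, 'k) galois"
    assume f: "f \<in> Arr (Mlc_category U)" and g: "g \<in> Arr (Mlc_category U)" and eq: "orderB f = orderA g"
    have fh: "f \<in> Hom (Mlc_category U) (orderA f) (orderA g)"
      and gh: "g \<in> Hom (Mlc_category U) (orderA g) (orderB g)"
      using Mlc_arr_hom[OF f] Mlc_arr_hom[OF g] eq by simp_all
    show "on_arr ?R (Comp (Mlc_category U) g f) = Comp (Mlc_category U) (on_arr ?R g) (on_arr ?R f)"
    proof (rule Mlc_hom_eqI[OF hom[OF Mlc_comp_hom[OF fh gh]] Mlc_comp_hom[OF hom[OF fh] hom[OF gh]]])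
      fix x assume x: "x \<in> carrier (on_obj ?R (orderA f))"
      then obtain x' where x': "x' \<in> carrier (orderA f)" "x = \<phi> (orderA f) x'"
        using R(1)[OF Mlc_homD(2)[OF fh] Mlc_homD(2)[OF fh]] obj by auto
      have "lower (Comp (Mlc_category U) (on_arr ?R g) (on_arr ?R f)) x =
          lower (on_arr ?R g) (lower (on_arr ?R f) x)"
        using x Mlc_homD(4)[OF hom[OF fh]] by (simp add: Mlc_comp_apply)
      then show "lower (on_arr ?R (Comp (Mlc_category U) g f)) x =
          lower (Comp (Mlc_category U) (on_arr ?R g) (on_arr ?R f)) x"
        using x' low[OF Mlc_comp_hom[OF fh gh]] low[OF fh] low[OF gh]
          image_kernel_connection.l_closed[OF Mlc_homD(1)[OF fh]]
        by (simp add: Mlc_comp_apply)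
    qed
  qed
  have h: "f \<in> Hom (Mlc_category U) (orderA f) (orderB f)"
    if "f \<in> Arr (Mlc_category U)" for f :: "('k, 'k) galois"
    using Mlc_arr_hom that by blast
  interpret M: concrete_system U "Mlc U :: ('k gorder, ('k, 'k) galois) system_category" carrier lower
    by (rule concrete_system_Mlc[OF universe])
  note M_left = M.left_sub[THEN subsetD, simplified] and M_right = M.right_sub[THEN subsetD, simplified]
  show ?thesis
  proof (rule transfer_functor_MlcI[OF universe transfer_category_Mlc[OF universe] fct], unfold Mlc_simps)
    fix f :: "('k, 'k) galois"
    show "conn_im (on_arr ?R f) = \<top>\<^bsub>on_obj ?R (orderB f)\<^esub>" if f: "f \<in> Left (Mlc U)"
    proof -
      note fh = h[OF M_left[OF f]]
      show ?thesis
        using im[OF fh] Left_Mlc_iff[OF fh] Mlc_surj_iff[OF fh] f R(6)[OF Mlc_homD(3)[OF fh] Mlc_homD(3)[OF fh]] obj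
        by simp
    qed
    show "conn_ker (on_arr ?R f) = \<bottom>\<^bsub>on_obj ?R (orderA f)\<^esub>" if f: "f \<in> Right (Mlc U)"
    proof -
      note fh = h[OF M_right[OF f]]
      show ?thesis
        using ker[OF fh] Right_Mlc_iff[OF fh] Mlc_inj_iff[OF fh] f R(7)[OF Mlc_homD(2)[OF fh] Mlc_homD(2)[OF fh]] obj
        by simp
    qed
    assume f: "f \<in> Arr (Mlc_category U)"
      and eq: "conn_im (on_arr ?R f) = \<top>\<^bsub>on_obj ?R (orderB f)\<^esub>"
        "conn_ker (on_arr ?R f) = \<bottom>\<^bsub>on_obj ?R (orderA f)\<^esub>"
    note F = Mlc_homD[OF h[OF f]]
    interpret A: bounded_lattice "orderA f" by (rule Mlc_objD(1)[OF F(2)])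
    interpret B: bounded_lattice "orderB f" by (rule Mlc_objD(1)[OF F(3)])
    \<comment> \<open>Conservativity: the injections reflect the top and bottom elements, and these
      detect isomorphisms.\<close>
    have "conn_im f = \<top>\<^bsub>orderB f\<^esub>"
      using eq(1) im[OF h[OF f]] R(6)[OF F(3,3)] obj conn_im_closed[OF h[OF f]] inj[OF F(3)]
      by (simp add: inj_on_eq_iff)
    moreover have "conn_ker f = \<bottom>\<^bsub>orderA f\<^esub>"
      using eq(2) ker[OF h[OF f]] R(7)[OF F(2,2)] obj conn_ker_closed[OF h[OF f]] inj[OF F(2)]
      by (simp add: inj_on_eq_iff)
    ultimately show "iso_arrow (Mlc U) f"
      using Mlc_iso_iff[OF universe h[OF f]] by blast
  next
    fix f g p q :: "('k, 'k) galois"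
    assume f: "f \<in> Right (Mlc U)" and g: "g \<in> Right (Mlc U)" and pb: "is_pullback (Mlc U) f g p q"
    note D = is_pullbackD[OF pb, unfolded Hom_Mlc, simplified]
    have fh: "f \<in> Hom (Mlc_category U) (orderA f) (orderB f)"
      and gh: "g \<in> Hom (Mlc_category U) (orderA g) (orderB f)"
      using h[OF D(1)] h[OF D(2)] D(3) by simp_all
    note RB = R[OF Mlc_homD(3)[OF fh] Mlc_homD(3)[OF fh]]
    have I: "conn_im f \<in> carrier (orderB f)" "conn_im g \<in> carrier (orderB f)"
      using conn_im_closed fh gh by blast+
    interpret B: bounded_lattice "orderB f" by (rule Mlc_objD(1)[OF Mlc_homD(3)[OF fh]])
    show "conn_im (on_arr ?R f) \<sqinter>\<^bsub>on_obj ?R (orderB f)\<^esub> conn_im (on_arr ?R g)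
        \<sqsubseteq>\<^bsub>on_obj ?R (orderB f)\<^esub> conn_im (on_arr ?R (Comp (Mlc_category U) f p))"
      using Mlc_pullback_im[OF universe f g pb] im[OF fh] im[OF gh] im[OF Mlc_comp_hom[OF D(4) fh]]
        RB(2,5) I obj by simp
  next
    fix f g p q :: "('k, 'k) galois"
    assume f: "f \<in> Left (Mlc U)" and g: "g \<in> Left (Mlc U)" and po: "is_pushout (Mlc U) f g p q"
    note D = is_pushoutD[OF po, unfolded Hom_Mlc, simplified]
    have fh: "f \<in> Hom (Mlc_category U) (orderA f) (orderB f)"
      and gh: "g \<in> Hom (Mlc_category U) (orderA f) (orderB g)"
      using h[OF D(1)] h[OF D(2)] D(3) by simp_all
    note RA = R[OF Mlc_homD(2)[OF fh] Mlc_homD(2)[OF fh]]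
    have K: "conn_ker f \<in> carrier (orderA f)" "conn_ker g \<in> carrier (orderA f)"
      using conn_ker_closed fh gh by blast+
    interpret A: bounded_lattice "orderA f" by (rule Mlc_objD(1)[OF Mlc_homD(2)[OF fh]])
    show "conn_ker (on_arr ?R (Comp (Mlc_category U) p f)) \<sqsubseteq>\<^bsub>on_obj ?R (orderA f)\<^esub>
        conn_ker (on_arr ?R f) \<squnion>\<^bsub>on_obj ?R (orderA f)\<^esub> conn_ker (on_arr ?R g)"
      using Mlc_pushout_ker[OF universe f g po] ker[OF fh] ker[OF gh] ker[OF Mlc_comp_hom[OF fh D(4)]]
        RA(2,4) K obj by simp
  qed
qed

text \<open>Once \<open>'l\<close> is at least as large as the universe, every small lattice injects
  into it; choosing one injection per lattice and composing with the relabelling changes only the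
  target.\<close>

lemma transfer_functor_Mlc_change:
  fixes T :: "('o, 'a, 'k gorder, ('k, 'k) galois) functor_data" and U :: "'u itself"
    and C :: "('o, 'a, 'm) system_category_scheme"
  assumes universe: "inaccessible_universe U" and le: "|UNIV :: 'u set| \<le>o |UNIV :: 'l set|"
    and T: "transfer_functor U C (Mlc U) T"
  shows "\<exists>S :: ('o, 'a, 'l gorder, ('l, 'l) galois) functor_data. transfer_functor U C (Mlc U) S"
proof -
  have "\<exists>f :: 'k \<Rightarrow> 'l. inj_on f (carrier L)" if "L \<in> Mlc_obj U" for L :: "'k gorder"
    by (rule small_embeds[OF Mlc_objD(3)[OF that] le])
  then obtain \<phi> :: "'k gorder \<Rightarrow> 'k \<Rightarrow> 'l"
    where "\<And>L. L \<in> Mlc_obj U \<Longrightarrow> inj_on (\<phi> L) (carrier L)"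
    by metis
  then show ?thesis
    using transfer_functor_comp[OF T transfer_functor_relabel[OF universe]] by blast
qed


section \<open>Noetherian forms from transfer functors\<close>

text \<open>Fibres and maps of the form are those of \<open>T\<close>, so (N1) is part of being an
  arrow of \<open>Mlc\<close>. The lattices have elements in \<open>'u\<close> because clusters of a
  form do. What remains is that quotients and embeddings are exactly the given classes, and
  (N3).\<close>

lemma induced_form:
  fixes T :: "('o, 'a, 'u gorder, ('u, 'u) galois) functor_data" and U :: "'u itself"
    and C :: "('o, 'a, 'm) system_category_scheme"
  assumes universe: "inaccessible_universe U" and T: "transfer_functor U C (Mlc U) T"
  shows "has_inducing_form U C"
proof -
  define F where "F = \<lparr>fibre = on_obj T, direct = (\<lambda>f. lower (on_arr T f)),
    inverse_im = (\<lambda>f. upper (on_arr T f))\<rparr>"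
  have F: "fibre F X = on_obj T X" "direct F f = lower (on_arr T f)"
    "inverse_im F f = upper (on_arr T f)" for X f
    unfolding F_def by simp_all
  have fct: "is_functor C (Mlc U) T" and C: "transfer_category U C"
    using T unfolding transfer_functor_def by auto
  interpret C: transfer_category U C by (rule C)
  note TD = is_functorD[OF fct, unfolded Hom_Mlc, simplified]
  note X = transfer_functor_MlcD[OF universe T]
  have Th: "on_arr T f \<in> Hom (Mlc_category U) (on_obj T (Dom C f)) (on_obj T (Cod C f))"
    if "f \<in> Arr C" for f
    using TD(2)[OF arr_hom[OF that]] .
  have con: "image_kernel_connection (on_obj T X) (on_obj T Y) (lower (on_arr T f)) (upper (on_arr T f))"
    if "f \<in> Hom C X Y" for f X Y
    using Mlc_homD(1)[OF TD(2)[OF that]] .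
  have im: "im_cluster C F f = conn_im (on_arr T f)" and ker: "ker_cluster C F f = conn_ker (on_arr T f)"
    if "f \<in> Arr C" for f
    using Mlc_homD(6,7)[OF Th[OF that]] unfolding im_cluster_def ker_cluster_def F by simp_all
  have im_comp: "conn_im (on_arr T (Comp C g f)) = lower (on_arr T g) (conn_im (on_arr T f))"
    and ker_comp: "conn_ker (on_arr T (Comp C g f)) = upper (on_arr T f) (conn_ker (on_arr T g))"
    if "f \<in> Hom C X Y" "g \<in> Hom C Y Z" for f g X Y Z
    using TD(4)[OF that] conn_im_comp[OF TD(2)[OF that(1)] TD(2)[OF that(2)]]
      conn_ker_comp[OF TD(2)[OF that(1)] TD(2)[OF that(2)]] by simp_all
  \<comment> \<open>Under \<open>T\<close> the factor \<open>m\<close> has trivial kernel and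
    \<open>e\<close> has full image, so \<open>f\<close> shares its image with \<open>m\<close> and
    its kernel with \<open>e\<close>. Questions about arbitrary arrows thereby reduce to the two
    classes.\<close>
  have fac: "\<exists>Z e m. e \<in> Left C \<and> m \<in> Right C \<and> e \<in> Hom C X Z \<and> m \<in> Hom C Z Y \<and> f = Comp C m e \<and>
      conn_im (on_arr T f) = conn_im (on_arr T m) \<and> conn_ker (on_arr T f) = conn_ker (on_arr T e)"
    if f: "f \<in> Hom C X Y" for f X Y
  proof -
    have fA: "f \<in> Arr C" using HomD[OF f] by blast
    obtain e m where em: "e \<in> Left C" "m \<in> Right C" "Cod C e = Dom C m" "f = Comp C m e"
      using C.factorization[OF fA] by blast
    have eA: "e \<in> Arr C" and mA: "m \<in> Arr C"
      using em C.left_arr C.right_arr by auto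
    have "Comp C m e \<in> Hom C (Dom C e) (Cod C m)"
      using C.comp_hom arr_hom[OF eA] arr_hom[OF mA] em(3) by metis
    then have d: "Dom C e = X" "Cod C m = Y"
      using em(4) HomD[OF f] HomD by metis+
    have e: "e \<in> Hom C X (Dom C m)" and m: "m \<in> Hom C (Dom C m) Y"
      using arr_hom[OF eA] arr_hom[OF mA] em(3) d by simp_all
    have "conn_im (on_arr T f) = conn_im (on_arr T m)"
      using im_comp[OF e m] em(4) X(1)[OF em(1)] HomD[OF e] Mlc_homD(6)[OF TD(2)[OF m]] by simp
    moreover have "conn_ker (on_arr T f) = conn_ker (on_arr T e)"
      using ker_comp[OF e m] em(4) X(2)[OF em(2)] HomD[OF m] Mlc_homD(7)[OF TD(2)[OF e]] by simp
    ultimately show ?thesis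
      using em e m by blast
  qed
  have M_emb: "embedding_of C F (Cod C m) (conn_im (on_arr T m)) m" if m: "m \<in> Right C" for m
  proof -
    have mA: "m \<in> Arr C" using m C.right_arr by blast
    note mh = arr_hom[OF mA]
    have "\<exists>h. h \<in> Hom C (Dom C f) (Dom C m) \<and> f = Comp C m h"
      if f: "f \<in> Arr C" "Cod C f = Cod C m"
        and le: "conn_im (on_arr T f) \<sqsubseteq>\<^bsub>on_obj T (Cod C m)\<^esub> conn_im (on_arr T m)" for f
    proof -
      have fh: "f \<in> Hom C (Dom C f) (Cod C m)"
        using arr_hom[OF f(1)] f(2) by simp
      obtain Z e' m' where fac: "e' \<in> Left C" "m' \<in> Right C" "e' \<in> Hom C (Dom C f) Z"
        "m' \<in> Hom C Z (Cod C m)" "f = Comp C m' e'"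
        and ims: "conn_im (on_arr T f) = conn_im (on_arr T m')"
        using fac[OF fh] by blast
      have dc: "Dom C m' = Z" "Cod C m' = Cod C m"
        using HomD[OF fac(4)] by auto
      obtain p q where pb: "is_pullback C m' m p q"
        using C.right_pullbacks[OF fac(2) m dc(2)] by blast
      note D = is_pullbackD[OF pb, unfolded dc]
      have pR: "p \<in> Right C" by (rule C.pullback_right[OF pb m])
      have pA: "p \<in> Arr C" using C.right_arr pR by blast
      have pd: "Cod C p = Z" using HomD[OF D(4)] by simp
      interpret M': image_kernel_connection "on_obj T Z" "on_obj T (Cod C m)"
        "lower (on_arr T m')" "upper (on_arr T m')" by (rule con[OF fac(4)])
      have I: "conn_im (on_arr T m') \<in> carrier (on_obj T (Cod C m))"
        "conn_im (on_arr T m) \<in> carrier (on_obj T (Cod C m))"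
        "conn_im (on_arr T p) \<in> carrier (on_obj T Z)"
        using conn_im_closed[OF TD(2)[OF fac(4)]] conn_im_closed[OF Th[OF mA]]
          conn_im_closed[OF TD(2)[OF D(4)]] by auto
      \<comment> \<open>Preservation of the pullback makes the image of \<open>m' p\<close> the meet
        of both images, which here is the image of \<open>m'\<close>. Since the direct image along
        \<open>m'\<close> is injective, the image of \<open>p\<close> must be the top
        element.\<close>
      have "lower (on_arr T m') (conn_im (on_arr T p)) = conn_im (on_arr T m')"
        using X(4)[OF fac(2) m pb] im_comp[OF D(4) fac(4)] dc M'.B.meet_absorb[OF I(1,2)] le ims by simp
      also have "\<dots> = lower (on_arr T m') \<top>\<^bsub>on_obj T Z\<^esub>"
        by (rule Mlc_homD(6)[OF TD(2)[OF fac(4)]])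
      finally have "conn_im (on_arr T p) = \<top>\<^bsub>on_obj T Z\<^esub>"
        using M'.inj_iff X(2)[OF fac(2)] dc(1) Mlc_homD(7)[OF TD(2)[OF fac(4)]] I(3)
        by (simp add: inj_on_eq_iff)
      then have "iso_arrow C p"
        using X(3)[OF pA] X(2)[OF pR] pd by simp
      then obtain r where r: "r \<in> Hom C Z (Dom C p)" "Comp C p r = Id C Z"
        using pd unfolding iso_arrow_def by blast
      have "Comp C m (Comp C q r) = Comp C m' (Comp C p r)"
        using C.comp_assoc[OF r(1) D(5) mh] C.comp_assoc[OF r(1) D(4) fac(4)] D(6) by simp
      also have "\<dots> = m'"
        using r(2) C.comp_id[OF fac(4)] by simp
      finally have mq: "Comp C m (Comp C q r) = m'" .
      have qr: "Comp C q r \<in> Hom C Z (Dom C m)"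
        using C.comp_hom[OF r(1) D(5)] .
      have "Comp C m (Comp C (Comp C q r) e') = f"
        using C.comp_assoc[OF fac(3) qr mh] mq fac(5) by simp
      then show ?thesis
        using C.comp_hom[OF fac(3) qr] by blast
    qed
    then have "\<exists>!h. h \<in> Hom C (Dom C f) (Dom C m) \<and> f = Comp C m h"
      if "f \<in> Arr C" "Cod C f = Cod C m"
        "conn_im (on_arr T f) \<sqsubseteq>\<^bsub>on_obj T (Cod C m)\<^esub> conn_im (on_arr T m)" for f
      using that C.mono_cancel[OF C.right_mono[OF m] mh] by metis
    moreover have "conormal_cluster C F (Cod C m) (conn_im (on_arr T m))"
      unfolding conormal_cluster_def using mA im[OF mA] by blast
    ultimately show ?thesis
      unfolding embedding_of_def using mA im by (simp add: F(1))
  qed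
  have E_quo: "quotient_of C F (Dom C e) (conn_ker (on_arr T e)) e" if e: "e \<in> Left C" for e
  proof -
    have eA: "e \<in> Arr C" using e C.left_arr by blast
    note eh = arr_hom[OF eA]
    have "\<exists>h. h \<in> Hom C (Cod C e) (Cod C g) \<and> g = Comp C h e"
      if g: "g \<in> Arr C" "Dom C g = Dom C e"
        and le: "conn_ker (on_arr T e) \<sqsubseteq>\<^bsub>on_obj T (Dom C e)\<^esub> conn_ker (on_arr T g)" for g
    proof -
      have gh: "g \<in> Hom C (Dom C e) (Cod C g)"
        using arr_hom[OF g(1)] g(2) by simp
      obtain Z e' m' where fac: "e' \<in> Left C" "m' \<in> Right C" "e' \<in> Hom C (Dom C e) Z"
        "m' \<in> Hom C Z (Cod C g)" "g = Comp C m' e'"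
        and kers: "conn_ker (on_arr T g) = conn_ker (on_arr T e')"
        using fac[OF gh] by blast
      have dc: "Dom C e' = Dom C e" "Cod C e' = Z"
        using HomD[OF fac(3)] by auto
      obtain p q where po: "is_pushout C e' e p q"
        using C.left_pushouts[OF fac(1) e dc(1)] by blast
      note D = is_pushoutD[OF po, unfolded dc]
      have pL: "p \<in> Left C" by (rule C.pushout_left[OF po e])
      have pA: "p \<in> Arr C" using C.left_arr pL by blast
      have pd: "Dom C p = Z" using HomD[OF D(4)] by simp
      interpret E': image_kernel_connection "on_obj T (Dom C e)" "on_obj T Z"
        "lower (on_arr T e')" "upper (on_arr T e')" by (rule con[OF fac(3)])
      have K: "conn_ker (on_arr T e') \<in> carrier (on_obj T (Dom C e))"
        "conn_ker (on_arr T e) \<in> carrier (on_obj T (Dom C e))"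
        "conn_ker (on_arr T p) \<in> carrier (on_obj T Z)"
        using conn_ker_closed[OF TD(2)[OF fac(3)]] conn_ker_closed[OF Th[OF eA]]
          conn_ker_closed[OF TD(2)[OF D(4)]] by auto
      \<comment> \<open>Dually, the kernel of \<open>p e'\<close> is the join of both kernels, here
        the kernel of \<open>e'\<close>. Pushing it forward along the surjective \<open>e'\<close>
        recovers the kernel of \<open>p\<close>, which is therefore bottom.\<close>
      have "upper (on_arr T e') (conn_ker (on_arr T p)) = conn_ker (on_arr T e')"
        using X(5)[OF fac(1) e po] ker_comp[OF fac(3) D(4)] dc E'.A.join_absorb[OF K(1,2)] le kers
        by simp
      also have "\<dots> = upper (on_arr T e') \<bottom>\<^bsub>on_obj T Z\<^esub>"
        by (rule Mlc_homD(7)[OF TD(2)[OF fac(3)]])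
      finally have "lower (on_arr T e') (upper (on_arr T e') (conn_ker (on_arr T p))) = \<bottom>\<^bsub>on_obj T Z\<^esub>"
        using E'.l_ker by simp
      then have "conn_ker (on_arr T p) = \<bottom>\<^bsub>on_obj T Z\<^esub>"
        using E'.lu[OF K(3)] X(1)[OF fac(1)] dc(2) Mlc_homD(6)[OF TD(2)[OF fac(3)]]
          E'.B.meet_top[OF K(3)] by simp
      then have "iso_arrow C p"
        using X(3)[OF pA] X(1)[OF pL] pd by simp
      then obtain r where r: "r \<in> Hom C (Cod C p) Z" "Comp C r p = Id C Z"
        using pd unfolding iso_arrow_def by blast
      have "Comp C (Comp C r q) e = Comp C (Comp C r p) e'"
        using C.comp_assoc[OF eh D(5) r(1)] C.comp_assoc[OF fac(3) D(4) r(1)] D(6) by simp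
      also have "\<dots> = e'"
        using r(2) C.id_comp[OF fac(3)] by simp
      finally have rq: "Comp C (Comp C r q) e = e'" .
      have rqh: "Comp C r q \<in> Hom C (Cod C e) Z"
        using C.comp_hom[OF D(5) r(1)] .
      have "Comp C (Comp C m' (Comp C r q)) e = g"
        using C.comp_assoc[OF eh rqh fac(4)] rq fac(5) by simp
      then show ?thesis
        using C.comp_hom[OF rqh fac(4)] by blast
    qed
    then have "\<exists>!h. h \<in> Hom C (Cod C e) (Cod C g) \<and> g = Comp C h e"
      if "g \<in> Arr C" "Dom C g = Dom C e"
        "conn_ker (on_arr T e) \<sqsubseteq>\<^bsub>on_obj T (Dom C e)\<^esub> conn_ker (on_arr T g)" for g
      using that C.epi_cancel[OF C.left_epi[OF e] eh] by metis
    moreover have "normal_cluster C F (Dom C e) (conn_ker (on_arr T e))"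
      unfolding normal_cluster_def using eA ker[OF eA] by blast
    ultimately show ?thesis
      unfolding quotient_of_def using eA ker by (simp add: F(1))
  qed
  have oF: "orean_form U C F"
  proof (rule orean_form.intro)
    fix X assume Xo: "X \<in> Obj C"
    have LX: "on_obj T X \<in> Mlc_obj U" by (rule TD(1)[OF Xo])
    show "bounded_lattice (fibre F X)" "small U (carrier (fibre F X))"
      unfolding F using Mlc_objD[OF LX] by auto
    fix S assume S: "S \<in> carrier (fibre F X)"
    show "direct F (Id C X) S = S" "inverse_im F (Id C X) S = S"
      using TD(3)[OF Xo] S unfolding F by (simp_all add: Mlc_id_apply)
  next
    fix f X Y assume f: "f \<in> Hom C X Y"
    interpret c: image_kernel_connection "on_obj T X" "on_obj T Y" "lower (on_arr T f)" "upper (on_arr T f)"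
      by (rule con[OF f])
    show "galois_connection \<lparr>orderA = fibre F X, orderB = fibre F Y,
        lower = direct F f, upper = inverse_im F f\<rparr>"
      unfolding galois_connection_def galois_connection_axioms_def connection_def F
      using c.A.partial_order_axioms c.B.partial_order_axioms c.l_closed c.u_closed c.adj by auto
    fix g Z assume g: "g \<in> Hom C Y Z"
    show "direct F (Comp C g f) S = direct F g (direct F f S)" if "S \<in> carrier (fibre F X)" for S
      using that TD(4)[OF f g] Mlc_homD(4)[OF TD(2)[OF f]] unfolding F by (simp add: Mlc_comp_apply)
    show "inverse_im F (Comp C g f) S = inverse_im F f (inverse_im F g S)"
      if "S \<in> carrier (fibre F Z)" for S
      using that TD(4)[OF f g] Mlc_homD(5)[OF TD(2)[OF g]] unfolding F by (simp add: Mlc_comp_apply)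
  qed
  have nF: "noetherian_form U C F"
  proof (intro noetherian_form.intro[OF oF] noetherian_form_axioms.intro)
    fix f X Y assume f: "f \<in> Hom C X Y"
    have fA: "f \<in> Arr C" using HomD[OF f] by blast
    interpret c: image_kernel_connection "on_obj T X" "on_obj T Y" "lower (on_arr T f)" "upper (on_arr T f)"
      by (rule con[OF f])
    show "inverse_im F f (direct F f S) = S \<squnion>\<^bsub>fibre F X\<^esub> ker_cluster C F f"
      if "S \<in> carrier (fibre F X)" for S
      using that c.ul ker[OF fA] Mlc_homD(7)[OF TD(2)[OF f]] unfolding F by simp
    show "direct F f (inverse_im F f S) = S \<sqinter>\<^bsub>fibre F Y\<^esub> im_cluster C F f"
      if "S \<in> carrier (fibre F Y)" for S
      using that c.lu im[OF fA] Mlc_homD(6)[OF TD(2)[OF f]] unfolding F by simp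
    obtain Z e m where fm: "e \<in> Left C" "m \<in> Right C" "e \<in> Hom C X Z" "m \<in> Hom C Z Y" "f = Comp C m e"
      "conn_im (on_arr T f) = conn_im (on_arr T m)" "conn_ker (on_arr T f) = conn_ker (on_arr T e)"
      using fac[OF f] by blast
    show "\<exists>e m. quotient_of C F X (ker_cluster C F f) e \<and> embedding_of C F Y (im_cluster C F f) m \<and>
        Cod C e = Dom C m \<and> f = Comp C m e"
      using E_quo[OF fm(1)] M_emb[OF fm(2)] HomD[OF fm(3)] HomD[OF fm(4)] fm(5-7) im[OF fA] ker[OF fA]
      by (intro exI[of _ e] exI[of _ m]) simp
  next
    fix X S S' assume "normal_cluster C F X S" "normal_cluster C F X S'"
    then obtain f g where f: "f \<in> Arr C" "Dom C f = X" "S = conn_ker (on_arr T f)"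
      and g: "g \<in> Arr C" "Dom C g = X" "S' = conn_ker (on_arr T g)"
      using ker unfolding normal_cluster_def by blast
    \<comment> \<open>Normal clusters are kernels of arbitrary arrows. Replacing these by their left
      factors keeps the kernels and makes a pushout available, whose kernel is the join.\<close>
    obtain Z e where e: "e \<in> Left C" "e \<in> Hom C X Z" "S = conn_ker (on_arr T e)"
      using fac[OF arr_hom[OF f(1)]] f by metis
    obtain Z' d where d: "d \<in> Left C" "d \<in> Hom C X Z'" "S' = conn_ker (on_arr T d)"
      using fac[OF arr_hom[OF g(1)]] g by metis
    have "Dom C e = Dom C d" using HomD[OF e(2)] HomD[OF d(2)] by simp
    then obtain p q where po: "is_pushout C e d p q"
      using C.left_pushouts[OF e(1) d(1)] by blast
    have h: "Comp C p e \<in> Hom C X (Cod C p)"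
      using C.comp_hom[OF e(2)] is_pushoutD(4)[OF po] HomD[OF e(2)] by simp
    have "ker_cluster C F (Comp C p e) = S \<squnion>\<^bsub>fibre F X\<^esub> S'"
      using X(5)[OF e(1) d(1) po] ker HomD[OF h] e(3) d(3) HomD[OF e(2)] by (simp add: F)
    then show "normal_cluster C F X (S \<squnion>\<^bsub>fibre F X\<^esub> S')"
      unfolding normal_cluster_def using HomD[OF h] by blast
  next
    fix X S S' assume "conormal_cluster C F X S" "conormal_cluster C F X S'"
    then obtain f g where f: "f \<in> Arr C" "Cod C f = X" "S = conn_im (on_arr T f)"
      and g: "g \<in> Arr C" "Cod C g = X" "S' = conn_im (on_arr T g)"
      using im unfolding conormal_cluster_def by blast
    \<comment> \<open>Dually, right factors keep the images, and their pullback realises the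
      meet.\<close>
    obtain Z m where m: "m \<in> Right C" "m \<in> Hom C Z X" "S = conn_im (on_arr T m)"
      using fac[OF arr_hom[OF f(1)]] f by metis
    obtain Z' n where n: "n \<in> Right C" "n \<in> Hom C Z' X" "S' = conn_im (on_arr T n)"
      using fac[OF arr_hom[OF g(1)]] g by metis
    have "Cod C m = Cod C n" using HomD[OF m(2)] HomD[OF n(2)] by simp
    then obtain p q where pb: "is_pullback C m n p q"
      using C.right_pullbacks[OF m(1) n(1)] by blast
    have h: "Comp C m p \<in> Hom C (Dom C p) X"
      using C.comp_hom[OF _ m(2)] is_pullbackD(4)[OF pb] HomD[OF m(2)] by simp
    have "im_cluster C F (Comp C m p) = S \<sqinter>\<^bsub>fibre F X\<^esub> S'"
      using X(4)[OF m(1) n(1) pb] im HomD[OF h] m(3) n(3) HomD[OF m(2)] by (simp add: F)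
    then show "conormal_cluster C F X (S \<sqinter>\<^bsub>fibre F X\<^esub> S')"
      unfolding conormal_cluster_def using HomD[OF h] by blast
  qed
  \<comment> \<open>Factor a quotient \<open>e\<close> of the form as \<open>m e'\<close>. As
    \<open>e'\<close> has the same kernel, it equals \<open>h e\<close> for some \<open>h\<close>,
    and the uniqueness clause applied to \<open>e\<close> itself forces \<open>m h = id\<close>. So
    \<open>m\<close> is invertible and \<open>e\<close> is in the left class.\<close>
  have "e \<in> Left C" if q: "quotient_of C F X K e" for X K e
  proof -
    have eA: "e \<in> Arr C" "Dom C e = X" "ker_cluster C F e = K"
      and univ: "\<And>g. g \<in> Arr C \<Longrightarrow> Dom C g = X \<Longrightarrow> K \<sqsubseteq>\<^bsub>fibre F X\<^esub> ker_cluster C F g \<Longrightarrow>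
        \<exists>!h. h \<in> Hom C (Cod C e) (Cod C g) \<and> g = Comp C h e"
      using q unfolding quotient_of_def by blast+
    have eh: "e \<in> Hom C X (Cod C e)" using arr_hom[OF eA(1)] eA(2) by simp
    obtain Z e' m where fm: "e' \<in> Left C" "m \<in> Right C" "e' \<in> Hom C X Z" "m \<in> Hom C Z (Cod C e)"
      "e = Comp C m e'" "conn_ker (on_arr T e) = conn_ker (on_arr T e')"
      using fac[OF eh] by blast
    have e'A: "e' \<in> Arr C" "Dom C e' = X" "Cod C e' = Z" using HomD[OF fm(3)] by auto
    interpret A: bounded_lattice "on_obj T X"
      using Mlc_objD(1)[OF TD(1)] C.dom_obj[OF eA(1)] eA(2) by simp
    have K: "K \<sqsubseteq>\<^bsub>fibre F X\<^esub> ker_cluster C F e'" "K \<sqsubseteq>\<^bsub>fibre F X\<^esub> ker_cluster C F e"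
      using ker[OF eA(1)] ker[OF e'A(1)] eA(3) fm(6) conn_ker_closed[OF TD(2)[OF eh]] unfolding F by auto
    obtain h where h: "h \<in> Hom C (Cod C e) Z" "e' = Comp C h e"
      using univ[OF e'A(1,2) K(1)] e'A(3) by blast
    have "Comp C (Comp C m h) e = e"
      using C.comp_assoc[OF eh h(1) fm(4)] h(2)[symmetric] fm(5)[symmetric] by simp
    moreover have "Comp C (Id C (Cod C e)) e = e"
      by (rule C.id_comp[OF eh])
    moreover have "Comp C m h \<in> Hom C (Cod C e) (Cod C e)" "Id C (Cod C e) \<in> Hom C (Cod C e) (Cod C e)"
      using C.comp_hom[OF h(1) fm(4)] C.id_hom C.cod_obj[OF eA(1)] by auto
    ultimately have "Comp C m h = Id C (Cod C e)"
      using univ[OF eA(1,2) K(2)] by metis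
    then have "iso_arrow C m"
      using C.mono_retraction_iso[OF C.right_mono[OF fm(2)] fm(4) h(1)] by blast
    then show "e \<in> Left C"
      using C.comp_left[OF fm(1) C.iso_left] e'A(3) HomD[OF fm(4)] fm(5) by simp
  qed
  \<comment> \<open>Dually, for \<open>m = m' e\<close> the equal images give
    \<open>m' = m h\<close>, and uniqueness forces \<open>h e = id\<close>, so \<open>e\<close> is
    invertible.\<close>
  moreover have "m \<in> Right C" if q: "embedding_of C F X S m" for X S m
  proof -
    have mA: "m \<in> Arr C" "Cod C m = X" "im_cluster C F m = S"
      and univ: "\<And>f. f \<in> Arr C \<Longrightarrow> Cod C f = X \<Longrightarrow> im_cluster C F f \<sqsubseteq>\<^bsub>fibre F X\<^esub> S \<Longrightarrow>
        \<exists>!h. h \<in> Hom C (Dom C f) (Dom C m) \<and> f = Comp C m h"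
      using q unfolding embedding_of_def by blast+
    have mh: "m \<in> Hom C (Dom C m) X" using arr_hom[OF mA(1)] mA(2) by simp
    obtain Z e m' where fm: "e \<in> Left C" "m' \<in> Right C" "e \<in> Hom C (Dom C m) Z" "m' \<in> Hom C Z X"
      "m = Comp C m' e" "conn_im (on_arr T m) = conn_im (on_arr T m')"
      using fac[OF mh] by blast
    have m'A: "m' \<in> Arr C" "Cod C m' = X" "Dom C m' = Z" using HomD[OF fm(4)] by auto
    interpret A: bounded_lattice "on_obj T X"
      using Mlc_objD(1)[OF TD(1)] C.cod_obj[OF mA(1)] mA(2) by simp
    have S: "im_cluster C F m' \<sqsubseteq>\<^bsub>fibre F X\<^esub> S" "im_cluster C F m \<sqsubseteq>\<^bsub>fibre F X\<^esub> S"
      using im[OF mA(1)] im[OF m'A(1)] mA(3) fm(6) conn_im_closed[OF TD(2)[OF mh]] unfolding F by auto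
    obtain h where h: "h \<in> Hom C Z (Dom C m)" "m' = Comp C m h"
      using univ[OF m'A(1,2) S(1)] m'A(3) by blast
    have "Comp C m (Comp C h e) = m"
      using C.comp_assoc[OF fm(3) h(1) mh] h(2)[symmetric] fm(5)[symmetric] by simp
    moreover have "Comp C m (Id C (Dom C m)) = m"
      by (rule C.comp_id[OF mh])
    moreover have "Comp C h e \<in> Hom C (Dom C m) (Dom C m)" "Id C (Dom C m) \<in> Hom C (Dom C m) (Dom C m)"
      using C.comp_hom[OF fm(3) h(1)] C.id_hom C.dom_obj[OF mA(1)] by auto
    ultimately have "Comp C h e = Id C (Dom C m)"
      using univ[OF mA(1,2) S(2)] by metis
    then have "iso_arrow C e"
      using C.epi_section_iso[OF C.left_epi[OF fm(1)] fm(3) h(1)] by blast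
    then show "m \<in> Right C"
      using C.comp_right[OF C.iso_right fm(2)] m'A(3) HomD[OF fm(3)] fm(5) by simp
  qed
  ultimately have "induces_system F C"
    unfolding induces_system_def
    using E_quo M_emb C.dom_obj C.cod_obj C.left_arr C.right_arr by blast
  then show ?thesis
    unfolding has_inducing_form_def using nF by blast
qed

section \<open>Sets\<close>

lemma Set_simps [simp]:
  "Obj (Set_cat U) = {X. small U X}" "Arr (Set_cat U) = Set_arr U"
  "Dom (Set_cat U) = source" "Cod (Set_cat U) = target"
  unfolding Set_cat_def by simp_all

lemma Set_hom_iff:
  "f \<in> Hom (Set_cat U) X Y \<longleftrightarrow> small U X \<and> small U Y \<and> source f = X \<and> target f = Y \<and>
     action f \<in> X \<rightarrow>\<^sub>E Y"
  unfolding Hom_def by (auto simp: Set_arr_def)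

lemma Set_homI:
  assumes "small U X" "small U Y" "\<And>x. x \<in> X \<Longrightarrow> h x \<in> Y"
  shows "\<lparr>source = X, target = Y, action = restrict h X\<rparr> \<in> Hom (Set_cat U) X Y"
  using assms unfolding Set_hom_iff by auto

lemma Set_comp_action:
  "x \<in> source f \<Longrightarrow> action (Comp (Set_cat U) g f) x = action g (action f x)"
  unfolding Set_cat_def by (simp add: compose_eq)

lemma Set_comp_hom:
  "f \<in> Hom (Set_cat U) X Y \<Longrightarrow> g \<in> Hom (Set_cat U) Y Z \<Longrightarrow> Comp (Set_cat U) g f \<in> Hom (Set_cat U) X Z"
  unfolding Set_hom_iff by (auto simp: Set_cat_def compose_def)

lemma Set_hom_eqI:
  assumes "f \<in> Hom (Set_cat U) X Y" "g \<in> Hom (Set_cat U) X Y"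
    "\<And>x. x \<in> X \<Longrightarrow> action f x = action g x"
  shows "f = g"
proof -
  have "action f = action g"
    using assms PiE_ext[of "action f" X "\<lambda>_. Y" "action g"] unfolding Set_hom_iff by blast
  then show ?thesis
    using assms(1,2) unfolding Set_hom_iff by (simp add: typed_map.equality)
qed

lemma Set_homD:
  assumes "f \<in> Hom (Set_cat U) X Y"
  shows "small U X" "small U Y" "source f = X" "target f = Y" "\<And>x. x \<in> X \<Longrightarrow> action f x \<in> Y"
  using assms unfolding Set_hom_iff by auto

lemma Set_Left_iff: "f \<in> Hom (Set_cat U) X Y \<Longrightarrow> f \<in> Left (Set_cat U) \<longleftrightarrow> action f ` X = Y"
  unfolding Hom_def by (auto simp: Set_cat_def)

lemma Set_Right_iff: "f \<in> Hom (Set_cat U) X Y \<Longrightarrow> f \<in> Right (Set_cat U) \<longleftrightarrow> inj_on (action f) X"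
  unfolding Hom_def by (auto simp: Set_cat_def)

lemma concrete_system_Set:
  assumes "inaccessible_universe U"
  shows "concrete_system U (Set_cat U :: ('x set, ('x set, 'x) typed_map) system_category) (\<lambda>X. X) action"
proof (rule concrete_system.intro)
  let ?S = "Set_cat U :: ('x set, ('x set, 'x) typed_map) system_category"
  show "inaccessible_universe U" by fact
  show "Dom ?S f \<in> Obj ?S" "Cod ?S f \<in> Obj ?S" if "f \<in> Arr ?S" for f
    using that by (auto simp: Set_arr_def)
  show "Id ?S X \<in> Hom ?S X X" if "X \<in> Obj ?S" for X
    using that unfolding Set_hom_iff by (simp add: Set_cat_def)
  show "Comp ?S g f \<in> Hom ?S X Z" if "f \<in> Hom ?S X Y" "g \<in> Hom ?S Y Z" for f g X Y Z
    using that by (rule Set_comp_hom)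
  show "small U X" if "X \<in> Obj ?S" for X
    using that by simp
  show "action f \<in> X \<rightarrow>\<^sub>E Y" if "f \<in> Hom ?S X Y" for f X Y
    using that unfolding Set_hom_iff by blast
  show "action (Id ?S X) x = x" if "X \<in> Obj ?S" "x \<in> X" for X x
    using that by (simp add: Set_cat_def)
  show "action (Comp ?S g f) x = action g (action f x)"
    if "f \<in> Hom ?S X Y" "g \<in> Hom ?S Y Z" "x \<in> X" for f g X Y Z x
    using Set_homD(3)[OF that(1)] that(3) by (simp add: Set_comp_action)
  show "f = g" if "f \<in> Hom ?S X Y" "g \<in> Hom ?S X Y" "action f = action g" for f g X Y
    using Set_hom_eqI[OF that(1,2)] that(3) by simp
  show "f \<in> Left ?S \<longleftrightarrow> action f ` X = Y" if "f \<in> Hom ?S X Y" for f X Y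
    using that by (rule Set_Left_iff)
  show "f \<in> Right ?S \<longleftrightarrow> inj_on (action f) X" if "f \<in> Hom ?S X Y" for f X Y
    using that by (rule Set_Right_iff)
  show "Left ?S \<subseteq> Arr ?S" "Right ?S \<subseteq> Arr ?S"
    by (auto simp: Set_cat_def)
  show "\<exists>h \<in> Hom ?S X Y. Comp ?S f h = g"
    if f: "f \<in> Hom ?S Y Z" and g: "g \<in> Hom ?S X Z" and sub: "action g ` X \<subseteq> action f ` Y" for f g X Y Z
  proof -
    let ?a = "\<lambda>x. inv_into Y (action f) (action g x)"
    let ?h = "\<lparr>source = X, target = Y, action = restrict ?a X\<rparr>"
    have a: "?a x \<in> Y" "action f (?a x) = action g x" if "x \<in> X" for x
    proof -
      have "action g x \<in> action f ` Y" using that sub by blast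
      then show "?a x \<in> Y" "action f (?a x) = action g x"
        by (rule inv_into_into, rule f_inv_into_f)
    qed
    have h: "?h \<in> Hom ?S X Y"
      using Set_homI[OF Set_homD(1)[OF g] Set_homD(1)[OF f] a(1)] .
    moreover have "Comp ?S f ?h = g"
      by (rule Set_hom_eqI[OF Set_comp_hom[OF h f] g]) (simp add: Set_comp_action a(2))
    ultimately show ?thesis by blast
  qed
  show "\<exists>h \<in> Hom ?S Y Z. Comp ?S h e = g"
    if eL: "e \<in> Left ?S" and e: "e \<in> Hom ?S X Y" and g: "g \<in> Hom ?S X Z"
      and sub: "kernel_pair X (action e) \<subseteq> kernel_pair X (action g)" for e g X Y Z
  proof -
    let ?a = "\<lambda>y. action g (inv_into X (action e) y)"
    let ?h = "\<lparr>source = Y, target = Z, action = restrict ?a Y\<rparr>"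
    have s: "action e ` X = Y" using eL Set_Left_iff[OF e] by blast
    have i: "inv_into X (action e) y \<in> X" "action e (inv_into X (action e) y) = y" if "y \<in> Y" for y
      using that s inv_into_into[of y "action e" X] f_inv_into_f[of y "action e" X] by auto
    have h: "?h \<in> Hom ?S Y Z"
      using Set_homI[OF Set_homD(2)[OF e] Set_homD(2)[OF g], of ?a] Set_homD(5)[OF g] i(1) by blast
    moreover have "Comp ?S ?h e = g"
    proof (rule Set_hom_eqI[OF Set_comp_hom[OF e h] g])
      fix x assume x: "x \<in> X"
      then have y: "action e x \<in> Y" using Set_homD(5)[OF e] by blast
      then have "(inv_into X (action e) (action e x), x) \<in> kernel_pair X (action g)"
        using sub i[OF y] x unfolding kernel_pair_def by auto
      then show "action (Comp ?S ?h e) x = action g x"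
        using x y Set_homD(3)[OF e] by (simp add: Set_comp_action kernel_pair_def)
    qed
    ultimately show ?thesis by blast
  qed
  show "\<exists>Z. \<exists>e \<in> Left ?S \<inter> Hom ?S X Z. \<exists>m \<in> Right ?S \<inter> Hom ?S Z Y. f = Comp ?S m e"
    if f: "f \<in> Hom ?S X Y" for f X Y
  proof -
    let ?Z = "action f ` X"
    let ?e = "\<lparr>source = X, target = ?Z, action = restrict (action f) X\<rparr>"
    let ?m = "\<lparr>source = ?Z, target = Y, action = restrict (\<lambda>z. z) ?Z\<rparr>"
    note F = Set_homD[OF f]
    have e: "?e \<in> Hom ?S X ?Z" and m: "?m \<in> Hom ?S ?Z Y"
      using Set_homI[OF F(1) small_image[OF F(1)], of "action f"]
        Set_homI[OF small_image[OF F(1)] F(2), of "action f" "\<lambda>z. z"] F(5) by auto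
    have "f = Comp ?S ?m ?e"
      by (rule Set_hom_eqI[OF f Set_comp_hom[OF e m]]) (simp add: Set_comp_action)
    moreover have "?e \<in> Left ?S" "?m \<in> Right ?S"
      using Set_Left_iff[OF e] Set_Right_iff[OF m] by (auto simp: inj_on_def)
    ultimately show ?thesis
      using e m by blast
  qed
  show "\<exists>W. \<exists>n \<in> Right ?S \<inter> Hom ?S W Z. action n ` W = action f ` X \<inter> action g ` Y"
    if f: "f \<in> Hom ?S X Z" and g: "g \<in> Hom ?S Y Z" for f g X Y Z
  proof -
    let ?W = "action f ` X \<inter> action g ` Y"
    let ?n = "\<lparr>source = ?W, target = Z, action = restrict (\<lambda>z. z) ?W\<rparr>"
    have "small U ?W"
      by (rule small_subset[OF small_image[OF Set_homD(1)[OF f]] Int_lower1])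
    then have n: "?n \<in> Hom ?S ?W Z"
      by (rule Set_homI[OF _ Set_homD(2)[OF f]]) (use Set_homD(5)[OF f] in auto)
    moreover have "?n \<in> Right ?S" "action ?n ` ?W = ?W"
      using Set_Right_iff[OF n] by (auto simp: inj_on_def)
    ultimately show ?thesis by blast
  qed
  show "\<exists>W. \<exists>n \<in> Left ?S \<inter> Hom ?S X W.
             kernel_pair X (action f) \<subseteq> kernel_pair X (action n) \<and>
             kernel_pair X (action g) \<subseteq> kernel_pair X (action n) \<and>
             (\<forall>V. \<forall>w \<in> Hom ?S X V.
                kernel_pair X (action f) \<subseteq> kernel_pair X (action w) \<longrightarrow>
                kernel_pair X (action g) \<subseteq> kernel_pair X (action w) \<longrightarrow>
                kernel_pair X (action n) \<subseteq> kernel_pair X (action w))"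
    if f: "f \<in> Hom ?S X Y" and g: "g \<in> Hom ?S X Z" for f g X Y Z
  proof -
    \<comment> \<open>\<open>R\<close> is the intersection of the kernel pairs of all functions that
      identify what \<open>f\<close> or \<open>g\<close> identifies, hence the least kernel pair
      above both. The choice \<open>r\<close> depends only on the class of its argument and picks a
      member of that class, so the quotient is represented by a subset of \<open>X\<close> and keeps
      the element type.\<close>
    define Q where "Q w \<longleftrightarrow> kernel_pair X (action f) \<subseteq> kernel_pair X w \<and>
        kernel_pair X (action g) \<subseteq> kernel_pair X w" for w :: "'x \<Rightarrow> 'x"
    define R where "R x y \<longleftrightarrow> x \<in> X \<and> y \<in> X \<and> (\<forall>w. Q w \<longrightarrow> w x = w y)" for x y
    define r where "r x = (SOME y. R x y)" for x
    have refl: "R x x" if "x \<in> X" for x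
      using that unfolding R_def by simp
    have sym: "R y x" if "R x y" for x y
      using that unfolding R_def by metis
    have trans: "R x z" if "R x y" "R y z" for x y z
      using that unfolding R_def by metis
    have Rr: "R x (r x)" if "x \<in> X" for x
      using refl[OF that] unfolding r_def by (rule someI)
    have eq: "r x = r y" if "R x y" for x y
    proof -
      have "R x = R y"
        using that sym trans by (intro ext) metis
      then show ?thesis unfolding r_def by simp
    qed
    have Req: "R x y \<longleftrightarrow> x \<in> X \<and> y \<in> X \<and> r x = r y" for x y
    proof
      show "R x y \<Longrightarrow> x \<in> X \<and> y \<in> X \<and> r x = r y"
        using eq[of x y] unfolding R_def by simp
      show "x \<in> X \<and> y \<in> X \<and> r x = r y \<Longrightarrow> R x y"
        using Rr[of x] sym[OF Rr[of y]] trans by simp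
    qed
    let ?n = "\<lparr>source = X, target = r ` X, action = restrict r X\<rparr>"
    have n: "?n \<in> Hom ?S X (r ` X)"
      by (rule Set_homI[OF Set_homD(1)[OF f] small_image[OF Set_homD(1)[OF f]]]) simp
    have ker: "kernel_pair X (action ?n) = {(x, y). R x y}"
      unfolding kernel_pair_def by (auto simp: Req)
    have "?n \<in> Left ?S"
      using Set_Left_iff[OF n] by simp
    moreover have "kernel_pair X (action f) \<subseteq> kernel_pair X (action ?n)"
      "kernel_pair X (action g) \<subseteq> kernel_pair X (action ?n)"
      unfolding ker R_def Q_def by (auto simp: kernel_pair_def)
    moreover have "kernel_pair X (action ?n) \<subseteq> kernel_pair X (action w)"
      if "kernel_pair X (action f) \<subseteq> kernel_pair X (action w)"
        "kernel_pair X (action g) \<subseteq> kernel_pair X (action w)" for w :: "('x set, 'x) typed_map"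
    proof -
      have "Q (action w)"
        using that unfolding Q_def by simp
      then show ?thesis
        unfolding ker by (auto simp: R_def kernel_pair_def)
    qed
    ultimately show ?thesis
      using n by (intro exI[of _ "r ` X"] bexI[of _ ?n]) auto
  qed
qed

text \<open>Replacing each value of \<open>w\<close> by a chosen preimage turns \<open>w\<close> into an endomap of the source, so the
  universal property also applies to maps into types outside the category.\<close>

lemma Set_pushout_kernel:
  fixes w :: "'x \<Rightarrow> 'y" and U :: "'u itself"
  assumes universe: "inaccessible_universe U"
    and f: "f \<in> Left (Set_cat U)" and g: "g \<in> Left (Set_cat U)" and po: "is_pushout (Set_cat U) f g p q"
    and w: "\<And>x y. x \<in> source f \<Longrightarrow> y \<in> source f \<Longrightarrow> action f x = action f y \<Longrightarrow> w x = w y"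
      "\<And>x y. x \<in> source f \<Longrightarrow> y \<in> source f \<Longrightarrow> action g x = action g y \<Longrightarrow> w x = w y"
    and xy: "x \<in> source f" "y \<in> source f"
      "action (Comp (Set_cat U) p f) x = action (Comp (Set_cat U) p f) y"
  shows "w x = w y"
proof -
  let ?S = "Set_cat U :: ('x set, ('x set, 'x) typed_map) system_category" and ?X = "source f"
  interpret S: concrete_system U ?S "\<lambda>X. X" action
    by (rule concrete_system_Set[OF universe])
  have X: "small U ?X"
    using is_pushoutD(1)[OF po] by (simp add: Set_arr_def)
  define r where "r x = inv_into ?X w (w x)" for x
  have r: "r x \<in> ?X" "w (r x) = w x" if "x \<in> ?X" for x
    using that unfolding r_def by (auto intro: inv_into_into f_inv_into_f)
  have req: "r x = r y \<longleftrightarrow> w x = w y" if "x \<in> ?X" "y \<in> ?X" for x y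
    using r(2)[OF that(1)] r(2)[OF that(2)] unfolding r_def by metis
  let ?r = "\<lparr>source = ?X, target = ?X, action = restrict r ?X\<rparr>"
  have rh: "?r \<in> Hom ?S ?X ?X"
    using Set_homI[OF X X, of r] r(1) by blast
  have ker: "kernel_pair ?X (action ?r) = kernel_pair ?X w"
    unfolding kernel_pair_def by (auto simp: req)
  have "kernel_pair ?X (action f) \<subseteq> kernel_pair ?X (action ?r)"
    "kernel_pair ?X (action g) \<subseteq> kernel_pair ?X (action ?r)"
    unfolding ker using w unfolding kernel_pair_def by blast+
  then have "kernel_pair ?X (action (Comp ?S p f)) \<subseteq> kernel_pair ?X w"
    using S.pushout_kernel[OF f g po, of ?r ?X] rh ker by simp
  then show ?thesis
    using xy unfolding kernel_pair_def by blast
qed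


section \<open>Abelian groups\<close>

lemma Ab_simps [simp]:
  "Obj (Ab_cat U) = Ab_obj U" "Arr (Ab_cat U) = Ab_arr U"
  "Dom (Ab_cat U) = source" "Cod (Ab_cat U) = target"
  unfolding Ab_cat_def by simp_all

lemma Ab_hom_iff:
  "h \<in> Hom (Ab_cat U) A B \<longleftrightarrow> A \<in> Ab_obj U \<and> B \<in> Ab_obj U \<and> source h = A \<and> target h = B \<and>
     action h \<in> hom A B \<and> action h \<in> extensional (carrier A)"
  unfolding Hom_def by (auto simp: Ab_arr_def)

lemma Ab_homI:
  assumes "A \<in> Ab_obj U" "B \<in> Ab_obj U" "h \<in> hom A B"
  shows "\<lparr>source = A, target = B, action = restrict h (carrier A)\<rparr> \<in> Hom (Ab_cat U) A B"
proof -
  interpret A: comm_group A using assms(1) unfolding Ab_obj_def by simp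
  have "restrict h (carrier A) \<in> hom A B"
    using A.hom_restrict[OF assms(3)] by simp
  then show ?thesis
    using assms unfolding Ab_hom_iff by simp
qed

lemma Ab_comp_action:
  "x \<in> carrier (source f) \<Longrightarrow> action (Comp (Ab_cat U) g f) x = action g (action f x)"
  unfolding Ab_cat_def by (simp add: compose_eq)

lemma Ab_homD:
  assumes "h \<in> Hom (Ab_cat U) A B"
  shows "A \<in> Ab_obj U" "B \<in> Ab_obj U" "source h = A" "target h = B" "action h \<in> hom A B"
    "\<And>x. x \<in> carrier A \<Longrightarrow> action h x \<in> carrier B" "group_hom A B (action h)"
    "comm_group A" "comm_group B" "small U (carrier A)" "small U (carrier B)"
proof -
  show h: "A \<in> Ab_obj U" "B \<in> Ab_obj U" "source h = A" "target h = B" "action h \<in> hom A B"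
    using assms unfolding Ab_hom_iff by auto
  then show "\<And>x. x \<in> carrier A \<Longrightarrow> action h x \<in> carrier B"
    using hom_in_carrier by metis
  show c: "comm_group A" "comm_group B" "small U (carrier A)" "small U (carrier B)"
    using h(1,2) unfolding Ab_obj_def by auto
  show "group_hom A B (action h)"
    using h(5) c comm_group.axioms(2) unfolding group_hom_def group_hom_axioms_def by blast
qed

lemma Ab_comp_hom:
  assumes "f \<in> Hom (Ab_cat U) A B" "g \<in> Hom (Ab_cat U) B D"
  shows "Comp (Ab_cat U) g f \<in> Hom (Ab_cat U) A D"
proof -
  have "Comp (Ab_cat U) g f =
      \<lparr>source = A, target = D, action = restrict (action g \<circ> action f) (carrier A)\<rparr>"
    using Ab_homD(3)[OF assms(1)] Ab_homD(4)[OF assms(2)]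
    unfolding Ab_cat_def by (simp add: compose_def o_def)
  then show ?thesis
    using Ab_homI[OF Ab_homD(1)[OF assms(1)] Ab_homD(2)[OF assms(2)]
      Group.hom_compose[OF Ab_homD(5)[OF assms(1)] Ab_homD(5)[OF assms(2)]]] by simp
qed

lemma Ab_hom_eqI:
  assumes "f \<in> Hom (Ab_cat U) A B" "g \<in> Hom (Ab_cat U) A B"
    "\<And>x. x \<in> carrier A \<Longrightarrow> action f x = action g x"
  shows "f = g"
proof -
  have "action f = action g"
    using assms extensionalityI[of "action f" "carrier A" "action g"] unfolding Ab_hom_iff by blast
  then show ?thesis
    using assms(1,2) unfolding Ab_hom_iff by (simp add: typed_map.equality)
qed

lemma Ab_Left_iff:
  "h \<in> Hom (Ab_cat U) A B \<Longrightarrow> h \<in> Left (Ab_cat U) \<longleftrightarrow> action h ` carrier A = carrier B"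
  unfolding Hom_def by (auto simp: Ab_cat_def)

lemma Ab_Right_iff:
  "h \<in> Hom (Ab_cat U) A B \<Longrightarrow> h \<in> Right (Ab_cat U) \<longleftrightarrow> inj_on (action h) (carrier A)"
  unfolding Hom_def by (auto simp: Ab_cat_def)

lemma Ab_obj_subgroup:
  assumes "A \<in> Ab_obj U" "subgroup H A"
  shows "A\<lparr>carrier := H\<rparr> \<in> Ab_obj U"
proof -
  interpret comm_group A using assms(1) unfolding Ab_obj_def by simp
  have "comm_group (A\<lparr>carrier := H\<rparr>)"
    using group.group_comm_groupI[OF subgroup.subgroup_is_group[OF assms(2) group_axioms]]
      subgroup.mem_carrier[OF assms(2)] m_comm by simp
  moreover have "small U H"
    using small_subset[OF _ subgroup.subset[OF assms(2)], of U] assms(1) unfolding Ab_obj_def by simp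
  ultimately show ?thesis
    unfolding Ab_obj_def by simp
qed

lemma group_hom_eq_iff:
  assumes "group_hom A B h" "x \<in> carrier A" "y \<in> carrier A"
  shows "h x = h y \<longleftrightarrow> x \<otimes>\<^bsub>A\<^esub> inv\<^bsub>A\<^esub> y \<in> kernel A B h"
proof -
  interpret group_hom A B h by fact
  have "h (x \<otimes>\<^bsub>A\<^esub> inv\<^bsub>A\<^esub> y) = h x \<otimes>\<^bsub>B\<^esub> inv\<^bsub>B\<^esub> h y"
    using assms by simp
  moreover have "h x \<otimes>\<^bsub>B\<^esub> inv\<^bsub>B\<^esub> h y = \<one>\<^bsub>B\<^esub> \<longleftrightarrow> h x = h y"
    using assms H.inv_equality H.inv_solve_right' by (metis H.l_one H.one_closed hom_closed)
  ultimately show ?thesis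
    using assms unfolding kernel_def by simp
qed

lemma group_hom_kernel_pair:
  assumes "group_hom A B h"
  shows "kernel_pair (carrier A) h =
    {(x, y). x \<in> carrier A \<and> y \<in> carrier A \<and> x \<otimes>\<^bsub>A\<^esub> inv\<^bsub>A\<^esub> y \<in> kernel A B h}"
  unfolding kernel_pair_def using group_hom_eq_iff[OF assms] by auto

text \<open>A weak group morphism \<open>r\<close> has the cosets of \<open>N\<close> as its fibres.
  \<open>image_group r A\<close> is thus a copy of the quotient by \<open>N\<close> carried by the
  values of \<open>r\<close>, which allows quotients within the element type of
  \<open>A\<close>.\<close>

lemma image_group_Ab_obj:
  assumes A: "A \<in> Ab_obj U" and w: "weak_group_morphism r N A"
  shows "image_group r A \<in> Ab_obj U" "r \<in> hom A (image_group r A)"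
proof -
  interpret A: comm_group A using A unfolding Ab_obj_def by simp
  interpret I: group "image_group r A" by (rule A.image_group_is_group[OF w])
  show r: "r \<in> hom A (image_group r A)" by (rule A.weak_group_morphism_is_hom[OF w])
  have "comm_group (image_group r A)"
  proof (rule I.group_comm_groupI)
    fix x y assume "x \<in> carrier (image_group r A)" "y \<in> carrier (image_group r A)"
    then obtain a b where "a \<in> carrier A" "b \<in> carrier A" "x = r a" "y = r b"
      by (auto simp: image_group_carrier)
    then show "x \<otimes>\<^bsub>image_group r A\<^esub> y = y \<otimes>\<^bsub>image_group r A\<^esub> x"
      using hom_mult[OF r] A.m_comm by metis
  qed
  then show "image_group r A \<in> Ab_obj U"
    using A small_image unfolding Ab_obj_def by (auto simp: image_group_carrier)
qed

lemma concrete_system_Ab: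
  assumes "inaccessible_universe U"
  shows "concrete_system U (Ab_cat U :: ('g monoid, ('g monoid, 'g) typed_map) system_category)
    carrier action"
proof (rule concrete_system.intro)
  let ?A = "Ab_cat U :: ('g monoid, ('g monoid, 'g) typed_map) system_category"
  show "inaccessible_universe U" by fact
  show "Dom ?A f \<in> Obj ?A" "Cod ?A f \<in> Obj ?A" if "f \<in> Arr ?A" for f
    using that by (auto simp: Ab_arr_def)
  show "Id ?A X \<in> Hom ?A X X" if "X \<in> Obj ?A" for X
    using Ab_homI[of X U X "\<lambda>x. x"] that by (simp add: Ab_cat_def hom_def)
  show "Comp ?A g f \<in> Hom ?A X Z" if "f \<in> Hom ?A X Y" "g \<in> Hom ?A Y Z" for f g X Y Z
    using that by (rule Ab_comp_hom)
  show "small U (carrier X)" if "X \<in> Obj ?A" for X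
    using that by (simp add: Ab_obj_def)
  show "action f \<in> carrier X \<rightarrow>\<^sub>E carrier Y" if "f \<in> Hom ?A X Y" for f X Y
    using that Ab_homD(6)[OF that] unfolding Ab_hom_iff PiE_iff by blast
  show "action (Id ?A X) x = x" if "X \<in> Obj ?A" "x \<in> carrier X" for X x
    using that by (simp add: Ab_cat_def)
  show "action (Comp ?A g f) x = action g (action f x)"
    if "f \<in> Hom ?A X Y" "g \<in> Hom ?A Y Z" "x \<in> carrier X" for f g X Y Z x
    using Ab_homD(3)[OF that(1)] that(3) by (simp add: Ab_comp_action)
  show "f = g" if "f \<in> Hom ?A X Y" "g \<in> Hom ?A X Y" "action f = action g" for f g X Y
    using Ab_hom_eqI[OF that(1,2)] that(3) by simp
  show "f \<in> Left ?A \<longleftrightarrow> action f ` carrier X = carrier Y" if "f \<in> Hom ?A X Y" for f X Y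
    using that by (rule Ab_Left_iff)
  show "f \<in> Right ?A \<longleftrightarrow> inj_on (action f) (carrier X)" if "f \<in> Hom ?A X Y" for f X Y
    using that by (rule Ab_Right_iff)
  show "Left ?A \<subseteq> Arr ?A" "Right ?A \<subseteq> Arr ?A"
    by (auto simp: Ab_cat_def)
  show "\<exists>h \<in> Hom ?A X Y. Comp ?A f h = g"
    if fR: "f \<in> Right ?A" and f: "f \<in> Hom ?A Y Z" and g: "g \<in> Hom ?A X Z"
      and sub: "action g ` carrier X \<subseteq> action f ` carrier Y" for f g X Y Z
  proof -
    interpret F: group_hom Y Z "action f" by (rule Ab_homD(7)[OF f])
    interpret G: group_hom X Z "action g" by (rule Ab_homD(7)[OF g])
    let ?a = "\<lambda>x. inv_into (carrier Y) (action f) (action g x)"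
    let ?h = "\<lparr>source = X, target = Y, action = restrict ?a (carrier X)\<rparr>"
    have inj: "inj_on (action f) (carrier Y)" using fR Ab_Right_iff[OF f] by blast
    have a: "?a x \<in> carrier Y" "action f (?a x) = action g x" if "x \<in> carrier X" for x
    proof -
      have "action g x \<in> action f ` carrier Y" using that sub by blast
      then show "?a x \<in> carrier Y" "action f (?a x) = action g x"
        by (rule inv_into_into, rule f_inv_into_f)
    qed
    \<comment> \<open>The two sides of the homomorphism law have the same image under the injective
      \<open>action f\<close>.\<close>
    have "?a \<in> hom X Y"
    proof (rule homI)
      fix x y assume xy: "x \<in> carrier X" "y \<in> carrier X"
      have "action f (?a (x \<otimes>\<^bsub>X\<^esub> y)) = action f (?a x \<otimes>\<^bsub>Y\<^esub> ?a y)"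
        using a(2)[OF G.m_closed[OF xy]] a[OF xy(1)] a[OF xy(2)] xy by simp
      then show "?a (x \<otimes>\<^bsub>X\<^esub> y) = ?a x \<otimes>\<^bsub>Y\<^esub> ?a y"
        by (rule inj_onD[OF inj]) (use a(1)[OF G.m_closed[OF xy]] a(1)[OF xy(1)] a(1)[OF xy(2)] in auto)
    qed (rule a(1))
    then have h: "?h \<in> Hom ?A X Y"
      using Ab_homI[OF Ab_homD(1)[OF g] Ab_homD(1)[OF f]] by blast
    moreover have "Comp ?A f ?h = g"
      by (rule Ab_hom_eqI[OF Ab_comp_hom[OF h f] g]) (simp add: Ab_comp_action a(2))
    ultimately show ?thesis by blast
  qed
  show "\<exists>h \<in> Hom ?A Y Z. Comp ?A h e = g"
    if eL: "e \<in> Left ?A" and e: "e \<in> Hom ?A X Y" and g: "g \<in> Hom ?A X Z"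
      and sub: "kernel_pair (carrier X) (action e) \<subseteq> kernel_pair (carrier X) (action g)" for e g X Y Z
  proof -
    interpret E: group_hom X Y "action e" by (rule Ab_homD(7)[OF e])
    interpret G: group_hom X Z "action g" by (rule Ab_homD(7)[OF g])
    let ?i = "inv_into (carrier X) (action e)"
    let ?h = "\<lparr>source = Y, target = Z, action = restrict (\<lambda>y. action g (?i y)) (carrier Y)\<rparr>"
    have s: "action e ` carrier X = carrier Y" using eL Ab_Left_iff[OF e] by blast
    have i: "?i y \<in> carrier X" "action e (?i y) = y" if "y \<in> carrier Y" for y
      using that s inv_into_into[of y "action e" "carrier X"] f_inv_into_f[of y "action e" "carrier X"]
      by auto
    \<comment> \<open>The chosen preimage does not matter: two preimages of one element are
      identified by \<open>e\<close>, hence by \<open>g\<close>.\<close>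
    have gi: "action g (?i (action e x)) = action g x" if x: "x \<in> carrier X" for x
    proof -
      have "(?i (action e x), x) \<in> kernel_pair (carrier X) (action e)"
        using i[OF E.hom_closed[OF x]] x unfolding kernel_pair_def by simp
      then show ?thesis
        using sub unfolding kernel_pair_def by blast
    qed
    have "(\<lambda>y. action g (?i y)) \<in> hom Y Z"
    proof (rule homI)
      fix x y assume xy: "x \<in> carrier Y" "y \<in> carrier Y"
      then have "action g (?i (action e (?i x \<otimes>\<^bsub>X\<^esub> ?i y))) = action g (?i x \<otimes>\<^bsub>X\<^esub> ?i y)"
        using gi[OF E.G.m_closed[OF i(1) i(1)]] by blast
      then show "action g (?i (x \<otimes>\<^bsub>Y\<^esub> y)) = action g (?i x) \<otimes>\<^bsub>Z\<^esub> action g (?i y)"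
        using xy i by simp
    qed (use i in simp)
    then have h: "?h \<in> Hom ?A Y Z"
      using Ab_homI[OF Ab_homD(2)[OF e] Ab_homD(2)[OF g]] by blast
    moreover have "Comp ?A ?h e = g"
      by (rule Ab_hom_eqI[OF Ab_comp_hom[OF e h] g])
        (simp add: Ab_comp_action Ab_homD(3)[OF e] gi)
    ultimately show ?thesis by blast
  qed
  \<comment> \<open>Serves both the image factorization and the intersection: a subgroup becomes an
    object by shrinking the carrier, with inclusion as an arrow of the right class.\<close>
  have inclusion: "\<lparr>source = Y\<lparr>carrier := H\<rparr>, target = Y, action = restrict (\<lambda>z. z) H\<rparr>
      \<in> Right ?A \<inter> Hom ?A (Y\<lparr>carrier := H\<rparr>) Y"
    if Y: "Y \<in> Ab_obj U" and H: "subgroup H Y" for Y and H :: "'g set"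
  proof -
    have "(\<lambda>z. z) \<in> hom (Y\<lparr>carrier := H\<rparr>) Y"
      using subgroup.mem_carrier[OF H] by (simp add: hom_def Pi_iff)
    then have m: "\<lparr>source = Y\<lparr>carrier := H\<rparr>, target = Y, action = restrict (\<lambda>z. z) H\<rparr>
        \<in> Hom ?A (Y\<lparr>carrier := H\<rparr>) Y"
      using Ab_homI[OF Ab_obj_subgroup[OF Y H] Y] by simp
    then show ?thesis
      using Ab_Right_iff[OF m] by (simp add: inj_on_def)
  qed
  show "\<exists>Z. \<exists>e \<in> Left ?A \<inter> Hom ?A X Z. \<exists>m \<in> Right ?A \<inter> Hom ?A Z Y. f = Comp ?A m e"
    if f: "f \<in> Hom ?A X Y" for f X Y
  proof -
    note F = Ab_homD[OF f]
    interpret F: group_hom X Y "action f" by (rule F(7))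
    let ?H = "action f ` carrier X"
    let ?Z = "Y\<lparr>carrier := ?H\<rparr>"
    let ?e = "\<lparr>source = X, target = ?Z, action = restrict (action f) (carrier X)\<rparr>"
    let ?m = "\<lparr>source = ?Z, target = Y, action = restrict (\<lambda>z. z) ?H\<rparr>"
    have H: "subgroup ?H Y"
      by (rule F.img_is_subgroup)
    have "action f \<in> hom X ?Z"
      using F.hom_mult by (simp add: hom_def)
    then have e: "?e \<in> Hom ?A X ?Z"
      using Ab_homI[OF F(1) Ab_obj_subgroup[OF F(2) H]] by blast
    have m: "?m \<in> Right ?A" "?m \<in> Hom ?A ?Z Y"
      using inclusion[OF F(2) H] by auto
    have "f = Comp ?A ?m ?e"
      by (rule Ab_hom_eqI[OF f Ab_comp_hom[OF e m(2)]]) (simp add: Ab_comp_action)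
    moreover have "?e \<in> Left ?A"
      using Ab_Left_iff[OF e] by simp
    ultimately show ?thesis
      using e m by blast
  qed
  show "\<exists>W. \<exists>n \<in> Right ?A \<inter> Hom ?A W Z.
      action n ` carrier W = action f ` carrier X \<inter> action g ` carrier Y"
    if f: "f \<in> Hom ?A X Z" and g: "g \<in> Hom ?A Y Z" for f g X Y Z
  proof -
    interpret F: group_hom X Z "action f" by (rule Ab_homD(7)[OF f])
    interpret G: group_hom Y Z "action g" by (rule Ab_homD(7)[OF g])
    let ?H = "action f ` carrier X \<inter> action g ` carrier Y"
    have H: "subgroup ?H Z"
      using F.H.subgroups_Inter_pair F.img_is_subgroup G.img_is_subgroup by blast
    have "action \<lparr>source = Z\<lparr>carrier := ?H\<rparr>, target = Z, action = restrict (\<lambda>z. z) ?H\<rparr>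
        ` carrier (Z\<lparr>carrier := ?H\<rparr>) = ?H"
      by simp
    then show ?thesis
      using inclusion[OF Ab_homD(2)[OF f] H] by blast
  qed
  show "\<exists>W. \<exists>n \<in> Left ?A \<inter> Hom ?A X W.
             kernel_pair (carrier X) (action f) \<subseteq> kernel_pair (carrier X) (action n) \<and>
             kernel_pair (carrier X) (action g) \<subseteq> kernel_pair (carrier X) (action n) \<and>
             (\<forall>V. \<forall>w \<in> Hom ?A X V.
                kernel_pair (carrier X) (action f) \<subseteq> kernel_pair (carrier X) (action w) \<longrightarrow>
                kernel_pair (carrier X) (action g) \<subseteq> kernel_pair (carrier X) (action w) \<longrightarrow>
                kernel_pair (carrier X) (action n) \<subseteq> kernel_pair (carrier X) (action w))"
    if f: "f \<in> Hom ?A X Y" and g: "g \<in> Hom ?A X Z" for f g X Y Z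
  proof -
    interpret F: group_hom X Y "action f" by (rule Ab_homD(7)[OF f])
    interpret G: group_hom X Z "action g" by (rule Ab_homD(7)[OF g])
    interpret X: comm_group X by (rule Ab_homD(8)[OF f])
    \<comment> \<open>The product set is the subgroup generated by the two kernels, so any
      homomorphism trivial on both is trivial on \<open>N\<close>.\<close>
    define N where "N = kernel X Y (action f) <#>\<^bsub>X\<^esub> kernel X Z (action g)"
    have N: "subgroup N X"
      unfolding N_def by (rule X.mult_subgroups[OF F.subgroup_kernel G.subgroup_kernel])
    have KN: "kernel X Y (action f) \<subseteq> N" "kernel X Z (action g) \<subseteq> N"
    proof -
      have "x \<otimes>\<^bsub>X\<^esub> \<one>\<^bsub>X\<^esub> \<in> N" if "x \<in> kernel X Y (action f)" for x
        using that subgroup.one_closed[OF G.subgroup_kernel] unfolding N_def set_mult_def by blast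
      then show "kernel X Y (action f) \<subseteq> N"
        by (auto simp: kernel_def)
      have "\<one>\<^bsub>X\<^esub> \<otimes>\<^bsub>X\<^esub> x \<in> N" if "x \<in> kernel X Z (action g)" for x
        using that subgroup.one_closed[OF F.subgroup_kernel] unfolding N_def set_mult_def by blast
      then show "kernel X Z (action g) \<subseteq> N"
        by (auto simp: kernel_def)
    qed
    \<comment> \<open>\<open>r x\<close> depends only on the coset of \<open>x\<close> and lies in
      it, so its values represent the quotient by \<open>N\<close> with elements taken from
      \<open>X\<close>.\<close>
    define r where "r x = (SOME y. y \<in> N #>\<^bsub>X\<^esub> x)" for x
    have rc: "r x \<in> N #>\<^bsub>X\<^esub> x" if "x \<in> carrier X" for x
      using F.G.rcos_self[OF that N] unfolding r_def by (rule someI)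
    have req: "r x = r y \<longleftrightarrow> x \<otimes>\<^bsub>X\<^esub> inv\<^bsub>X\<^esub> y \<in> N" if xy: "x \<in> carrier X" "y \<in> carrier X" for x y
    proof
      assume "r x = r y"
      then have "N #>\<^bsub>X\<^esub> x = N #>\<^bsub>X\<^esub> y"
        using F.G.repr_independence[OF rc[OF xy(1)] xy(1) N] F.G.repr_independence[OF rc[OF xy(2)] xy(2) N]
        by simp
      then have "x \<in> N #>\<^bsub>X\<^esub> y"
        using F.G.rcos_self[OF xy(1) N] by simp
      then show "x \<otimes>\<^bsub>X\<^esub> inv\<^bsub>X\<^esub> y \<in> N"
        using subgroup.rcos_module_imp[OF N F.G.group_axioms xy(2)] by blast
    next
      assume "x \<otimes>\<^bsub>X\<^esub> inv\<^bsub>X\<^esub> y \<in> N"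
      then have "x \<in> N #>\<^bsub>X\<^esub> y"
        using subgroup.rcos_module_rev[OF N F.G.group_axioms xy(2,1)] by blast
      then show "r x = r y"
        using F.G.repr_independence[OF _ xy(2) N] unfolding r_def by simp
    qed
    have wm: "weak_group_morphism r N X"
      using weak_group_morphismsI[OF X.subgroup_imp_normal[OF N]] req by blast
    note W = image_group_Ab_obj[OF Ab_homD(1)[OF f] wm]
    let ?W = "image_group r X"
    let ?n = "\<lparr>source = X, target = ?W, action = restrict r (carrier X)\<rparr>"
    have n: "?n \<in> Hom ?A X ?W"
      by (rule Ab_homI[OF Ab_homD(1)[OF f] W])
    have ker: "kernel_pair (carrier X) (action ?n) =
        {(x, y). x \<in> carrier X \<and> y \<in> carrier X \<and> x \<otimes>\<^bsub>X\<^esub> inv\<^bsub>X\<^esub> y \<in> N}"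
      unfolding kernel_pair_def by (auto simp: req)
    have "?n \<in> Left ?A"
      using Ab_Left_iff[OF n] by (simp add: image_group_carrier)
    moreover have "kernel_pair (carrier X) (action f) \<subseteq> kernel_pair (carrier X) (action ?n)"
      unfolding ker group_hom_kernel_pair[OF Ab_homD(7)[OF f]] using KN by auto
    moreover have "kernel_pair (carrier X) (action g) \<subseteq> kernel_pair (carrier X) (action ?n)"
      unfolding ker group_hom_kernel_pair[OF Ab_homD(7)[OF g]] using KN by auto
    moreover have "kernel_pair (carrier X) (action ?n) \<subseteq> kernel_pair (carrier X) (action w)"
      if w: "w \<in> Hom ?A X V"
        and le: "kernel_pair (carrier X) (action f) \<subseteq> kernel_pair (carrier X) (action w)"
          "kernel_pair (carrier X) (action g) \<subseteq> kernel_pair (carrier X) (action w)" for w V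
    proof -
      interpret W: group_hom X V "action w" by (rule Ab_homD(7)[OF w])
      have "action w x = \<one>\<^bsub>V\<^esub>" if "x \<in> kernel X Y (action f) \<union> kernel X Z (action g)" for x
      proof -
        have "(x, \<one>\<^bsub>X\<^esub>) \<in> kernel_pair (carrier X) (action f) \<union> kernel_pair (carrier X) (action g)"
          using that unfolding kernel_def kernel_pair_def by auto
        then have "(x, \<one>\<^bsub>X\<^esub>) \<in> kernel_pair (carrier X) (action w)"
          using le by blast
        then show ?thesis unfolding kernel_pair_def by simp
      qed
      then have "N \<subseteq> kernel X V (action w)"
        unfolding N_def set_mult_def by (auto simp: kernel_def)
      then show ?thesis
        unfolding ker group_hom_kernel_pair[OF Ab_homD(7)[OF w]] by auto
    qed
    ultimately show ?thesis
      using n by (intro exI[of _ ?W] bexI[of _ ?n]) auto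
  qed
qed

section \<open>From noetherian forms to sets\<close>

text \<open>The order of the fibres and the maps \<open>f\<^sup>*\<close> are forgotten.
  \<open>Im f\<close> and \<open>Ker f\<close> survive as the image and the kernel pair of
  \<open>f\<^sub>!\<close>.\<close>

definition fibre_functor ::
  "('o, 'a, 'm) category_scheme \<Rightarrow> ('o, 'a, 'u) form \<Rightarrow> ('o, 'a, 'u set, ('u set, 'u) typed_map) functor_data"
  where "fibre_functor C F =
    \<lparr>on_obj = (\<lambda>X. carrier (fibre F X)),
     on_arr = (\<lambda>f. \<lparr>source = carrier (fibre F (Dom C f)), target = carrier (fibre F (Cod C f)),
       action = restrict (direct F f) (carrier (fibre F (Dom C f)))\<rparr>)\<rparr>"

text \<open>(N3) acts in two ways: a conormal meet provides an arrow bounding the image of the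
  pullback from below, and a normal join provides one bounding the kernel of the pushout from above.
  For pushouts in \<open>Set\<close> a comparison of kernel elements is not enough, since
  equivalence relations on the fibre have to be compared.\<close>

lemma transfer_functor_fibre:
  fixes C :: "('o, 'a, 'm) system_category_scheme" and F :: "('o, 'a, 'u) form" and U :: "'u itself"
  assumes universe: "inaccessible_universe U" and C: "transfer_category U C"
    and F: "noetherian_form U C F" and ind: "induces_system F C"
  shows "transfer_functor U C (Set_cat U) (fibre_functor C F)"
proof -
  interpret C: transfer_category U C by (rule C)
  interpret F: noetherian_form U C F by (rule F)
  let ?S = "Set_cat U :: ('u set, ('u set, 'u) typed_map) system_category" and ?V = "fibre_functor C F"
  interpret S: concrete_system U ?S "\<lambda>X. X" action
    by (rule concrete_system_Set[OF universe])
  have con: "image_kernel_connection (fibre F X) (fibre F Y) (direct F f) (inverse_im F f)"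
    if f: "f \<in> Hom C X Y" for f X Y
  proof -
    have X: "X \<in> Obj C" and Y: "Y \<in> Obj C" and d: "Dom C f = X" "Cod C f = Y"
      using HomD[OF f] C.dom_obj C.cod_obj by auto
    interpret A: bounded_lattice "fibre F X" by (rule F.bounded_fibre[OF X])
    interpret B: bounded_lattice "fibre F Y" by (rule F.bounded_fibre[OF Y])
    note g = F.adjunction[OF f, unfolded galois_connection_def connection_def
        galois_connection_axioms_def, simplified]
    show ?thesis
      by unfold_locales
        (use g F.N1_inverse[OF f] F.N1_direct[OF f] d in
          \<open>auto simp: Pi_iff ker_cluster_def im_cluster_def\<close>)
  qed
  have im: "im_cluster C F f = direct F f \<top>\<^bsub>fibre F X\<^esub>"
    and ker: "ker_cluster C F f = inverse_im F f \<bottom>\<^bsub>fibre F Y\<^esub>" if "f \<in> Hom C X Y" for f X Y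
    using HomD[OF that] unfolding im_cluster_def ker_cluster_def by auto
  have imc: "im_cluster C F f \<in> carrier (fibre F Y)" and kerc: "ker_cluster C F f \<in> carrier (fibre F X)"
    if f: "f \<in> Hom C X Y" for f X Y
    unfolding im[OF f] ker[OF f]
    using image_kernel_connection.im_closed[OF con[OF f]] image_kernel_connection.ker_closed[OF con[OF f]]
    by auto
  have top: "\<top>\<^bsub>fibre F X\<^esub> \<in> carrier (fibre F X)" and bot: "\<bottom>\<^bsub>fibre F X\<^esub> \<in> carrier (fibre F X)"
    if X: "X \<in> Obj C" for X
  proof -
    interpret bounded_lattice "fibre F X" by (rule F.bounded_fibre[OF X])
    show "\<top>\<^bsub>fibre F X\<^esub> \<in> carrier (fibre F X)" "\<bottom>\<^bsub>fibre F X\<^esub> \<in> carrier (fibre F X)" by auto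
  qed
  have im_comp: "im_cluster C F (Comp C g f) = direct F g (im_cluster C F f)"
    and ker_comp: "ker_cluster C F (Comp C g f) = inverse_im F f (ker_cluster C F g)"
    if f: "f \<in> Hom C X Y" and g: "g \<in> Hom C Y Z" for f g X Y Z
  proof -
    have "X \<in> Obj C" "Z \<in> Obj C" using HomD[OF f] HomD[OF g] C.dom_obj C.cod_obj by auto
    then show "im_cluster C F (Comp C g f) = direct F g (im_cluster C F f)"
      "ker_cluster C F (Comp C g f) = inverse_im F f (ker_cluster C F g)"
      using im[OF C.comp_hom[OF f g]] im[OF f] ker[OF C.comp_hom[OF f g]] ker[OF g]
        F.direct_comp[OF f g top] F.inverse_comp[OF f g bot] by simp_all
  qed
  have im_comp_le: "im_cluster C F (Comp C g f) \<sqsubseteq>\<^bsub>fibre F Z\<^esub> im_cluster C F g"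
    if f: "f \<in> Hom C X Y" and g: "g \<in> Hom C Y Z" for f g X Y Z
    unfolding im_comp[OF f g] im[OF g]
    by (rule image_kernel_connection.l_le_im[OF con[OF g] imc[OF f]])
  have ker_comp_ge: "ker_cluster C F f \<sqsubseteq>\<^bsub>fibre F X\<^esub> ker_cluster C F (Comp C g f)"
    if f: "f \<in> Hom C X Y" and g: "g \<in> Hom C Y Z" for f g X Y Z
    unfolding ker_comp[OF f g] ker[OF f]
    by (rule image_kernel_connection.ker_le_u[OF con[OF f] kerc[OF g]])
  have im_id: "im_cluster C F (Id C X) = \<top>\<^bsub>fibre F X\<^esub>"
    and ker_id: "ker_cluster C F (Id C X) = \<bottom>\<^bsub>fibre F X\<^esub>" if X: "X \<in> Obj C" for X
    using im[OF C.id_hom[OF X]] ker[OF C.id_hom[OF X]] F.direct_id[OF X top[OF X]]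
      F.inverse_id[OF X bot[OF X]] by auto
  have emb: "embedding_of C F (Cod C m) (im_cluster C F m) m" if "m \<in> Right C" for m
    using that ind unfolding induces_system_def embedding_of_def by auto
  have quo: "quotient_of C F (Dom C e) (ker_cluster C F e) e" if "e \<in> Left C" for e
    using that ind unfolding induces_system_def quotient_of_def by auto
  have embR: "m \<in> Right C" if "embedding_of C F X S m" for X S m
  proof -
    have "X \<in> Obj C" using that C.cod_obj unfolding embedding_of_def by blast
    then show ?thesis using that ind unfolding induces_system_def by auto
  qed
  have quoL: "e \<in> Left C" if "quotient_of C F X K e" for X K e
  proof -
    have "X \<in> Obj C" using that C.dom_obj unfolding quotient_of_def by blast
    then show ?thesis using that ind unfolding induces_system_def by auto
  qed
  have lift: "\<exists>h \<in> Hom C Z Y. f = Comp C m h"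
    if "m \<in> Right C" "m \<in> Hom C Y X" "f \<in> Hom C Z X"
      "im_cluster C F f \<sqsubseteq>\<^bsub>fibre F X\<^esub> im_cluster C F m" for f m X Y Z
    using emb[OF that(1)] HomD[OF that(2)] HomD[OF that(3)] that(4) unfolding embedding_of_def by metis
  have desc: "\<exists>h \<in> Hom C Y Z. f = Comp C h e"
    if "e \<in> Left C" "e \<in> Hom C X Y" "f \<in> Hom C X Z"
      "ker_cluster C F e \<sqsubseteq>\<^bsub>fibre F X\<^esub> ker_cluster C F f" for f e X Y Z
    using quo[OF that(1)] HomD[OF that(2)] HomD[OF that(3)] that(4) unfolding quotient_of_def by metis
  have fac: "\<exists>Z e m. e \<in> Left C \<and> m \<in> Right C \<and> e \<in> Hom C X Z \<and> m \<in> Hom C Z Y \<and> f = Comp C m e \<and>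
      im_cluster C F m = im_cluster C F f \<and> ker_cluster C F e = ker_cluster C F f"
    if f: "f \<in> Hom C X Y" for f X Y
  proof -
    obtain e m where em: "quotient_of C F X (ker_cluster C F f) e" "embedding_of C F Y (im_cluster C F f) m"
      "Cod C e = Dom C m" "f = Comp C m e"
      using F.N2[OF f] by blast
    have "e \<in> Hom C X (Dom C m)" "m \<in> Hom C (Dom C m) Y"
      "im_cluster C F m = im_cluster C F f" "ker_cluster C F e = ker_cluster C F f"
      using em(1-3) unfolding quotient_of_def embedding_of_def Hom_def by auto
    then show ?thesis
      using quoL[OF em(1)] embR[OF em(2)] em(4) by blast
  qed
  \<comment> \<open>In the factorization \<open>e = m e'\<close> of (N2) the arrow \<open>e'\<close>
    has the kernel of \<open>e\<close>, so \<open>e' = h e\<close>. Cancelling \<open>e\<close>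
    gives \<open>m h = id\<close>, and the common image of \<open>e\<close> and \<open>m\<close> is
    everything.\<close>
  have left_im: "im_cluster C F e = \<top>\<^bsub>fibre F Y\<^esub>" if eL: "e \<in> Left C" and e: "e \<in> Hom C X Y" for e X Y
  proof -
    have Y: "Y \<in> Obj C" and X: "X \<in> Obj C" using HomD[OF e] C.cod_obj C.dom_obj by auto
    interpret B: bounded_lattice "fibre F Y" by (rule F.bounded_fibre[OF Y])
    interpret A: bounded_lattice "fibre F X" by (rule F.bounded_fibre[OF X])
    obtain Z e' m where fm: "e' \<in> Hom C X Z" "m \<in> Hom C Z Y" "e = Comp C m e'"
      "im_cluster C F m = im_cluster C F e" "ker_cluster C F e' = ker_cluster C F e"
      using fac[OF e] by blast
    obtain h where h: "h \<in> Hom C Y Z" "e' = Comp C h e"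
      using desc[OF eL e fm(1)] fm(5) kerc[OF e] by auto
    have "Comp C (Comp C m h) e = Comp C (Id C Y) e"
      using C.comp_assoc[OF e h(1) fm(2)] h(2)[symmetric] fm(3)[symmetric] C.id_comp[OF e] by simp
    then have "Comp C m h = Id C Y"
      using C.epi_cancel[OF C.left_epi[OF eL] e C.comp_hom[OF h(1) fm(2)] C.id_hom[OF Y]] by blast
    then have "\<top>\<^bsub>fibre F Y\<^esub> \<sqsubseteq>\<^bsub>fibre F Y\<^esub> im_cluster C F e"
      using im_comp_le[OF h(1) fm(2)] im_id[OF Y] fm(4) by simp
    then show ?thesis
      using imc[OF e] B.le_antisym B.top_higher by simp
  qed
  \<comment> \<open>Dually, \<open>m = n e\<close> with equal images gives \<open>n = m h\<close>.
    Cancelling \<open>m\<close> yields \<open>h e = id\<close>, so the common kernel of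
    \<open>e\<close> and \<open>m\<close> is bottom.\<close>
  have right_ker: "ker_cluster C F m = \<bottom>\<^bsub>fibre F X\<^esub>" if mR: "m \<in> Right C" and m: "m \<in> Hom C X Y" for m X Y
  proof -
    have Y: "Y \<in> Obj C" and X: "X \<in> Obj C" using HomD[OF m] C.cod_obj C.dom_obj by auto
    interpret B: bounded_lattice "fibre F Y" by (rule F.bounded_fibre[OF Y])
    interpret A: bounded_lattice "fibre F X" by (rule F.bounded_fibre[OF X])
    obtain Z e n where fm: "e \<in> Hom C X Z" "n \<in> Hom C Z Y" "m = Comp C n e"
      "im_cluster C F n = im_cluster C F m" "ker_cluster C F e = ker_cluster C F m"
      using fac[OF m] by blast
    obtain h where h: "h \<in> Hom C Z X" "n = Comp C m h"
      using lift[OF mR m fm(2)] fm(4) imc[OF m] by auto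
    have "Comp C m (Comp C h e) = Comp C m (Id C X)"
      using C.comp_assoc[OF fm(1) h(1) m] h(2)[symmetric] fm(3)[symmetric] C.comp_id[OF m] by simp
    then have "Comp C h e = Id C X"
      using C.mono_cancel[OF C.right_mono[OF mR] m C.comp_hom[OF fm(1) h(1)] C.id_hom[OF X]] by blast
    then have "ker_cluster C F m \<sqsubseteq>\<^bsub>fibre F X\<^esub> \<bottom>\<^bsub>fibre F X\<^esub>"
      using ker_comp_ge[OF fm(1) h(1)] ker_id[OF X] fm(5) by simp
    then show ?thesis
      using kerc[OF m] A.le_antisym A.bottom_lower by simp
  qed
  \<comment> \<open>A full image lets the identity of \<open>Y\<close> lift through the embedding
    factor, and a trivial kernel lets the identity of \<open>X\<close> descend along the quotient
    factor, so both factors are invertible.\<close>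
  have iso: "iso_arrow C f" if f: "f \<in> Hom C X Y"
    and t: "im_cluster C F f = \<top>\<^bsub>fibre F Y\<^esub>" and b: "ker_cluster C F f = \<bottom>\<^bsub>fibre F X\<^esub>" for f X Y
  proof -
    have Y: "Y \<in> Obj C" and X: "X \<in> Obj C" using HomD[OF f] C.cod_obj C.dom_obj by auto
    interpret B: bounded_lattice "fibre F Y" by (rule F.bounded_fibre[OF Y])
    interpret A: bounded_lattice "fibre F X" by (rule F.bounded_fibre[OF X])
    obtain Z e m where fm: "e \<in> Left C" "m \<in> Right C" "e \<in> Hom C X Z" "m \<in> Hom C Z Y" "f = Comp C m e"
      "im_cluster C F m = im_cluster C F f" "ker_cluster C F e = ker_cluster C F f"
      using fac[OF f] by blast
    obtain s where s: "s \<in> Hom C Y Z" "Id C Y = Comp C m s"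
      using lift[OF fm(2,4) C.id_hom[OF Y]] fm(6) t im_id[OF Y] by auto
    obtain r where r: "r \<in> Hom C Z X" "Id C X = Comp C r e"
      using desc[OF fm(1,3) C.id_hom[OF X]] fm(7) b ker_id[OF X] by auto
    have "iso_arrow C m"
      using C.mono_retraction_iso[OF C.right_mono[OF fm(2)] fm(4) s(1) s(2)[symmetric]] .
    moreover have "iso_arrow C e"
      using C.epi_section_iso[OF C.left_epi[OF fm(1)] fm(3) r(1) r(2)[symmetric]] .
    ultimately show ?thesis
      using C.iso_arrow_comp[of e m] HomD[OF fm(3)] HomD[OF fm(4)] fm(5) by simp
  qed
  have Vobj: "on_obj ?V X = carrier (fibre F X)" for X
    unfolding fibre_functor_def by simp
  have Vhom: "on_arr ?V f \<in> Hom ?S (carrier (fibre F X)) (carrier (fibre F Y))"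
    and Vact: "\<And>x. x \<in> carrier (fibre F X) \<Longrightarrow> action (on_arr ?V f) x = direct F f x"
    if f: "f \<in> Hom C X Y" for f X Y
  proof -
    have d: "Dom C f = X" "Cod C f = Y" and X: "X \<in> Obj C" and Y: "Y \<in> Obj C"
      using HomD[OF f] C.cod_obj C.dom_obj by auto
    show "on_arr ?V f \<in> Hom ?S (carrier (fibre F X)) (carrier (fibre F Y))"
      using Set_homI[OF F.small_fibre[OF X] F.small_fibre[OF Y] image_kernel_connection.l_closed[OF con[OF f]]]
      unfolding fibre_functor_def by (simp add: d)
    show "action (on_arr ?V f) x = direct F f x" if "x \<in> carrier (fibre F X)" for x
      using that unfolding fibre_functor_def by (simp add: d)
  qed
  have Vcomp: "on_arr ?V (Comp C g f) = Comp ?S (on_arr ?V g) (on_arr ?V f)"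
    if f: "f \<in> Hom C X Y" and g: "g \<in> Hom C Y Z" for f g X Y Z
  proof (rule Set_hom_eqI[OF Vhom[OF C.comp_hom[OF f g]] Set_comp_hom[OF Vhom[OF f] Vhom[OF g]]])
    fix x assume x: "x \<in> carrier (fibre F X)"
    then show "action (on_arr ?V (Comp C g f)) x = action (Comp ?S (on_arr ?V g) (on_arr ?V f)) x"
      using Vact[OF C.comp_hom[OF f g]] Vact[OF f] Vact[OF g] F.direct_comp[OF f g]
        image_kernel_connection.l_closed[OF con[OF f]] Set_homD(3)[OF Vhom[OF f]]
      by (simp add: Set_comp_action)
  qed
  have fct: "is_functor C ?S ?V"
    unfolding is_functor_def Vobj
  proof (intro conjI ballI impI)
    fix X assume X: "X \<in> Obj C"
    then show "carrier (fibre F X) \<in> Obj ?S"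
      using F.small_fibre by simp
    show "on_arr ?V (Id C X) = Id ?S (carrier (fibre F X))"
      using Set_hom_eqI[OF Vhom[OF C.id_hom[OF X]] S.id_hom] Vact[OF C.id_hom[OF X]] F.small_fibre[OF X]
        F.direct_id[OF X] S.act_id by simp
  next
    show "on_arr ?V f \<in> Hom ?S (carrier (fibre F (Dom C f))) (carrier (fibre F (Cod C f)))"
      if "f \<in> Arr C" for f
      using Vhom[OF arr_hom[OF that]] .
    fix f g assume "f \<in> Arr C" "g \<in> Arr C" "Cod C f = Dom C g"
    then show "on_arr ?V (Comp C g f) = Comp ?S (on_arr ?V g) (on_arr ?V f)"
      using Vcomp[of f "Dom C f" "Dom C g" g "Cod C g"] unfolding Hom_def by simp
  qed
  have Vsurj: "action (on_arr ?V f) ` carrier (fibre F X) = carrier (fibre F Y) \<longleftrightarrow>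
      im_cluster C F f = \<top>\<^bsub>fibre F Y\<^esub>"
    and Vinj: "inj_on (action (on_arr ?V f)) (carrier (fibre F X)) \<longleftrightarrow>
      ker_cluster C F f = \<bottom>\<^bsub>fibre F X\<^esub>" if f: "f \<in> Hom C X Y" for f X Y
  proof -
    have "action (on_arr ?V f) ` carrier (fibre F X) = direct F f ` carrier (fibre F X)"
      by (rule image_cong[OF refl Vact[OF f]])
    then show "action (on_arr ?V f) ` carrier (fibre F X) = carrier (fibre F Y) \<longleftrightarrow>
        im_cluster C F f = \<top>\<^bsub>fibre F Y\<^esub>"
      using image_kernel_connection.surj_iff[OF con[OF f]] im[OF f] by simp
    have "inj_on (action (on_arr ?V f)) (carrier (fibre F X)) \<longleftrightarrow> inj_on (direct F f) (carrier (fibre F X))"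
      by (rule inj_on_cong[OF Vact[OF f]])
    then show "inj_on (action (on_arr ?V f)) (carrier (fibre F X)) \<longleftrightarrow>
        ker_cluster C F f = \<bottom>\<^bsub>fibre F X\<^esub>"
      using image_kernel_connection.inj_iff[OF con[OF f]] ker[OF f] by simp
  qed
  have VL: "on_arr ?V e \<in> Left ?S" if eL: "e \<in> Left C" for e
  proof -
    have e: "e \<in> Hom C (Dom C e) (Cod C e)" using eL C.left_arr arr_hom[of e C] by auto
    show ?thesis
      using Set_Left_iff[OF Vhom[OF e]] Vsurj[OF e] left_im[OF eL e] by blast
  qed
  have VR: "on_arr ?V m \<in> Right ?S" if mR: "m \<in> Right C" for m
  proof -
    have m: "m \<in> Hom C (Dom C m) (Cod C m)" using mR C.right_arr arr_hom[of m C] by auto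
    show ?thesis
      using Set_Right_iff[OF Vhom[OF m]] Vinj[OF m] right_ker[OF mR m] by blast
  qed
  have "conservative C ?S ?V"
    unfolding conservative_def
  proof (intro ballI impI)
    fix f assume fA: "f \<in> Arr C" and i: "iso_arrow ?S (on_arr ?V f)"
    note f = arr_hom[OF fA]
    have "on_arr ?V f \<in> Left ?S" "on_arr ?V f \<in> Right ?S"
      using S.iso_iff[OF Vhom[OF f]] i by auto
    then show "iso_arrow C f"
      using iso[OF f] Set_Left_iff[OF Vhom[OF f]] Set_Right_iff[OF Vhom[OF f]] Vsurj[OF f] Vinj[OF f] by blast
  qed
  moreover have "is_pullback ?S (on_arr ?V f) (on_arr ?V g) (on_arr ?V p) (on_arr ?V q)"
    if fR: "f \<in> Right C" and gR: "g \<in> Right C" and pb: "is_pullback C f g p q" for f g p q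
  proof -
    note D = is_pullbackD[OF pb]
    let ?X = "Cod C f"
    have f: "f \<in> Hom C (Dom C f) ?X" and g: "g \<in> Hom C (Dom C g) ?X"
      using arr_hom[OF D(1)] arr_hom[OF D(2)] D(3) by simp_all
    have X: "?X \<in> Obj C" using D(1) C.cod_obj by blast
    interpret X: bounded_lattice "fibre F ?X" by (rule F.bounded_fibre[OF X])
    have I: "im_cluster C F f \<in> carrier (fibre F ?X)" "im_cluster C F g \<in> carrier (fibre F ?X)"
      "im_cluster C F (Comp C f p) \<in> carrier (fibre F ?X)"
      using imc f g C.comp_hom[OF D(4) f] by blast+
    \<comment> \<open>(N3) supplies an arrow \<open>k\<close> whose image is the meet. It lifts
      through \<open>f\<close> and \<open>g\<close>, hence through the pullback, so the image of
      \<open>f p\<close> is at least the meet.\<close>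
    have "conormal_cluster C F ?X (im_cluster C F f \<sqinter>\<^bsub>fibre F ?X\<^esub> im_cluster C F g)"
      using F.N3_conormal[OF X] D(1-3) unfolding conormal_cluster_def by metis
    then obtain k where k: "k \<in> Hom C (Dom C k) ?X"
      "im_cluster C F k = im_cluster C F f \<sqinter>\<^bsub>fibre F ?X\<^esub> im_cluster C F g"
      unfolding conormal_cluster_def Hom_def by auto
    obtain h where h: "h \<in> Hom C (Dom C k) (Dom C f)" "k = Comp C f h"
      using lift[OF fR f k(1)] k(2) X.meet_left I by auto
    obtain h' where h': "h' \<in> Hom C (Dom C k) (Dom C g)" "k = Comp C g h'"
      using lift[OF gR g k(1)] k(2) X.meet_right I by auto
    obtain u where u: "u \<in> Hom C (Dom C k) (Dom C p)" "Comp C p u = h"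
      using is_pullback_lift[OF pb h(1) h'(1)] h(2) h'(2) by metis
    have "k = Comp C (Comp C f p) u"
      using C.comp_assoc[OF u(1) D(4) f] u(2) h(2) by simp
    then have le: "im_cluster C F f \<sqinter>\<^bsub>fibre F ?X\<^esub> im_cluster C F g
        \<sqsubseteq>\<^bsub>fibre F ?X\<^esub> im_cluster C F (Comp C f p)"
      using im_comp_le[OF u(1) C.comp_hom[OF D(4) f]] k(2) by simp
    have img: "action (on_arr ?V h) ` carrier (fibre F A) =
        {y \<in> carrier (fibre F B). y \<sqsubseteq>\<^bsub>fibre F B\<^esub> im_cluster C F h}" if h: "h \<in> Hom C A B" for h A B
    proof -
      have "action (on_arr ?V h) ` carrier (fibre F A) = direct F h ` carrier (fibre F A)"
        by (rule image_cong[OF refl Vact[OF h]])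
      then show ?thesis
        using image_kernel_connection.image_l[OF con[OF h]] im[OF h] by simp
    qed
    have "{y \<in> carrier (fibre F ?X). y \<sqsubseteq>\<^bsub>fibre F ?X\<^esub> im_cluster C F f} \<inter>
        {y \<in> carrier (fibre F ?X). y \<sqsubseteq>\<^bsub>fibre F ?X\<^esub> im_cluster C F g}
        \<subseteq> {y \<in> carrier (fibre F ?X). y \<sqsubseteq>\<^bsub>fibre F ?X\<^esub> im_cluster C F (Comp C f p)}"
      using X.le_trans[OF X.meet_le[OF _ _ I(1,2)] le] I by auto
    then have "action (on_arr ?V f) ` carrier (fibre F (Dom C f)) \<inter>
        action (on_arr ?V g) ` carrier (fibre F (Dom C g))
        \<subseteq> action (Comp ?S (on_arr ?V f) (on_arr ?V p)) ` carrier (fibre F (Dom C p))"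
      using img[OF f] img[OF g] img[OF C.comp_hom[OF D(4) f]] Vcomp[OF D(4) f] by simp
    moreover have "Comp ?S (on_arr ?V f) (on_arr ?V p) = Comp ?S (on_arr ?V g) (on_arr ?V q)"
      using Vcomp[OF D(4) f] Vcomp[OF D(5) g] D(6) by simp
    ultimately show ?thesis
      using S.is_pullbackI[OF VR[OF fR] Vhom[OF f] VR[OF gR] Vhom[OF g]
          VR[OF C.pullback_right[OF pb gR]] Vhom[OF D(4)] Vhom[OF D(5)]] by blast
  qed
  moreover have "is_pushout ?S (on_arr ?V f) (on_arr ?V g) (on_arr ?V p) (on_arr ?V q)"
    if fL: "f \<in> Left C" and gL: "g \<in> Left C" and po: "is_pushout C f g p q" for f g p q
  proof -
    note D = is_pushoutD[OF po]
    let ?X = "Dom C f"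
    have f: "f \<in> Hom C ?X (Cod C f)" and g: "g \<in> Hom C ?X (Cod C g)"
      using arr_hom[OF D(1)] arr_hom[OF D(2)] D(3) by simp_all
    note pf = C.comp_hom[OF f D(4)]
    have X: "?X \<in> Obj C" using D(1) C.dom_obj by blast
    let ?X' = "carrier (fibre F ?X)"
    interpret X: bounded_lattice "fibre F ?X" by (rule F.bounded_fibre[OF X])
    let ?K = "ker_cluster C F f" and ?L = "ker_cluster C F g" and ?N = "ker_cluster C F (Comp C p f)"
    let ?J = "?K \<squnion>\<^bsub>fibre F ?X\<^esub> ?L"
    have K: "?K \<in> ?X'" "?L \<in> ?X'" "?N \<in> ?X'"
      using kerc f g pf by blast+
    then have J: "?J \<in> ?X'" by simp
    \<comment> \<open>(N3) supplies an arrow \<open>k\<close> whose kernel is the join. It descends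
      along \<open>f\<close> and \<open>g\<close>, hence factors through the pushout, so
      \<open>?N\<close> is at most \<open>?J\<close>.\<close>
    have "normal_cluster C F ?X ?J"
      using F.N3_normal[OF X] D(1-3) unfolding normal_cluster_def by metis
    then obtain k where k: "k \<in> Hom C ?X (Cod C k)" "ker_cluster C F k = ?J"
      unfolding normal_cluster_def Hom_def by auto
    obtain h where h: "h \<in> Hom C (Cod C f) (Cod C k)" "k = Comp C h f"
      using desc[OF fL f k(1)] k(2) X.join_left K by auto
    obtain h' where h': "h' \<in> Hom C (Cod C g) (Cod C k)" "k = Comp C h' g"
      using desc[OF gL g k(1)] k(2) X.join_right K by auto
    obtain u where u: "u \<in> Hom C (Cod C p) (Cod C k)" "Comp C u p = h"
      using is_pushout_desc[OF po h(1) h'(1)] h(2) h'(2) by metis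
    have "k = Comp C u (Comp C p f)"
      using C.comp_assoc[OF f D(4) u(1)] u(2) h(2) by simp
    then have le: "?N \<sqsubseteq>\<^bsub>fibre F ?X\<^esub> ?J"
      using ker_comp_ge[OF pf u(1)] k(2) by simp
    have eq_iff: "action (on_arr ?V h) x = action (on_arr ?V h) y \<longleftrightarrow>
        x \<squnion>\<^bsub>fibre F ?X\<^esub> ker_cluster C F h = y \<squnion>\<^bsub>fibre F ?X\<^esub> ker_cluster C F h"
      if h: "h \<in> Hom C ?X B" and "x \<in> ?X'" "y \<in> ?X'" for h B x y
      using image_kernel_connection.l_eq_iff[OF con[OF h]] ker[OF h] Vact[OF h] that by simp
    have "kernel_pair ?X' (action (Comp ?S (on_arr ?V p) (on_arr ?V f))) \<subseteq> kernel_pair ?X' (action w)"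
      if wf: "kernel_pair ?X' (action (on_arr ?V f)) \<subseteq> kernel_pair ?X' (action w)"
        and wg: "kernel_pair ?X' (action (on_arr ?V g)) \<subseteq> kernel_pair ?X' (action w)" for w
    proof -
      \<comment> \<open>Here \<open>w\<close> is an arbitrary function on the fibre and need not
        respect its order. It is known only to identify elements with equal join with
        \<open>Ker f\<close> or with \<open>Ker g\<close>; joining an element with such a kernel is
        one instance.\<close>
      have join: "action w x = action w (x \<squnion>\<^bsub>fibre F ?X\<^esub> ker_cluster C F h)"
        if h: "h \<in> Hom C ?X B" and wh: "kernel_pair ?X' (action (on_arr ?V h)) \<subseteq> kernel_pair ?X' (action w)"
          and x: "x \<in> ?X'" for h B x
      proof -
        note Kh = kerc[OF h]
        have "(x \<squnion>\<^bsub>fibre F ?X\<^esub> ker_cluster C F h) \<squnion>\<^bsub>fibre F ?X\<^esub> ker_cluster C F h =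
            x \<squnion>\<^bsub>fibre F ?X\<^esub> ker_cluster C F h"
          using Kh x X.join_right by (intro X.join_absorb) auto
        then have "(x, x \<squnion>\<^bsub>fibre F ?X\<^esub> ker_cluster C F h) \<in> kernel_pair ?X' (action (on_arr ?V h))"
          using x Kh eq_iff[OF h x, of "x \<squnion>\<^bsub>fibre F ?X\<^esub> ker_cluster C F h"] unfolding kernel_pair_def by simp
        then have "(x, x \<squnion>\<^bsub>fibre F ?X\<^esub> ker_cluster C F h) \<in> kernel_pair ?X' (action w)"
          by (rule subsetD[OF wh])
        then show ?thesis unfolding kernel_pair_def by simp
      qed
      \<comment> \<open>Two steps, along \<open>?K\<close> and then along \<open>?L\<close>, reach
        the join with both. This is why the join of the kernel elements gives the join of the two
        equivalence relations.\<close>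
      have wJ: "action w x = action w (x \<squnion>\<^bsub>fibre F ?X\<^esub> ?J)" if x: "x \<in> ?X'" for x
        using join[OF f wf x] join[OF g wg, of "x \<squnion>\<^bsub>fibre F ?X\<^esub> ?K"] x K
          X.join_assoc[OF x K(1,2)] by simp
      \<comment> \<open>As \<open>?N\<close> lies below \<open>?J\<close>, equality of joins with
        \<open>?N\<close> implies equality of joins with \<open>?J\<close>.\<close>
      have NJ: "?N \<squnion>\<^bsub>fibre F ?X\<^esub> ?J = ?J"
        using X.join_absorb[OF J K(3) le] by (simp add: join_comm)
      have "action w x = action w y" if x: "x \<in> ?X'" and y: "y \<in> ?X'"
        and eq: "action (on_arr ?V (Comp C p f)) x = action (on_arr ?V (Comp C p f)) y" for x y
      proof -
        have "x \<squnion>\<^bsub>fibre F ?X\<^esub> ?N = y \<squnion>\<^bsub>fibre F ?X\<^esub> ?N"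
          using eq eq_iff[OF pf x y] by simp
        then have "x \<squnion>\<^bsub>fibre F ?X\<^esub> ?J = y \<squnion>\<^bsub>fibre F ?X\<^esub> ?J"
          using X.join_assoc[OF x K(3) J] X.join_assoc[OF y K(3) J] NJ by simp
        then show ?thesis
          using wJ[OF x] wJ[OF y] by simp
      qed
      then show ?thesis
        using Vcomp[OF f D(4)] unfolding kernel_pair_def by auto
    qed
    moreover have "Comp ?S (on_arr ?V p) (on_arr ?V f) = Comp ?S (on_arr ?V q) (on_arr ?V g)"
      using Vcomp[OF f D(4)] Vcomp[OF g D(5)] D(6) by simp
    ultimately show ?thesis
      using S.is_pushoutI[OF VL[OF fL] Vhom[OF f] VL[OF gL] Vhom[OF g]
          VL[OF C.pushout_left[OF po gL]] Vhom[OF D(4)] Vhom[OF D(5)]] by blast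
  qed
  ultimately show ?thesis
    unfolding transfer_functor_def using C S.transfer_category_axioms fct VL VR by blast
qed


section \<open>Subgroup lattices\<close>

lemma set_mult_least:
  assumes "comm_group A" "subgroup H A" "subgroup K A"
  shows "H \<subseteq> H <#>\<^bsub>A\<^esub> K" "K \<subseteq> H <#>\<^bsub>A\<^esub> K"
    and "subgroup M A \<Longrightarrow> H \<subseteq> M \<Longrightarrow> K \<subseteq> M \<Longrightarrow> H <#>\<^bsub>A\<^esub> K \<subseteq> M"
proof -
  interpret comm_group A by fact
  show "H \<subseteq> H <#>\<^bsub>A\<^esub> K"
  proof
    fix x assume x: "x \<in> H"
    then have "x \<otimes>\<^bsub>A\<^esub> \<one>\<^bsub>A\<^esub> \<in> H <#>\<^bsub>A\<^esub> K"
      using subgroup.one_closed[OF assms(3)] unfolding set_mult_def by blast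
    then show "x \<in> H <#>\<^bsub>A\<^esub> K"
      using subgroup.mem_carrier[OF assms(2) x] by simp
  qed
  show "K \<subseteq> H <#>\<^bsub>A\<^esub> K"
  proof
    fix x assume x: "x \<in> K"
    then have "\<one>\<^bsub>A\<^esub> \<otimes>\<^bsub>A\<^esub> x \<in> H <#>\<^bsub>A\<^esub> K"
      using subgroup.one_closed[OF assms(2)] unfolding set_mult_def by blast
    then show "x \<in> H <#>\<^bsub>A\<^esub> K"
      using subgroup.mem_carrier[OF assms(3) x] by simp
  qed
  show "H <#>\<^bsub>A\<^esub> K \<subseteq> M" if "subgroup M A" "H \<subseteq> M" "K \<subseteq> M"
    using that(2,3) subgroup.m_closed[OF that(1)] unfolding set_mult_def by auto
qed

lemma Sub_simps [simp]:
  "H \<in> carrier (Sub A) \<longleftrightarrow> subgroup H A" "H \<sqsubseteq>\<^bsub>Sub A\<^esub> K \<longleftrightarrow> H \<subseteq> K"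
  unfolding Sub_def by simp_all

lemma Sub_lattice:
  assumes A: "comm_group A"
  shows "bounded_lattice (Sub A)"
    and "\<And>H K. subgroup H A \<Longrightarrow> subgroup K A \<Longrightarrow> H \<squnion>\<^bsub>Sub A\<^esub> K = H <#>\<^bsub>A\<^esub> K"
    and "\<And>H K. subgroup H A \<Longrightarrow> subgroup K A \<Longrightarrow> H \<sqinter>\<^bsub>Sub A\<^esub> K = H \<inter> K"
    and "\<top>\<^bsub>Sub A\<^esub> = carrier A" and "\<bottom>\<^bsub>Sub A\<^esub> = {\<one>\<^bsub>A\<^esub>}"
proof -
  interpret comm_group A by (rule A)
  note J = mult_subgroups set_mult_least[OF A]
  have po: "partial_order (Sub A)"
    by unfold_locales (auto simp: Sub_def)
  show bl: "bounded_lattice (Sub A)"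
    by (rule bounded_latticeI[OF po, where j = "set_mult A" and m = "(\<inter>)" and t = "carrier A"
          and b = "{\<one>\<^bsub>A\<^esub>}"])
      (simp_all add: J subgroups_Inter_pair subgroup_self triv_subgroup subgroup.subset subgroup.one_closed)
  interpret S: bounded_lattice "Sub A" by (rule bl)
  show "\<And>H K. subgroup H A \<Longrightarrow> subgroup K A \<Longrightarrow> H \<squnion>\<^bsub>Sub A\<^esub> K = H <#>\<^bsub>A\<^esub> K"
    by (rule S.join_eqI) (simp_all add: J)
  show "\<And>H K. subgroup H A \<Longrightarrow> subgroup K A \<Longrightarrow> H \<sqinter>\<^bsub>Sub A\<^esub> K = H \<inter> K"
    by (rule S.meet_eqI) (simp_all add: subgroups_Inter_pair)
  show "\<top>\<^bsub>Sub A\<^esub> = carrier A"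
    by (rule S.top_eq[symmetric]) (simp_all add: subgroup_self subgroup.subset)
  show "\<bottom>\<^bsub>Sub A\<^esub> = {\<one>\<^bsub>A\<^esub>}"
    by (rule S.bottom_eq[symmetric]) (simp_all add: triv_subgroup subgroup.one_closed)
qed

lemma Sub_Mlc_obj:
  assumes universe: "inaccessible_universe U" and A: "A \<in> Ab_obj U"
  shows "Sub A \<in> Mlc_obj U"
proof -
  have cA: "comm_group A" and sA: "small U (carrier A)"
    using A unfolding Ab_obj_def by auto
  interpret comm_group A by (rule cA)
  note L = Sub_lattice[OF cA]
  have "modular_lattice (Sub A)"
    unfolding modular_lattice_def
  proof (intro ballI impI, simp)
    fix X Y Z assume X: "subgroup X A" and Y: "subgroup Y A" and Z: "subgroup Z A" and XZ: "X \<subseteq> Z"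
    note YZ = subgroups_Inter_pair[OF Y Z] and XY = mult_subgroups[OF X Y]
    \<comment> \<open>Dedekind's modular law: if \<open>z = x y\<close> with \<open>x\<close> in
      \<open>X\<close>, and \<open>X\<close> is contained in \<open>Z\<close>, then \<open>y\<close>
      is the product of the inverse of \<open>x\<close> with \<open>z\<close> and so lies in
      \<open>Z\<close>.\<close>
    have "(X <#>\<^bsub>A\<^esub> Y) \<inter> Z \<subseteq> X <#>\<^bsub>A\<^esub> (Y \<inter> Z)"
    proof
      fix z assume z: "z \<in> (X <#>\<^bsub>A\<^esub> Y) \<inter> Z"
      then obtain x y where xy: "x \<in> X" "y \<in> Y" "z = x \<otimes>\<^bsub>A\<^esub> y"
        unfolding set_mult_def by auto
      have c: "x \<in> carrier A" "y \<in> carrier A"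
        using subgroup.mem_carrier[OF X xy(1)] subgroup.mem_carrier[OF Y xy(2)] by auto
      have "inv\<^bsub>A\<^esub> x \<otimes>\<^bsub>A\<^esub> z \<in> Z"
        using subgroup.m_closed[OF Z subgroup.m_inv_closed[OF Z]] xy(1) XZ z by blast
      then have "y \<in> Z"
        using xy(3) c by (simp add: m_assoc[symmetric])
      then show "z \<in> X <#>\<^bsub>A\<^esub> (Y \<inter> Z)"
        using xy unfolding set_mult_def by blast
    qed
    moreover have "X <#>\<^bsub>A\<^esub> (Y \<inter> Z) \<subseteq> (X <#>\<^bsub>A\<^esub> Y) \<inter> Z"
      using set_mult_least(3)[OF cA X YZ Z XZ] mono_set_mult[of X X "Y \<inter> Z" Y A] by blast
    ultimately show "X \<squnion>\<^bsub>Sub A\<^esub> (Y \<sqinter>\<^bsub>Sub A\<^esub> Z) = (X \<squnion>\<^bsub>Sub A\<^esub> Y) \<sqinter>\<^bsub>Sub A\<^esub> Z"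
      using L(2)[OF X YZ] L(3)[OF Y Z] L(2)[OF X Y] L(3)[OF XY Z] by simp
  qed
  moreover have "small U (carrier (Sub A))"
  proof (rule small_subset[OF small_Pow[OF universe sA]])
    show "carrier (Sub A) \<subseteq> Pow (carrier A)"
      by (auto dest: subgroup.mem_carrier)
  qed
  ultimately show ?thesis
    using L(1) unfolding Mlc_obj_def by simp
qed

lemma subgroup_vimage:
  assumes "group_hom A B h" "subgroup K B"
  shows "subgroup {x \<in> carrier A. h x \<in> K} A"
proof -
  interpret group_hom A B h by fact
  interpret K: subgroup K B by fact
  show ?thesis
    by (rule G.subgroupI) (use K.one_closed K.m_closed K.m_inv_closed in \<open>auto intro!: exI[of _ "\<one>\<^bsub>A\<^esub>"]\<close>)
qed

lemma Sub_connection: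
  assumes "group_hom A B h" and cA: "comm_group A" and cB: "comm_group B"
  shows "image_kernel_connection (Sub A) (Sub B) (\<lambda>H. h ` H) (\<lambda>K. {x \<in> carrier A. h x \<in> K})"
proof -
  interpret h: group_hom A B h by fact
  note LA = Sub_lattice[OF cA] and LB = Sub_lattice[OF cB]
  interpret SA: bounded_lattice "Sub A" by (rule LA(1))
  interpret SB: bounded_lattice "Sub B" by (rule LB(1))
  have ker: "{x \<in> carrier A. h x \<in> {\<one>\<^bsub>B\<^esub>}} = kernel A B h"
    unfolding kernel_def by auto
  show ?thesis
  proof
    fix H assume "H \<in> carrier (Sub A)"
    then have H: "subgroup H A" by simp
    then show "h ` H \<in> carrier (Sub B)"
      using h.subgroup_img_is_subgroup by simp
    \<comment> \<open>\<open>h x = h y\<close> with \<open>y\<close> in \<open>H\<close> means that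
      \<open>x\<close> and \<open>y\<close> differ by an element of the kernel, so the preimage of
      an image adds exactly the kernel.\<close>
    have "{x \<in> carrier A. h x \<in> h ` H} = H <#>\<^bsub>A\<^esub> kernel A B h"
    proof (intro subset_antisym subsetI)
      fix x assume "x \<in> {x \<in> carrier A. h x \<in> h ` H}"
      then obtain y where x: "x \<in> carrier A" and y: "y \<in> H" "h x = h y" by auto
      have yc: "y \<in> carrier A" using subgroup.mem_carrier[OF H y(1)] .
      have "inv\<^bsub>A\<^esub> y \<otimes>\<^bsub>A\<^esub> x \<in> kernel A B h"
        using x yc y(2) unfolding kernel_def by simp
      moreover have "x = y \<otimes>\<^bsub>A\<^esub> (inv\<^bsub>A\<^esub> y \<otimes>\<^bsub>A\<^esub> x)"
        using x yc by (simp add: h.G.m_assoc[symmetric])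
      ultimately show "x \<in> H <#>\<^bsub>A\<^esub> kernel A B h"
        using y(1) unfolding set_mult_def by blast
    next
      fix x assume "x \<in> H <#>\<^bsub>A\<^esub> kernel A B h"
      then show "x \<in> {x \<in> carrier A. h x \<in> h ` H}"
        using subgroup.mem_carrier[OF H] unfolding set_mult_def kernel_def by auto
    qed
    then show "{x \<in> carrier A. h x \<in> h ` H} = H \<squnion>\<^bsub>Sub A\<^esub> {x \<in> carrier A. h x \<in> \<bottom>\<^bsub>Sub B\<^esub>}"
      using LA(2)[OF H h.subgroup_kernel] LB(5) ker by simp
  next
    fix K assume "K \<in> carrier (Sub B)"
    then have K: "subgroup K B" by simp
    show "{x \<in> carrier A. h x \<in> K} \<in> carrier (Sub A)"
      using subgroup_vimage[OF assms(1) K] by simp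
    have "h ` {x \<in> carrier A. h x \<in> K} = K \<inter> h ` carrier A"
      by auto
    then show "h ` {x \<in> carrier A. h x \<in> K} = K \<sqinter>\<^bsub>Sub B\<^esub> h ` \<top>\<^bsub>Sub A\<^esub>"
      using LB(3)[OF K h.img_is_subgroup] LA(4) by simp
  next
    fix H K assume "H \<in> carrier (Sub A)" "K \<in> carrier (Sub B)"
    then show "h ` H \<sqsubseteq>\<^bsub>Sub B\<^esub> K \<longleftrightarrow> H \<sqsubseteq>\<^bsub>Sub A\<^esub> {x \<in> carrier A. h x \<in> K}"
      using subgroup.subset by auto
  qed
qed

lemma Sub_functor_simps:
  "on_obj Sub_functor A = Sub A"
  "subgroup H (source h) \<Longrightarrow> lower (on_arr Sub_functor h) H = action h ` H"
  "subgroup K (target h) \<Longrightarrow>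
    upper (on_arr Sub_functor h) K = {x \<in> carrier (source h). action h x \<in> K}"
  unfolding Sub_functor_def by simp_all

lemma Sub_functor_hom:
  assumes universe: "inaccessible_universe U" and h: "h \<in> Hom (Ab_cat U) A B"
  shows "on_arr Sub_functor h \<in> Hom (Mlc_category U) (Sub A) (Sub B)"
proof -
  note H = Ab_homD[OF h]
  have "on_arr Sub_functor h =
      galcon_of (Sub A) (Sub B) (\<lambda>S. action h ` S) (\<lambda>K. {x \<in> carrier A. action h x \<in> K})"
    using H(3,4) unfolding Sub_functor_def galcon_of_def by simp
  then show ?thesis
    using galcon_of_hom[OF Sub_Mlc_obj[OF universe H(1)] Sub_Mlc_obj[OF universe H(2)]
      Sub_connection[OF H(7-9)]] by simp
qed

lemma is_functor_Sub:
  assumes universe: "inaccessible_universe U"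
  shows "is_functor (Ab_cat U) (Mlc U)
    (Sub_functor :: ('g monoid, ('g monoid, 'g) typed_map, 'g set gorder, ('g set, 'g set) galois) functor_data)"
  unfolding is_functor_def Hom_Mlc Sub_functor_simps(1)
proof (intro conjI ballI impI)
  interpret A: concrete_system U "Ab_cat U :: ('g monoid, ('g monoid, 'g) typed_map) system_category"
    carrier action
    by (rule concrete_system_Ab[OF universe])
  fix A :: "'g monoid" assume A: "A \<in> Obj (Ab_cat U)"
  show "Sub A \<in> Obj (Mlc U)"
    using Sub_Mlc_obj[OF universe] A by simp
  note i = A.id_hom[OF A]
  show "on_arr Sub_functor (Id (Ab_cat U) A) = Id (Mlc U) (Sub A)"
    unfolding Mlc_simps
  proof (rule Mlc_hom_eqI[OF Sub_functor_hom[OF universe i] Mlc_id_hom[OF Sub_Mlc_obj[OF universe]]])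
    show "A \<in> Ab_obj U" using A by simp
    fix H assume H: "H \<in> carrier (Sub A)"
    then have "action (Id (Ab_cat U) A) ` H = H"
      using A.act_id[OF A] subgroup.mem_carrier[of H A] by force
    then show "lower (on_arr Sub_functor (Id (Ab_cat U) A)) H = lower (Id (Mlc_category U) (Sub A)) H"
      using H Ab_homD(3)[OF i] Sub_functor_simps(2)[of H "Id (Ab_cat U) A"] Mlc_id_apply(1)[OF H, of U]
      by simp
  qed
next
  fix h :: "('g monoid, 'g) typed_map" assume "h \<in> Arr (Ab_cat U)"
  then show "on_arr Sub_functor h \<in> Hom (Mlc_category U) (Sub (Dom (Ab_cat U) h)) (Sub (Cod (Ab_cat U) h))"
    using Sub_functor_hom[OF universe arr_hom] by blast
next
  fix f g :: "('g monoid, 'g) typed_map"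
  assume fg: "f \<in> Arr (Ab_cat U)" "g \<in> Arr (Ab_cat U)" "Cod (Ab_cat U) f = Dom (Ab_cat U) g"
  have f: "f \<in> Hom (Ab_cat U) (source f) (source g)" and g: "g \<in> Hom (Ab_cat U) (source g) (target g)"
    using fg unfolding Hom_def by auto
  show "on_arr Sub_functor (Comp (Ab_cat U) g f) = Comp (Mlc U) (on_arr Sub_functor g) (on_arr Sub_functor f)"
    unfolding Mlc_simps
  proof (rule Mlc_hom_eqI[OF Sub_functor_hom[OF universe Ab_comp_hom[OF f g]]
        Mlc_comp_hom[OF Sub_functor_hom[OF universe f] Sub_functor_hom[OF universe g]]])
    fix H assume H: "H \<in> carrier (Sub (source f))"
    then have sH: "subgroup H (source f)" by simp
    have sf: "subgroup (action f ` H) (source g)"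
      using group_hom.subgroup_img_is_subgroup[OF Ab_homD(7)[OF f] sH] .
    have "lower (on_arr Sub_functor (Comp (Ab_cat U) g f)) H = action (Comp (Ab_cat U) g f) ` H"
      using Sub_functor_simps(2)[of H "Comp (Ab_cat U) g f"] Ab_homD(3)[OF Ab_comp_hom[OF f g]] sH by simp
    also have "\<dots> = action g ` action f ` H"
      unfolding image_image
      by (rule image_cong[OF refl]) (simp add: Ab_comp_action subgroup.mem_carrier[OF sH])
    also have "\<dots> = lower (on_arr Sub_functor g) (lower (on_arr Sub_functor f) H)"
      using Sub_functor_simps(2)[OF sH] Sub_functor_simps(2)[OF sf] by simp
    also have "\<dots> = lower (Comp (Mlc_category U) (on_arr Sub_functor g) (on_arr Sub_functor f)) H"
      using H Mlc_homD(4)[OF Sub_functor_hom[OF universe f]] by (simp add: Mlc_comp_apply)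
    finally show "lower (on_arr Sub_functor (Comp (Ab_cat U) g f)) H =
        lower (Comp (Mlc_category U) (on_arr Sub_functor g) (on_arr Sub_functor f)) H" .
  qed
qed


section \<open>Free abelian groups\<close>

text \<open>The action of the free abelian group functor for a bare function. Carriers enter only
  through supports, so functions such as \<open>inv_into X f\<close> can be used without
  restriction.\<close>

abbreviation frag_map :: "('x \<Rightarrow> 'y) \<Rightarrow> ('x \<Rightarrow>\<^sub>0 int) \<Rightarrow> 'y \<Rightarrow>\<^sub>0 int" where
  "frag_map f \<equiv> frag_extend (\<lambda>x. frag_of (f x))"

lemma frag_map_comp: "frag_map g (frag_map f c) = frag_map (\<lambda>x. g (f x)) c"
  using frag_extend_compose[of "\<lambda>x. frag_of (g x)" f c] by (simp add: o_def)

lemma keys_frag_map: "Poly_Mapping.keys (frag_map f c) \<subseteq> f ` Poly_Mapping.keys c"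
  using keys_frag_extend[of "\<lambda>x. frag_of (f x)" c] by auto

text \<open>Only the values of \<open>f\<close> on the support of \<open>c\<close> matter.
  Composites with \<open>inv_into\<close> thus act as the identity on combinations supported in the
  right set.\<close>

lemma frag_map_ident:
  assumes "\<And>x. x \<in> Poly_Mapping.keys c \<Longrightarrow> f x = x"
  shows "frag_map f c = c"
  using frag_extend_eq[of c "\<lambda>x. frag_of (f x)" frag_of] assms frag_expansion[of c] by simp

text \<open>A section of \<open>f\<close> over its image, extended additively, lifts every
  combination supported there.\<close>

lemma image_frag_map:
  "frag_map f ` carrier (free_Abelian_group X) = carrier (free_Abelian_group (f ` X))"
proof (intro subset_antisym subsetI)
  fix c assume c: "c \<in> carrier (free_Abelian_group (f ` X))"
  let ?s = "inv_into X f"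
  have "frag_map f (frag_map ?s c) = c"
    unfolding frag_map_comp using c by (intro frag_map_ident) (auto simp: f_inv_into_f)
  moreover have "frag_map ?s c \<in> carrier (free_Abelian_group X)"
    using c keys_frag_map[of ?s c] inv_into_into[of _ f X] by (auto simp: subset_iff)
  ultimately show "c \<in> frag_map f ` carrier (free_Abelian_group X)"
    by (metis image_eqI)
next
  fix c assume "c \<in> frag_map f ` carrier (free_Abelian_group X)"
  then show "c \<in> carrier (free_Abelian_group (f ` X))"
    using keys_frag_map[of f] by (fastforce simp: subset_iff)
qed

lemma frag_map_hom:
  assumes "f ` X \<subseteq> Y"
  shows "frag_map f \<in> hom (free_Abelian_group X) (free_Abelian_group Y)"
proof (rule homI)
  fix c assume "c \<in> carrier (free_Abelian_group X)"
  then show "frag_map f c \<in> carrier (free_Abelian_group Y)"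
    using order_trans[OF keys_frag_map[of f c]] image_mono[of "Poly_Mapping.keys c" X f] assms by auto
qed (simp add: frag_extend_add)

lemma free_Abelian_group_Ab_obj:
  fixes X :: "'x set"
  assumes universe: "inaccessible_universe U" and X: "small U X"
  shows "free_Abelian_group X \<in> Ab_obj U"
proof -
  have "small U (carrier (free_Abelian_group X))"
  proof (rule small_inj_on)
    \<comment> \<open>A combination vanishes off its support, so its graph over the support
      determines it. Such graphs are subsets of \<open>X\<close> times the integers.\<close>
    let ?g = "\<lambda>c :: 'x \<Rightarrow>\<^sub>0 int. (\<lambda>x. (x, Poly_Mapping.lookup c x)) ` Poly_Mapping.keys c"
    show "inj_on ?g (carrier (free_Abelian_group X))"
    proof (rule inj_onI, rule poly_mapping_eqI)
      fix c d :: "'x \<Rightarrow>\<^sub>0 int" and x assume eq: "?g c = ?g d"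
      have sub: "Poly_Mapping.lookup a x = Poly_Mapping.lookup b x"
        if "?g a = ?g b" "x \<in> Poly_Mapping.keys a" for a b :: "'x \<Rightarrow>\<^sub>0 int"
      proof -
        have "(x, Poly_Mapping.lookup a x) \<in> ?g b"
          using that by (metis (no_types, lifting) image_eqI)
        then show ?thesis by auto
      qed
      show "Poly_Mapping.lookup c x = Poly_Mapping.lookup d x"
      proof (cases "x \<in> Poly_Mapping.keys c \<or> x \<in> Poly_Mapping.keys d")
        case True
        then show ?thesis using sub[OF eq] sub[OF eq[symmetric]] by auto
      next
        case False
        then show ?thesis by (simp add: in_keys_iff)
      qed
    qed
    show "?g ` carrier (free_Abelian_group X) \<subseteq> Pow (X \<times> UNIV)"
      by auto
    show "small U (Pow (X \<times> (UNIV :: int set)))"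
      by (intro small_Pow[OF universe] small_Times[OF universe] X small_countable[OF universe]) simp
  qed
  then show ?thesis
    using abelian_free_Abelian_group unfolding Ab_obj_def by blast
qed

lemma free_ab_functor_hom:
  assumes universe: "inaccessible_universe U" and f: "f \<in> Hom (Set_cat U) X Y"
  shows "on_arr free_ab_functor f \<in> Hom (Ab_cat U) (free_Abelian_group X) (free_Abelian_group Y)"
    and "\<And>c. c \<in> carrier (free_Abelian_group X) \<Longrightarrow>
      action (on_arr free_ab_functor f) c = frag_map (action f) c"
proof -
  note F = Set_homD[OF f]
  have "action f ` X \<subseteq> Y" using F(5) by auto
  then show "on_arr free_ab_functor f \<in> Hom (Ab_cat U) (free_Abelian_group X) (free_Abelian_group Y)"
    using Ab_homI[OF free_Abelian_group_Ab_obj[OF universe F(1)] free_Abelian_group_Ab_obj[OF universe F(2)]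
      frag_map_hom] F(3,4) unfolding free_ab_functor_def by simp
  show "action (on_arr free_ab_functor f) c = frag_map (action f) c"
    if "c \<in> carrier (free_Abelian_group X)" for c
    using that F(3) unfolding free_ab_functor_def by simp
qed

lemma is_functor_free_ab:
  assumes universe: "inaccessible_universe U"
  shows "is_functor (Set_cat U) (Ab_cat U)
    (free_ab_functor :: ('x set, ('x set, 'x) typed_map, _, _) functor_data)"
proof -
  interpret S: concrete_system U "Set_cat U :: ('x set, ('x set, 'x) typed_map) system_category" "\<lambda>X. X" action
    by (rule concrete_system_Set[OF universe])
  interpret A: concrete_system U "Ab_cat U :: (('x \<Rightarrow>\<^sub>0 int) monoid, _) system_category" carrier action
    by (rule concrete_system_Ab[OF universe])
  note h = free_ab_functor_hom[OF universe]
  have obj: "on_obj free_ab_functor X = free_Abelian_group X" for X :: "'x set"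
    unfolding free_ab_functor_def by simp
  show ?thesis
    unfolding is_functor_def obj
  proof (intro conjI ballI impI)
    fix X :: "'x set" assume X: "X \<in> Obj (Set_cat U)"
    show F: "free_Abelian_group X \<in> Obj (Ab_cat U)"
      using free_Abelian_group_Ab_obj[OF universe] X by simp
    show "on_arr free_ab_functor (Id (Set_cat U) X) = Id (Ab_cat U) (free_Abelian_group X)"
    proof (rule Ab_hom_eqI[OF h(1)[OF S.id_hom[OF X]] A.id_hom[OF F]])
      fix c assume c: "c \<in> carrier (free_Abelian_group X)"
      then have "frag_map (action (Id (Set_cat U) X)) c = c"
        using S.act_id[OF X] by (intro frag_map_ident) auto
      then show "action (on_arr free_ab_functor (Id (Set_cat U) X)) c =
          action (Id (Ab_cat U) (free_Abelian_group X)) c"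
        using h(2)[OF S.id_hom[OF X] c] A.act_id[OF F c] by simp
    qed
  next
    fix f :: "('x set, 'x) typed_map" assume f: "f \<in> Arr (Set_cat U)"
    show "on_arr free_ab_functor f \<in>
        Hom (Ab_cat U) (free_Abelian_group (Dom (Set_cat U) f)) (free_Abelian_group (Cod (Set_cat U) f))"
      by (rule h(1)[OF arr_hom[OF f]])
  next
    fix f g :: "('x set, 'x) typed_map"
    assume fg: "f \<in> Arr (Set_cat U)" "g \<in> Arr (Set_cat U)" "Cod (Set_cat U) f = Dom (Set_cat U) g"
    have f: "f \<in> Hom (Set_cat U) (source f) (source g)" and g: "g \<in> Hom (Set_cat U) (source g) (target g)"
      using fg unfolding Hom_def by auto
    show "on_arr free_ab_functor (Comp (Set_cat U) g f) =
        Comp (Ab_cat U) (on_arr free_ab_functor g) (on_arr free_ab_functor f)"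
    proof (rule Ab_hom_eqI[OF h(1)[OF Set_comp_hom[OF f g]] Ab_comp_hom[OF h(1)[OF f] h(1)[OF g]]])
      fix c assume c: "c \<in> carrier (free_Abelian_group (source f))"
      have "frag_map (action (Comp (Set_cat U) g f)) c = frag_map (\<lambda>x. action g (action f x)) c"
        using c by (intro frag_extend_eq) (auto simp: Set_comp_action)
      then show "action (on_arr free_ab_functor (Comp (Set_cat U) g f)) c =
          action (Comp (Ab_cat U) (on_arr free_ab_functor g) (on_arr free_ab_functor f)) c"
        using h(2)[OF Set_comp_hom[OF f g] c] A.act_comp[OF h(1)[OF f] h(1)[OF g] c]
          h(2)[OF f c] h(2)[OF g Ab_homD(6)[OF h(1)[OF f] c]] by (simp add: frag_map_comp)
    qed
  qed
qed

lemma frag_map_inj_onD: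
  assumes "inj_on (frag_map f) (carrier (free_Abelian_group X))"
  shows "inj_on f X"
proof (rule inj_onI)
  fix x y assume "x \<in> X" "y \<in> X" "f x = f y"
  then have "frag_of x = (frag_of y :: 'a \<Rightarrow>\<^sub>0 int)"
    using inj_onD[OF assms, of "frag_of x" "frag_of y"] by simp
  then show "x = y"
    by (simp add: frag_of_eq)
qed

text \<open>The additive extension of a left inverse of \<open>f\<close> on \<open>X\<close>
  recovers \<open>c\<close> from its image.\<close>

lemma frag_map_kernel_trivial:
  assumes "inj_on f X" "c \<in> carrier (free_Abelian_group X)" "frag_map f c = 0"
  shows "c = 0"
proof -
  have "frag_map (inv_into X f) (frag_map f c) = c"
    unfolding frag_map_comp using assms(1,2) by (intro frag_map_ident) (auto simp: inv_into_f_f)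
  then show ?thesis
    using assms(3) by simp
qed

text \<open>The combinations \<open>x - x'\<close> with \<open>n x = n x'\<close> generate the kernel of the additive extension
  of \<open>n\<close>: subtract from \<open>c\<close> its image under a map picking representatives of the fibres of \<open>n\<close>.\<close>

lemma frag_map_kernel_subset:
  fixes n :: "'x \<Rightarrow> 'y"
  assumes N: "subgroup N (free_Abelian_group X)"
    and gen: "\<And>x x'. x \<in> X \<Longrightarrow> x' \<in> X \<Longrightarrow> n x = n x' \<Longrightarrow> frag_of x - frag_of x' \<in> N"
    and c: "c \<in> carrier (free_Abelian_group X)" "frag_map n c = 0"
  shows "c \<in> N"
proof -
  let ?s = "\<lambda>x. inv_into X n (n x)"
  have zero: "0 \<in> N" and diff: "\<And>a b. a \<in> N \<Longrightarrow> b \<in> N \<Longrightarrow> a - b \<in> N"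
  proof -
    show "0 \<in> N" using subgroup.one_closed[OF N] by simp
    fix a b assume a: "a \<in> N" and b: "b \<in> N"
    then have "a \<otimes>\<^bsub>free_Abelian_group X\<^esub> inv\<^bsub>free_Abelian_group X\<^esub> b \<in> N"
      using subgroup.m_closed[OF N] subgroup.m_inv_closed[OF N] by blast
    then show "a - b \<in> N"
      using subgroup.mem_carrier[OF N b] by simp
  qed
  have "Poly_Mapping.keys c \<subseteq> X" using c(1) by simp
  \<comment> \<open>Combinations with this property are closed under differences because
    \<open>frag_map ?s\<close> is additive; for a generator it is an instance of \<open>gen\<close>,
    since \<open>n (?s x) = n x\<close>.\<close>
  then have "c - frag_map ?s c \<in> N"
  proof (induction c rule: frag_induction)
    case (one x)
    have "?s x \<in> X" "n (?s x) = n x"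
      using one by (auto intro: inv_into_into f_inv_into_f)
    then show ?case
      using gen[of x "?s x"] one by simp
  next
    case (diff a b)
    have "(a - frag_map ?s a) - (b - frag_map ?s b) \<in> N"
      using \<open>\<And>a b. a \<in> N \<Longrightarrow> b \<in> N \<Longrightarrow> a - b \<in> N\<close> diff by blast
    then show ?case
      by (simp add: frag_extend_diff algebra_simps)
  qed (simp add: zero)
  moreover have "frag_map ?s c = frag_map (inv_into X n) (frag_map n c)"
    by (rule frag_map_comp[symmetric])
  ultimately show ?thesis
    using c(2) by simp
qed

text \<open>The composite is tested as a whole through its images and kernels. Images consist of the
  combinations supported in the image of the map, so pullbacks reduce to intersecting supports;
  kernels are generated by differences of identified generators, so pushouts reduce to which
  elements become identified.\<close>

lemma transfer_functor_Sub_free: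
  fixes U :: "'u itself"
  assumes universe: "inaccessible_universe U"
  shows "transfer_functor U (Set_cat U :: ('x set, _) system_category)
    (Mlc U :: (('x \<Rightarrow>\<^sub>0 int) set gorder, _) system_category)
    (comp_functor Sub_functor free_ab_functor)"
proof -
  let ?S = "Set_cat U :: ('x set, ('x set, 'x) typed_map) system_category"
    and ?T = "comp_functor Sub_functor free_ab_functor ::
      ('x set, ('x set, 'x) typed_map, ('x \<Rightarrow>\<^sub>0 int) set gorder, _) functor_data"
  interpret S: concrete_system U ?S "\<lambda>X. X" action
    by (rule concrete_system_Set[OF universe])
  have obj: "on_obj ?T X = Sub (free_Abelian_group X)" for X
    unfolding comp_functor_def free_ab_functor_def Sub_functor_def by simp
  have ab: "comm_group (free_Abelian_group X)" for X :: "'x set"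
    by (rule abelian_free_Abelian_group)
  note L = Sub_lattice[OF ab]
  have im: "conn_im (on_arr ?T f) = carrier (free_Abelian_group (action f ` X))"
    and ker: "conn_ker (on_arr ?T f) = {c \<in> carrier (free_Abelian_group X). frag_map (action f) c = 0}"
    if f: "f \<in> Hom ?S X Y" for f X Y
  proof -
    let ?f = "on_arr free_ab_functor f"
    have fh: "?f \<in> Hom (Ab_cat U) (free_Abelian_group X) (free_Abelian_group Y)"
      and act: "\<And>c. c \<in> carrier (free_Abelian_group X) \<Longrightarrow> action ?f c = frag_map (action f) c"
      using free_ab_functor_hom[OF universe f] by auto
    note H = Ab_homD[OF fh]
    have T: "on_arr ?T f = on_arr Sub_functor ?f"
      unfolding comp_functor_def by simp
    note Th = Mlc_homD[OF Sub_functor_hom[OF universe fh]]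
    have "subgroup (carrier (free_Abelian_group X)) (free_Abelian_group X)"
      by (rule group.subgroup_self[OF group_free_Abelian_group])
    then have "conn_im (on_arr ?T f) = action ?f ` carrier (free_Abelian_group X)"
      using Th(6) L(4) Sub_functor_simps(2)[of "carrier (free_Abelian_group X)" ?f] H(3) T by simp
    also have "\<dots> = frag_map (action f) ` carrier (free_Abelian_group X)"
      by (rule image_cong[OF refl act])
    also have "\<dots> = carrier (free_Abelian_group (action f ` X))"
      by (rule image_frag_map)
    finally show "conn_im (on_arr ?T f) = carrier (free_Abelian_group (action f ` X))" .
    have "conn_ker (on_arr ?T f) = {c \<in> carrier (free_Abelian_group X). action ?f c \<in> {0}}"
      using Th(7) L(5) Sub_functor_simps(3)[of "{0}" ?f] H(3,4)
        group.triv_subgroup[OF group_free_Abelian_group, of Y] T by simp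
    also have "\<dots> = {c \<in> carrier (free_Abelian_group X). frag_map (action f) c = 0}"
      using act by auto
    finally show "conn_ker (on_arr ?T f) = {c \<in> carrier (free_Abelian_group X). frag_map (action f) c = 0}" .
  qed
  have h: "f \<in> Hom ?S (source f) (target f)" if "f \<in> Arr ?S" for f
    using arr_hom[OF that] by simp
  \<comment> \<open>A set is recovered from its free group through the generators, so a full image
    in the subgroup lattice forces surjectivity of the map of sets.\<close>
  have carrier_inj: "X = Y" if "carrier (free_Abelian_group X) = carrier (free_Abelian_group Y)"
    for X Y :: "'x set"
  proof (rule Set.set_eqI)
    fix x
    have "frag_of x \<in> carrier (free_Abelian_group X) \<longleftrightarrow> frag_of x \<in> carrier (free_Abelian_group Y)"
      unfolding that ..
    then show "x \<in> X \<longleftrightarrow> x \<in> Y" by simp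
  qed
  show ?thesis
  proof (rule transfer_functor_MlcI[OF universe S.transfer_category_axioms
        is_functor_comp[OF is_functor_free_ab[OF universe] is_functor_Sub[OF universe]]], unfold obj Set_simps L(4,5))
    fix f :: "('x set, 'x) typed_map"
    show "conn_im (on_arr ?T f) = carrier (free_Abelian_group (target f))" if f: "f \<in> Left ?S"
    proof -
      have fh: "f \<in> Hom ?S (source f) (target f)" by (rule h[OF subsetD[OF S.left_sub f]])
      show ?thesis
        using im[OF fh] Set_Left_iff[OF fh] f by simp
    qed
    show "conn_ker (on_arr ?T f) = {\<one>\<^bsub>free_Abelian_group (source f)\<^esub>}" if f: "f \<in> Right ?S"
    proof -
      have fh: "f \<in> Hom ?S (source f) (target f)" by (rule h[OF subsetD[OF S.right_sub f]])
      have "inj_on (action f) (source f)" using Set_Right_iff[OF fh] f by blast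
      then show ?thesis
        using ker[OF fh] frag_map_kernel_trivial by auto
    qed
    assume f: "f \<in> Set_arr U"
      and t: "conn_im (on_arr ?T f) = carrier (free_Abelian_group (target f))"
      and b: "conn_ker (on_arr ?T f) = {\<one>\<^bsub>free_Abelian_group (source f)\<^esub>}"
    have fh: "f \<in> Hom ?S (source f) (target f)" using h f by simp
    have "action f ` source f = target f"
      using t im[OF fh] carrier_inj by simp
    moreover have "inj_on (frag_map (action f)) (carrier (free_Abelian_group (source f)))"
    proof (rule inj_onI)
      fix c d assume c: "c \<in> carrier (free_Abelian_group (source f))"
        and d: "d \<in> carrier (free_Abelian_group (source f))" and "frag_map (action f) c = frag_map (action f) d"
      then have "frag_map (action f) (c - d) = 0" "c - d \<in> carrier (free_Abelian_group (source f))"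
        using keys_diff[of c d] by (auto simp: frag_extend_diff)
      then have "c - d \<in> conn_ker (on_arr ?T f)"
        unfolding ker[OF fh] by simp
      then have "c - d \<in> {0}"
        unfolding b by simp
      then show "c = d" by simp
    qed
    ultimately show "iso_arrow ?S f"
      using S.iso_iff[OF fh] Set_Left_iff[OF fh] Set_Right_iff[OF fh] frag_map_inj_onD by blast
  next
    fix f g p q :: "('x set, 'x) typed_map"
    assume f: "f \<in> Right ?S" and g: "g \<in> Right ?S" and pb: "is_pullback ?S f g p q"
    note D = is_pullbackD[OF pb, simplified]
    have fh: "f \<in> Hom ?S (source f) (target f)" and gh: "g \<in> Hom ?S (source g) (target f)"
      using h[of f] h[of g] D(1-3) by simp_all
    have "action (Comp ?S f p) ` source p = action f ` source f \<inter> action g ` source g"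
      using S.pullback_image[OF f g pb] by simp
    \<comment> \<open>A combination supported in both images is supported in their intersection,
      which is the image of the pullback composite.\<close>
    then have eq: "carrier (free_Abelian_group (action f ` source f)) \<inter>
        carrier (free_Abelian_group (action g ` source g)) = conn_im (on_arr ?T (Comp ?S f p))"
      using im[OF Set_comp_hom[OF D(4) fh]] by auto
    have sub: "subgroup (carrier (free_Abelian_group (action k ` source k))) (free_Abelian_group (target f))"
      if k: "k \<in> Hom ?S (source k) (target f)" for k
      using Mlc_homD(3)[OF is_functorD(2)[OF is_functor_comp[OF is_functor_free_ab[OF universe]
          is_functor_Sub[OF universe]] k, unfolded Hom_Mlc]]
        conn_im_closed[OF is_functorD(2)[OF is_functor_comp[OF is_functor_free_ab[OF universe]
          is_functor_Sub[OF universe]] k, unfolded Hom_Mlc]] im[OF k] obj by simp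
    show "conn_im (on_arr ?T f) \<sqinter>\<^bsub>Sub (free_Abelian_group (target f))\<^esub> conn_im (on_arr ?T g)
        \<sqsubseteq>\<^bsub>Sub (free_Abelian_group (target f))\<^esub> conn_im (on_arr ?T (Comp ?S f p))"
      using L(3)[OF sub[OF fh] sub[OF gh]] im[OF fh] im[OF gh] eq by simp
  next
    fix f g p q :: "('x set, 'x) typed_map"
    assume f: "f \<in> Left ?S" and g: "g \<in> Left ?S" and po: "is_pushout ?S f g p q"
    note D = is_pushoutD[OF po, simplified]
    let ?X = "source f" and ?F = "free_Abelian_group (source f)"
    have fh: "f \<in> Hom ?S ?X (target f)" and gh: "g \<in> Hom ?S ?X (target g)"
      using h[of f] h[of g] D(1-3) by simp_all
    note nh = Set_comp_hom[OF fh D(4)]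
    interpret F: comm_group ?F by (rule ab)
    have sub: "subgroup (conn_ker (on_arr ?T k)) ?F" if k: "k \<in> Hom ?S ?X Y" for k Y
      using conn_ker_closed[OF is_functorD(2)[OF is_functor_comp[OF is_functor_free_ab[OF universe]
          is_functor_Sub[OF universe]] k, unfolded Hom_Mlc]] obj by simp
    let ?K = "conn_ker (on_arr ?T f)" and ?L = "conn_ker (on_arr ?T g)"
    let ?N = "?K <#>\<^bsub>?F\<^esub> ?L"
    note K = sub[OF fh] and L' = sub[OF gh]
    have N: "subgroup ?N ?F" by (rule F.mult_subgroups[OF K L'])
    note KN = set_mult_least(1,2)[OF ab K L']
    have mem: "frag_of x - frag_of x' \<in> conn_ker (on_arr ?T k)"
      if k: "k \<in> Hom ?S ?X Y" and x: "x \<in> ?X" "x' \<in> ?X" "action k x = action k x'" for k Y x x'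
      using ker[OF k] x keys_diff[of "frag_of x" "frag_of x'"] by (auto simp: frag_extend_diff)
    \<comment> \<open>The function sending \<open>x\<close> to the coset of its generator modulo
      \<open>?N\<close> identifies whatever \<open>f\<close> or \<open>g\<close> identifies, hence
      also whatever the pushout composite identifies. Its values are sets of combinations, outside
      the element type of the category, so the form of the universal property with an arbitrary
      target type is needed.\<close>
    have gen: "frag_of x - frag_of x' \<in> ?N"
      if x: "x \<in> ?X" "x' \<in> ?X" "action (Comp ?S p f) x = action (Comp ?S p f) x'" for x x'
    proof -
      have eq_iff: "?N #>\<^bsub>?F\<^esub> frag_of a = ?N #>\<^bsub>?F\<^esub> frag_of b \<longleftrightarrow> frag_of a - frag_of b \<in> ?N"
        if "a \<in> ?X" "b \<in> ?X" for a b
      proof -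
        have ab: "frag_of a \<in> carrier ?F" "frag_of b \<in> carrier ?F"
          using that by simp_all
        have "?N #>\<^bsub>?F\<^esub> frag_of a = ?N #>\<^bsub>?F\<^esub> frag_of b \<longleftrightarrow> frag_of a \<in> ?N #>\<^bsub>?F\<^esub> frag_of b"
          using F.repr_independence[OF _ ab(2) N] F.rcos_self[OF ab(1) N] by metis
        also have "\<dots> \<longleftrightarrow> frag_of a \<otimes>\<^bsub>?F\<^esub> inv\<^bsub>?F\<^esub> frag_of b \<in> ?N"
          using subgroup.rcos_module[OF N F.is_group ab(2,1)] .
        finally show ?thesis using that by simp
      qed
      have "?N #>\<^bsub>?F\<^esub> frag_of x = ?N #>\<^bsub>?F\<^esub> frag_of x'"
      proof (rule Set_pushout_kernel[OF universe f g po _ _ x])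
        show "?N #>\<^bsub>?F\<^esub> frag_of a = ?N #>\<^bsub>?F\<^esub> frag_of b"
          if "a \<in> ?X" "b \<in> ?X" "action f a = action f b" for a b
          using eq_iff[OF that(1,2)] mem[OF fh that] KN(1) by blast
        show "?N #>\<^bsub>?F\<^esub> frag_of a = ?N #>\<^bsub>?F\<^esub> frag_of b"
          if "a \<in> ?X" "b \<in> ?X" "action g a = action g b" for a b
          using eq_iff[OF that(1,2)] mem[OF gh that] KN(2) by blast
      qed
      then show ?thesis using eq_iff[OF x(1,2)] by blast
    qed
    \<comment> \<open>The differences collected in \<open>gen\<close> generate the kernel of the
      additive extension of \<open>p f\<close>.\<close>
    have "conn_ker (on_arr ?T (Comp ?S p f)) \<subseteq> ?N"
      using ker[OF nh] frag_map_kernel_subset[OF N gen] by blast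
    then show "conn_ker (on_arr ?T (Comp ?S p f)) \<sqsubseteq>\<^bsub>Sub ?F\<^esub> ?K \<squnion>\<^bsub>Sub ?F\<^esub> ?L"
      using L(2)[OF K L'] by simp
  qed
qed

section \<open>The equivalence and the universal property\<close>

text \<open>Forwards, the relabelling comes last and moves lattices of sets of combinations over
  \<open>'u\<close> to \<open>'l\<close>. Backwards it comes first: clusters must be elements of
  \<open>'u\<close>, so the lattices over \<open>'l\<close> are copied there before the form is read
  off.\<close>

lemma inducing_form_iff_transfer_functor:
  fixes C :: "('o, 'a, 'm) system_category_scheme" and U :: "'u itself"
  assumes universe: "inaccessible_universe U" and le: "|UNIV :: 'u set| \<le>o |UNIV :: 'l set|"
    and C: "transfer_category U C"
  shows "has_inducing_form U C \<longleftrightarrow>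
    (\<exists>T. transfer_functor U C (Mlc U :: ('l gorder, ('l, 'l) galois) system_category) T)"
proof
  assume "has_inducing_form U C"
  then obtain F :: "('o, 'a, 'u) form" where "noetherian_form U C F" "induces_system F C"
    unfolding has_inducing_form_def by blast
  then have "transfer_functor U C (Set_cat U) (fibre_functor C F)"
    by (rule transfer_functor_fibre[OF universe C])
  from transfer_functor_comp[OF this transfer_functor_Sub_free[OF universe]]
  show "\<exists>T. transfer_functor U C (Mlc U :: ('l gorder, ('l, 'l) galois) system_category) T"
    by (rule transfer_functor_Mlc_change[OF universe le])
next
  assume "\<exists>T. transfer_functor U C (Mlc U :: ('l gorder, ('l, 'l) galois) system_category) T"
  then obtain T where "transfer_functor U C (Mlc U :: ('l gorder, ('l, 'l) galois) system_category) T" ..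
  then obtain S :: "('o, 'a, 'u gorder, ('u, 'u) galois) functor_data"
    where "transfer_functor U C (Mlc U) S"
    using transfer_functor_Mlc_change[OF universe card_of_mono1[OF subset_UNIV]] by blast
  then show "has_inducing_form U C"
    by (rule induced_form[OF universe])
qed

text \<open>\<open>comp_functor\<close> composes raw data, so functoriality of both factors is
  asserted separately from the transfer property of their composite. The composite lands in lattices
  whose elements are sets of integer combinations over \<open>'u\<close>, whereas \<open>'l\<close>
  is any type at least as large as \<open>'u\<close>.\<close>

theorem corollary3p25:
  assumes "inaccessible_universe TYPE('u)"
    and "|UNIV :: 'u set| \<le>o |UNIV :: 'l set|"
  shows "(\<forall>C :: ('o, 'a) system_category. transfer_category TYPE('u) C \<longrightarrow>
            (has_inducing_form TYPE('u) C \<longleftrightarrow>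
             (\<exists>T. transfer_functor TYPE('u) C
                    (Mlc TYPE('u) :: ('l gorder, ('l, 'l) galois) system_category) T)))
    \<and> universal_target TYPE('u) TYPE('o) TYPE('a)
        (Mlc TYPE('u) :: ('l gorder, ('l, 'l) galois) system_category)
    \<and> transfer_category TYPE('u)
        (Ab_cat TYPE('u) :: (('u \<Rightarrow>\<^sub>0 int) monoid, _) system_category)
    \<and> is_functor (Set_cat TYPE('u)) (Ab_cat TYPE('u))
        (free_ab_functor :: ('u set, _, _, _) functor_data)
    \<and> is_functor (Ab_cat TYPE('u)) (Mlc TYPE('u))
        (Sub_functor :: (('u \<Rightarrow>\<^sub>0 int) monoid, _, _, _) functor_data)
    \<and> transfer_functor TYPE('u)
        (Set_cat TYPE('u) :: ('u set, _) system_category)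
        (Mlc TYPE('u) :: (('u \<Rightarrow>\<^sub>0 int) set gorder, _) system_category)
        (comp_functor Sub_functor free_ab_functor)"
proof (intro conjI)
  interpret A: concrete_system "TYPE('u)"
    "Ab_cat TYPE('u) :: (('u \<Rightarrow>\<^sub>0 int) monoid, _) system_category" carrier action
    by (rule concrete_system_Ab[OF assms(1)])
  show "\<forall>C :: ('o, 'a) system_category. transfer_category TYPE('u) C \<longrightarrow>
      (has_inducing_form TYPE('u) C \<longleftrightarrow>
       (\<exists>T. transfer_functor TYPE('u) C
          (Mlc TYPE('u) :: ('l gorder, ('l, 'l) galois) system_category) T))"
    using inducing_form_iff_transfer_functor[OF assms] by blast
  then show "universal_target TYPE('u) TYPE('o) TYPE('a)
      (Mlc TYPE('u) :: ('l gorder, ('l, 'l) galois) system_category)"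
    unfolding universal_target_def using transfer_category_Mlc[OF assms(1)] by blast
  show "transfer_category TYPE('u) (Ab_cat TYPE('u) :: (('u \<Rightarrow>\<^sub>0 int) monoid, _) system_category)"
    by (rule A.transfer_category_axioms)
qed (rule is_functor_free_ab[OF assms(1)] is_functor_Sub[OF assms(1)] transfer_functor_Sub_free[OF assms(1)])+

end
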